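(* Let $G=GL(m|n)$ over a field $K$ of characteristic zero, let $l$ be an integer, and let $X(T)^+_l=\{\lambda\in X(T)^+\mid|\lambda|=l\}$. Let $\pi_l=\pi_{X(T)^+_l}:Dist(G)\to S_{X(T)^+_l}$ be the restriction morphism, and let $I_l$ be the superideal of $Dist(G)$ generated by $J_l=\ker\pi_l\cap Dist(T)$. Then $\ker\pi_l=I_l$.
   Context: $K$ is a field of characteristic zero, $m,n\ge1$, $G=GL(m|n)$ with coordinate Hopf superalgebra $K[G]$; left $G$-supermodules are right $K[G]$-supercomodules, $\rho_r$ is the structure on $K[G]$ given by $\Delta_G$. $T$ is the diagonal torus, $X(T)=\mathbb Z^{m+n}$ with basis $\epsilon_i$, $|\lambda|=\sum_i\lambda_i$. $X(T)^+$ is the set of dominant weights ($\lambda_1\ge\dots\ge\lambda_m$, $\lambda_{m+1}\ge\dots\ge\lambda_{m+n}$), ordered by $\mu\unlhd\lambda$ iff $\lambda-\mu$ is a nonnegative integer combination of $\epsilon_i-\epsilon_j$, $i<j$; an ideal is a down-closed subset ($X(T)^+_l$ is an ideal). $L_-(\lambda)$ is the simple socle of $H^0_-(\lambda)=\mathrm{ind}^G_{B^-}K_\lambda$ ($B^-$ lower triangular Borel); irreducible $G$-supermodules are $L_-(\lambda)$, $\Pi L_-(\lambda)$ ($\Pi$ parity shift). For an ideal $\Gamma$, $C_\Gamma=O_\Gamma(K[G])$ is the largest subsupermodule of $(K[G],\rho_r)$ all of whose composition factors are $L_-(\lambda)$ or $\Pi L_-(\lambda)$ with $\lambda\in\Gamma$;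 it is a subsupercoalgebra, and $S_\Gamma=C_\Gamma^*$. $Dist(G)=\bigcup_{t\ge0}(K[G]/\mathfrak m^{t+1})^*\subseteq K[G]^*$, $\mathfrak m=\ker\epsilon_G$, is the distribution superalgebra with product $\phi\psi(f)=\sum(-1)^{|\psi||f_1|}\phi(f_1)\psi(f_2)$, $Dist(T)\subseteq Dist(G)$ is that of $T$, and $\pi_\Gamma:Dist(G)\to S_\Gamma$ is $\xi\mapsto\xi|_{C_\Gamma}$. *)

theory Defs
  imports Complex_Main "HOL-Library.Poly_Mapping" "HOL-Library.FuncSet"
begin

section \<open>Generalities\<close>

text \<open>Words form the free monoid, which is written additively so that \<open>'x word \<Rightarrow>\<^sub>0 'k\<close>
  becomes the free associative algebra on \<open>'x\<close>.\<close>

datatype 'x word = Word (letters: "'x list")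

instantiation word :: (type) monoid_add
begin
definition zero_word where "0 = Word []"
definition plus_word where "u + v = Word (letters u @ letters v)"
instance by standard (auto simp: zero_word_def plus_word_def word.expand)
end

inductive_set ideal_gen :: "'r::ring_1 set \<Rightarrow> 'r set" for R where
  zero: "0 \<in> ideal_gen R"
| add: "\<lbrakk>x \<in> ideal_gen R; r \<in> R\<rbrakk> \<Longrightarrow> x + a * r * b \<in> ideal_gen R"

text \<open>The Koszul sign of interchanging elements of parities \<^term>\<open>p\<close> and \<^term>\<open>q\<close>
  (\<^const>\<open>True\<close> is odd).\<close>

definition ksign :: "bool \<Rightarrow> bool \<Rightarrow> 'r::ring_1" where
  "ksign p q = (if p \<and> q then -1 else 1)"

text \<open>The algebra homomorphism on a free algebra sending the generator \<^term>\<open>x\<close> to \<^term>\<open>g x\<close>;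
  \<^term>\<open>\<iota>\<close> is the structure map from the ground field.\<close>

definition free_eval :: "('k::zero \<Rightarrow> 'r::ring_1) \<Rightarrow> ('x \<Rightarrow> 'r) \<Rightarrow> ('x word \<Rightarrow>\<^sub>0 'k) \<Rightarrow> 'r" where
  "free_eval \<iota> g f = (\<Sum>w\<in>Poly_Mapping.keys f. \<iota> (Poly_Mapping.lookup f w) * prod_list (map g (letters w)))"

lemma ideal_gen_base: "r \<in> R \<Longrightarrow> a * r * b \<in> ideal_gen R"
  using ideal_gen.add[OF ideal_gen.zero] by force

lemma ideal_gen_superset: "r \<in> R \<Longrightarrow> r \<in> ideal_gen R"
  using ideal_gen_base[of r R 1 1] by simp

lemma ideal_gen_plus:
  assumes "x \<in> ideal_gen R" "y \<in> ideal_gen R" shows "x + y \<in> ideal_gen R"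
  using assms(2)
proof induction
  case (add y r a b)
  then show ?case using ideal_gen.add[of "x + y" R r a b] by (simp add: add.assoc)
qed (simp add: assms)

lemma ideal_gen_mult: "x \<in> ideal_gen R \<Longrightarrow> c * x * d \<in> ideal_gen R"
proof (induction x rule: ideal_gen.induct)
  case (add x r a b)
  then show ?case using ideal_gen.add[of "c * x * d" R r "c * a" "b * d"]
    by (simp add: algebra_simps)
qed (simp add: ideal_gen.zero)

lemma ideal_gen_lmult: "x \<in> ideal_gen R \<Longrightarrow> c * x \<in> ideal_gen R"
  using ideal_gen_mult[of x R c 1] by simp

lemma ideal_gen_rmult: "x \<in> ideal_gen R \<Longrightarrow> x * c \<in> ideal_gen R"
  using ideal_gen_mult[of x R 1 c] by simp

lemma ideal_gen_uminus: "x \<in> ideal_gen R \<Longrightarrow> - x \<in> ideal_gen R"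
  using ideal_gen_lmult[of x R "-1"] by simp

lemma ideal_gen_minus: "\<lbrakk>x \<in> ideal_gen R; y \<in> ideal_gen R\<rbrakk> \<Longrightarrow> x - y \<in> ideal_gen R"
  using ideal_gen_plus[of x R "- y"] ideal_gen_uminus[of y R] by simp

lemma letters_plus [simp]: "letters (u + v) = letters u @ letters v"
  by (simp add: plus_word_def)

lemma letters_zero [simp]: "letters 0 = []"
  by (simp add: zero_word_def)

lemma sum_superset_keys:
  "\<lbrakk>finite S; Poly_Mapping.keys f \<subseteq> S; \<And>w. h w 0 = 0\<rbrakk>
    \<Longrightarrow> (\<Sum>w\<in>Poly_Mapping.keys f. h w (Poly_Mapping.lookup f w)) = (\<Sum>w\<in>S. h w (Poly_Mapping.lookup f w))"
  by (rule sum.mono_neutral_left) (auto simp: in_keys_iff)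

lemma sum_keys_add:
  assumes "\<And>w. h w 0 = 0" "\<And>w a b. h w (a + b) = h w a + h w b"
  shows "(\<Sum>w\<in>Poly_Mapping.keys (f + g). h w (Poly_Mapping.lookup (f + g) w))
    = (\<Sum>w\<in>Poly_Mapping.keys f. h w (Poly_Mapping.lookup f w)) + (\<Sum>w\<in>Poly_Mapping.keys g. h w (Poly_Mapping.lookup g w))"
proof -
  let ?S = "Poly_Mapping.keys f \<union> Poly_Mapping.keys g"
  have "Poly_Mapping.keys (f + g) \<subseteq> ?S" by (rule Poly_Mapping.keys_add)
  then show ?thesis
    by (simp add: sum_superset_keys[where S = ?S and h = h] assms(1))
      (simp add: assms(2) lookup_add sum.distrib)
qed

lemma sum_keys_single:
  "h w 0 = 0 \<Longrightarrow> (\<Sum>v\<in>Poly_Mapping.keys (Poly_Mapping.single w c). h v (Poly_Mapping.lookup (Poly_Mapping.single w c) v)) = h w c"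
  by simp

lemma poly_mapping_add_induct [case_names zero add]:
  fixes f :: "'a \<Rightarrow>\<^sub>0 'k::monoid_add"
  assumes "P 0" "\<And>f w c. P f \<Longrightarrow> P (Poly_Mapping.single w c + f)"
  shows "P f"
proof (induction f rule: update_induct)
  case const show ?case by (simp add: assms)
next
  case (update f a b)
  have "Poly_Mapping.update a b f = Poly_Mapping.single a b + f"
    using update(1) by (intro poly_mapping_eqI) (auto simp: Poly_Mapping.update.rep_eq lookup_add lookup_single when_def in_keys_iff)
  with update(3) assms(2) show ?case by simp
qed

locale free_eval_hom =
  fixes \<iota> :: "'k::comm_ring_1 \<Rightarrow> 'r::ring_1" and g :: "'x \<Rightarrow> 'r"
  assumes iota_add: "\<iota> (a + b) = \<iota> a + \<iota> b"
    and iota_mult: "\<iota> (a * b) = \<iota> a * \<iota> b"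
    and iota_one: "\<iota> 1 = 1"
    and iota_central: "\<iota> a * x = x * \<iota> a"
begin

lemma iota_zero: "\<iota> 0 = 0"
  using iota_add[of 0 0] by simp

lemma fe_add: "free_eval \<iota> g (f + h) = free_eval \<iota> g f + free_eval \<iota> g h"
  unfolding free_eval_def
  by (rule sum_keys_add[where h = "\<lambda>w c. \<iota> c * prod_list (map g (letters w))"])
    (auto simp: iota_zero iota_add algebra_simps)

lemma fe_single: "free_eval \<iota> g (Poly_Mapping.single w c) = \<iota> c * prod_list (map g (letters w))"
  by (cases "c = 0") (simp_all add: free_eval_def iota_zero)

lemma fe_zero: "free_eval \<iota> g 0 = 0"
  by (simp add: free_eval_def)

lemma fe_one: "free_eval \<iota> g 1 = 1"
  by (simp add: single_one[symmetric] fe_single iota_one del: single_one)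

lemma fe_minus: "free_eval \<iota> g (f - h) = free_eval \<iota> g f - free_eval \<iota> g h"
  using fe_add[of "f - h" h] by simp

lemma fe_mult: "free_eval \<iota> g (f * h) = free_eval \<iota> g f * free_eval \<iota> g h"
proof (induction f rule: poly_mapping_add_induct)
  case (add f w c)
  have "free_eval \<iota> g (Poly_Mapping.single w c * h) = free_eval \<iota> g (Poly_Mapping.single w c) * free_eval \<iota> g h"
  proof (induction h rule: poly_mapping_add_induct)
    case (add h v d)
    have "\<iota> c * \<iota> d * (prod_list (map g (letters w)) * prod_list (map g (letters v)))
      = \<iota> c * prod_list (map g (letters w)) * (\<iota> d * prod_list (map g (letters v)))"
      by (metis iota_central mult.assoc)
    with add show ?case
      by (simp add: distrib_left mult_single fe_add fe_single iota_mult)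
  qed (simp add: fe_zero)
  with add show ?case by (simp add: distrib_right fe_add)
qed (simp add: fe_zero)

lemma fe_ideal:
  assumes "\<And>r. r \<in> R \<Longrightarrow> free_eval \<iota> g r = 0" "x \<in> ideal_gen R"
  shows "free_eval \<iota> g x = 0"
  using assms(2) by induction (simp_all add: fe_zero fe_add fe_mult assms(1))

lemma fe_sum: "free_eval \<iota> g (sum F A) = (\<Sum>k\<in>A. free_eval \<iota> g (F k))"
  by (induction A rule: infinite_finite_induct) (simp_all add: fe_zero fe_add)

end

section \<open>The coordinate superalgebra of $GL(m|n)$\<close>

text \<open>Matrix indices are elements of \<^typ>\<open>'m + 'n\<close> with $m$ = CARD('m), $n$ = CARD('n); an index
  is odd iff it comes from the second summand.  The coordinate superalgebra represents the functor
  of invertible even $(m|n)\times(m|n)$-matrices: it is the supercommutative superalgebra generated by the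
  entries $c_{ij}$ of the generic matrix and the entries $s_{ij}$ of its inverse.  (Inverting the
  generic matrix is the same as inverting the determinants of its two diagonal blocks.)\<close>

datatype ('m, 'n) gen = Cgen "'m + 'n" "'m + 'n" | Sgen "'m + 'n" "'m + 'n"

fun odd_index :: "'m + 'n \<Rightarrow> bool" where
  "odd_index (Inl i) = False"
| "odd_index (Inr j) = True"

fun gen_par :: "('m, 'n) gen \<Rightarrow> bool" where
  "gen_par (Cgen i j) = (odd_index i \<noteq> odd_index j)"
| "gen_par (Sgen i j) = (odd_index i \<noteq> odd_index j)"

definition word_par :: "('m, 'n) gen word \<Rightarrow> bool" where
  "word_par w = odd (length (filter gen_par (letters w)))"

definition free_gen :: "'x \<Rightarrow> 'x word \<Rightarrow>\<^sub>0 'k::{zero, one}" where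
  "free_gen x = Poly_Mapping.single (Word [x]) 1"

lift_definition free_part :: "bool \<Rightarrow> (('m, 'n) gen word \<Rightarrow>\<^sub>0 'k::zero) \<Rightarrow> ('m, 'n) gen word \<Rightarrow>\<^sub>0 'k"
  is "\<lambda>p f w. if word_par w = p then f w else 0"
  by (erule rev_finite_subset) auto

definition gl_rels :: "(('m::finite, 'n::finite) gen word \<Rightarrow>\<^sub>0 'k::field_char_0) set" where
  "gl_rels =
     {free_gen x * free_gen y - ksign (gen_par x) (gen_par y) * (free_gen y * free_gen x) | x y. True}
   \<union> {(\<Sum>k\<in>UNIV. free_gen (Cgen i k) * free_gen (Sgen k j)) - of_bool (i = j) | i j. True}
   \<union> {(\<Sum>k\<in>UNIV. free_gen (Sgen i k) * free_gen (Cgen k j)) - of_bool (i = j) | i j. True}"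

quotient_type (overloaded) ('k, 'm, 'n) gl = "('m::finite, 'n::finite) gen word \<Rightarrow>\<^sub>0 'k::field_char_0" /
  "\<lambda>x y. x - y \<in> ideal_gen gl_rels"
proof (rule equivpI)
  show "reflp (\<lambda>x y. x - y \<in> ideal_gen gl_rels)"
    by (auto simp: reflp_def ideal_gen.zero)
  show "symp (\<lambda>x y. x - y \<in> ideal_gen gl_rels)"
    by (rule sympI) (drule ideal_gen_uminus, simp)
  show "transp (\<lambda>x y. x - y \<in> ideal_gen gl_rels)"
    by (rule transpI) (drule (1) ideal_gen_plus, simp)
qed

fun eps_gen :: "('m, 'n) gen \<Rightarrow> 'k::field_char_0" where
  "eps_gen (Cgen i j) = of_bool (i = j)"
| "eps_gen (Sgen i j) = of_bool (i = j)"

lemma eps_hom: "free_eval_hom (\<lambda>c::'k::field_char_0. c)"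
  by standard auto

lemma eps_gen_odd: "gen_par x \<Longrightarrow> eps_gen x = 0"
  by (cases x) auto

lemma eval_gen:
  assumes "free_eval_hom \<iota>" shows "free_eval \<iota> g (free_gen x) = g x"
  by (simp add: free_gen_def free_eval_hom.fe_single[OF assms] free_eval_hom.iota_one[OF assms])

lemma eval_ksign:
  assumes "free_eval_hom \<iota>" shows "free_eval \<iota> g (ksign p q) = ksign p q"
  using free_eval_hom.fe_minus[OF assms, of g 0 1]
  by (simp add: ksign_def free_eval_hom.fe_zero[OF assms] free_eval_hom.fe_one[OF assms])

lemma eval_of_bool:
  assumes "free_eval_hom \<iota>" shows "free_eval \<iota> g (of_bool b) = of_bool b"
  by (cases b) (simp_all add: free_eval_hom.fe_zero[OF assms] free_eval_hom.fe_one[OF assms])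

lemmas eval_simps = eval_gen eval_ksign eval_of_bool free_eval_hom.fe_zero free_eval_hom.fe_one
  free_eval_hom.fe_add free_eval_hom.fe_minus free_eval_hom.fe_mult free_eval_hom.fe_sum

lemma sum_of_bool_mult:
  fixes f :: "'i::finite \<Rightarrow> 'r::ring_1"
  shows "(\<Sum>k\<in>UNIV. of_bool (i = k) * f k) = f i" "(\<Sum>k\<in>UNIV. f k * of_bool (k = i)) = f i"
  by (simp_all add: of_bool_def if_distrib[of "\<lambda>x. x * _"] if_distrib[of "\<lambda>x. _ * x"] cong: if_cong)

lemma eps_rels: "r \<in> gl_rels \<Longrightarrow> free_eval (\<lambda>c. c) eps_gen r = 0"
  unfolding gl_rels_def
  by (auto simp: eval_simps[OF eps_hom] sum_of_bool_mult ksign_def eps_gen_odd)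

lemma eps_ideal: "r \<in> ideal_gen gl_rels \<Longrightarrow> free_eval (\<lambda>c. c) eps_gen r = 0"
  by (rule free_eval_hom.fe_ideal[OF eps_hom]) (auto intro: eps_rels)

instantiation gl :: (field_char_0, finite, finite) ring_1
begin
lift_definition zero_gl :: "('a, 'b, 'c) gl" is 0 .
lift_definition one_gl :: "('a, 'b, 'c) gl" is 1 .
lift_definition plus_gl :: "('a, 'b, 'c) gl \<Rightarrow> ('a, 'b, 'c) gl \<Rightarrow> ('a, 'b, 'c) gl" is "(+)"
  by (metis add_diff_add ideal_gen_plus)
lift_definition minus_gl :: "('a, 'b, 'c) gl \<Rightarrow> ('a, 'b, 'c) gl \<Rightarrow> ('a, 'b, 'c) gl" is "(-)"
proof -
  fix a b c d :: "('b, 'c) gen word \<Rightarrow>\<^sub>0 'a"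
  assume "a - b \<in> ideal_gen gl_rels" "c - d \<in> ideal_gen gl_rels"
  from ideal_gen_minus[OF this] show "a - c - (b - d) \<in> ideal_gen gl_rels"
    by (simp add: algebra_simps)
qed
lift_definition uminus_gl :: "('a, 'b, 'c) gl \<Rightarrow> ('a, 'b, 'c) gl" is uminus
  by (metis ideal_gen_uminus minus_diff_minus)
lift_definition times_gl :: "('a, 'b, 'c) gl \<Rightarrow> ('a, 'b, 'c) gl \<Rightarrow> ('a, 'b, 'c) gl" is "(*)"
proof -
  fix a b c d :: "('b, 'c) gen word \<Rightarrow>\<^sub>0 'a"
  assume "a - b \<in> ideal_gen gl_rels" "c - d \<in> ideal_gen gl_rels"
  then have "(a - b) * c + b * (c - d) \<in> ideal_gen gl_rels"
    by (intro ideal_gen_plus ideal_gen_lmult ideal_gen_rmult)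
  then show "a * c - b * d \<in> ideal_gen gl_rels" by (simp add: algebra_simps)
qed
instance
proof
  show "(0 :: ('a, 'b, 'c) gl) \<noteq> 1"
    by transfer (use eps_ideal ideal_gen_uminus in \<open>force simp: eval_simps[OF eps_hom]\<close>)
qed (transfer; simp add: algebra_simps ideal_gen.zero)+
end


lift_definition gl_scale :: "'k \<Rightarrow> ('k::field_char_0, 'm::finite, 'n::finite) gl \<Rightarrow> ('k, 'm, 'n) gl"
  is "\<lambda>c f. Poly_Mapping.single 0 c * f"
  by (metis ideal_gen_lmult right_diff_distrib)

lift_definition gl_gen :: "('m, 'n) gen \<Rightarrow> ('k::field_char_0, 'm::finite, 'n::finite) gl"
  is free_gen .

abbreviation cc :: "'m + 'n \<Rightarrow> 'm + 'n \<Rightarrow> ('k::field_char_0, 'm::finite, 'n::finite) gl" where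
  "cc i j \<equiv> gl_gen (Cgen i j)"

abbreviation ss :: "'m + 'n \<Rightarrow> 'm + 'n \<Rightarrow> ('k::field_char_0, 'm::finite, 'n::finite) gl" where
  "ss i j \<equiv> gl_gen (Sgen i j)"

lemma single0_mult_commute:
  "Poly_Mapping.single 0 c * f = f * Poly_Mapping.single (0::'x::monoid_add) (c::'k::comm_ring_1)"
proof (induction f rule: poly_mapping_add_induct)
  case (add f w d)
  then show ?case by (simp add: distrib_left distrib_right mult_single mult.commute)
qed simp

lemma single0_left_commute:
  "Poly_Mapping.single (0::'x::monoid_add) (c::'k::comm_ring_1) * (f * g) = f * (Poly_Mapping.single 0 c * g)"
  unfolding mult.assoc[symmetric] single0_mult_commute[of c f] ..

global_interpretation gl: vector_space gl_scale
  by standard (transfer; simp add: distrib_left distrib_right single_add mult_single ideal_gen.zero flip: mult.assoc)+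

lemma gl_scale_mult: "gl_scale c (x * y) = gl_scale c x * y" "gl_scale c (x * y) = x * gl_scale c y"
proof -
  show "gl_scale c (x * y) = gl_scale c x * y"
    by transfer (simp add: mult.assoc ideal_gen.zero)
  show "gl_scale c (x * y) = x * gl_scale c y"
    by transfer (simp add: single0_left_commute ideal_gen.zero)
qed

subsection \<open>Parity\<close>

lemma word_par_plus: "word_par (u + v) = (word_par u \<noteq> word_par v)"
  by (auto simp: word_par_def)

lemma lookup_free_part:
  "Poly_Mapping.lookup (free_part p f) w = (if word_par w = p then Poly_Mapping.lookup f w else 0)"
  by (simp add: free_part.rep_eq)

lemma free_part_add: "free_part p (f + g) = free_part p f + free_part p (g :: _ \<Rightarrow>\<^sub>0 'k::monoid_add)"
  by (rule poly_mapping_eqI) (simp add: lookup_free_part lookup_add)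

lemma free_part_zero [simp]: "free_part p 0 = 0"
  by (rule poly_mapping_eqI) (simp add: lookup_free_part)

lemma free_part_diff: "free_part p (f - g) = free_part p f - free_part p (g :: _ \<Rightarrow>\<^sub>0 'k::ab_group_add)"
  by (rule poly_mapping_eqI) (simp add: lookup_free_part lookup_minus)

lemma free_part_single:
  "free_part p (Poly_Mapping.single w c) = (if word_par w = p then Poly_Mapping.single w c else 0)"
  by (rule poly_mapping_eqI) (auto simp: lookup_free_part lookup_single when_def)

lemma free_part_sum_parts: "free_part True f + free_part False f = (f :: _ \<Rightarrow>\<^sub>0 'k::monoid_add)"
  by (rule poly_mapping_eqI) (simp add: lookup_free_part lookup_add)

lemma free_part_part: "free_part p (free_part q f) = (if p = q then free_part p f else 0)"
  by (rule poly_mapping_eqI) (auto simp: lookup_free_part)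

lemma free_part_mult:
  "free_part p (f * g) = free_part True f * free_part (\<not> p) g + free_part False f * free_part p (g :: _ \<Rightarrow>\<^sub>0 'k::comm_ring_1)"
proof (induction f rule: poly_mapping_add_induct)
  case (add f u c)
  have "free_part p (Poly_Mapping.single u c * g)
    = free_part True (Poly_Mapping.single u c) * free_part (\<not> p) g
      + free_part False (Poly_Mapping.single u c) * free_part p g"
  proof (induction g rule: poly_mapping_add_induct)
    case (add g v d)
    then show ?case
      by (auto simp: distrib_left free_part_add mult_single free_part_single word_par_plus)
  qed simp
  with add show ?case by (simp add: distrib_right free_part_add)
qed simp

lemma free_part_gen: "free_part p (free_gen x) = (if gen_par x = p then free_gen x else 0)"
  by (auto simp: free_gen_def free_part_single word_par_def)

lemma free_part_one: "free_part p 1 = (if p then 0 else 1)"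
  by (simp add: single_one[symmetric] free_part_single word_par_def del: single_one)

lemma free_part_of_bool: "free_part p (of_bool b) = (if p then 0 else of_bool b)"
  by (cases b) (simp_all add: free_part_one)

lemma free_part_sum: "free_part p (sum F A) = (\<Sum>k\<in>A. free_part p (F k :: _ \<Rightarrow>\<^sub>0 'k::comm_monoid_add))"
  by (induction A rule: infinite_finite_induct) (simp_all add: free_part_add)

lemma gl_rels_homogeneous:
  fixes r :: "('m::finite, 'n::finite) gen word \<Rightarrow>\<^sub>0 'k::field_char_0"
  assumes "r \<in> gl_rels" shows "\<exists>q. free_part q r = r \<and> free_part (\<not> q) r = 0"
proof -
  have *: "free_part (gen_par x \<noteq> gen_par y) (free_gen x * free_gen y) = (free_gen x * free_gen y :: _ \<Rightarrow>\<^sub>0 'k)"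
    "free_part (\<not> (gen_par x \<noteq> gen_par y)) (free_gen x * free_gen y) = (0 :: _ \<Rightarrow>\<^sub>0 'k)" for x y :: "('m, 'n) gen"
    by (auto simp: free_part_mult free_part_gen)
  from assms consider
      (comm) x y where "r = free_gen x * free_gen y - ksign (gen_par x) (gen_par y) * (free_gen y * free_gen x)"
    | (cs) i j where "r = (\<Sum>k\<in>UNIV. free_gen (Cgen i k) * free_gen (Sgen k j)) - of_bool (i = j)"
    | (sc) i j where "r = (\<Sum>k\<in>UNIV. free_gen (Sgen i k) * free_gen (Cgen k j)) - of_bool (i = j)"
    unfolding gl_rels_def by blast
  then show ?thesis
  proof cases
    case comm
    have "free_part q (ksign a b * f) = ksign a b * free_part q f" for q a b and f :: "('m, 'n) gen word \<Rightarrow>\<^sub>0 'k"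
      using free_part_diff[of q 0 f] by (simp add: ksign_def)
    moreover have **: "free_part (gen_par x \<noteq> gen_par y) (free_gen y * free_gen x) = (free_gen y * free_gen x :: _ \<Rightarrow>\<^sub>0 'k)"
      "free_part (\<not> (gen_par x \<noteq> gen_par y)) (free_gen y * free_gen x) = (0 :: _ \<Rightarrow>\<^sub>0 'k)"
      by (auto simp: free_part_mult free_part_gen)
    ultimately show ?thesis
      using *[of x y] ** by (intro exI[of _ "gen_par x \<noteq> gen_par y"]) (simp add: comm free_part_diff)
  next
    case cs
    have "free_part (odd_index i \<noteq> odd_index j) (free_gen (Cgen i k) * free_gen (Sgen k j)) = (free_gen (Cgen i k) * free_gen (Sgen k j) :: _ \<Rightarrow>\<^sub>0 'k)"
      "free_part (\<not> (odd_index i \<noteq> odd_index j)) (free_gen (Cgen i k) * free_gen (Sgen k j)) = (0 :: _ \<Rightarrow>\<^sub>0 'k)" for k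
      by (auto simp: free_part_mult free_part_gen)
    then show ?thesis
      by (intro exI[of _ "odd_index i \<noteq> odd_index j"]) (auto simp: cs free_part_diff free_part_sum free_part_of_bool)
  next
    case sc
    have "free_part (odd_index i \<noteq> odd_index j) (free_gen (Sgen i k) * free_gen (Cgen k j)) = (free_gen (Sgen i k) * free_gen (Cgen k j) :: _ \<Rightarrow>\<^sub>0 'k)"
      "free_part (\<not> (odd_index i \<noteq> odd_index j)) (free_gen (Sgen i k) * free_gen (Cgen k j)) = (0 :: _ \<Rightarrow>\<^sub>0 'k)" for k
      by (auto simp: free_part_mult free_part_gen)
    then show ?thesis
      by (intro exI[of _ "odd_index i \<noteq> odd_index j"]) (auto simp: sc free_part_diff free_part_sum free_part_of_bool)
  qed
qed

lemma free_part_rels: "r \<in> gl_rels \<Longrightarrow> free_part p r = r \<or> free_part p r = 0"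
  by (drule gl_rels_homogeneous, elim exE, case_tac "p = q") auto

lemma free_part_ideal: "x \<in> ideal_gen gl_rels \<Longrightarrow> free_part p x \<in> ideal_gen gl_rels"
proof (induction x rule: ideal_gen.induct)
  case (add x r a b)
  have "free_part q r \<in> ideal_gen gl_rels" for q
    using free_part_rels[OF add.hyps(2), of q] add.hyps(2) by (auto intro: ideal_gen.zero ideal_gen_superset)
  then show ?case
    using add.IH unfolding free_part_add free_part_mult[of _ "a * r" b] free_part_mult[of _ a r]
    by (intro ideal_gen_plus ideal_gen_rmult[of "_ + _"] ideal_gen_lmult)
qed (simp add: ideal_gen.zero)

lift_definition gl_part :: "bool \<Rightarrow> ('k::field_char_0, 'm::finite, 'n::finite) gl \<Rightarrow> ('k, 'm, 'n) gl"
  is free_part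
  by (metis free_part_diff free_part_ideal)

lemma gl_part_add: "gl_part p (f + g) = gl_part p f + gl_part p g"
  by transfer (simp add: free_part_add ideal_gen.zero)

lemma gl_part_zero [simp]: "gl_part p 0 = 0"
  by transfer (simp add: ideal_gen.zero)

lemma gl_part_scale: "gl_part p (gl_scale c f) = gl_scale c (gl_part p f)"
  by transfer (simp add: free_part_mult free_part_single word_par_def ideal_gen.zero)

lemma gl_part_sum_parts: "gl_part True f + gl_part False f = f"
  by transfer (simp add: free_part_sum_parts ideal_gen.zero)

lemma gl_part_part: "gl_part p (gl_part q f) = (if p = q then gl_part p f else 0)"
  by transfer (simp add: free_part_part ideal_gen.zero)

lemma gl_part_mult:
  "gl_part p (f * g) = gl_part True f * gl_part (\<not> p) g + gl_part False f * gl_part p g"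
  by transfer (simp add: free_part_mult ideal_gen.zero)

lemma gl_part_one: "gl_part p 1 = (if p then 0 else 1)"
  by transfer (simp add: free_part_one ideal_gen.zero)

lemma gl_part_gen: "gl_part p (gl_gen x) = (if gen_par x = p then gl_gen x else 0)"
  by transfer (simp add: free_part_gen ideal_gen.zero)


subsection \<open>The tensor square\<close>

definition pm_scale :: "'k \<Rightarrow> ('x \<Rightarrow>\<^sub>0 'k::field) \<Rightarrow> 'x \<Rightarrow>\<^sub>0 'k" where
  "pm_scale c = Poly_Mapping.map ((*) c)"

lemma lookup_pm_scale: "Poly_Mapping.lookup (pm_scale c f) x = c * Poly_Mapping.lookup f x"
  by (simp add: pm_scale_def Poly_Mapping.map.rep_eq when_def)

global_interpretation pm: vector_space pm_scale
  by standard (auto intro!: poly_mapping_eqI simp: lookup_pm_scale lookup_add algebra_simps)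

abbreviation pm_basis :: "'x \<Rightarrow> 'x \<Rightarrow>\<^sub>0 'k::field" where
  "pm_basis x \<equiv> Poly_Mapping.single x 1"

definition tensor_rels :: "(('k::field_char_0, 'm::finite, 'n::finite) gl \<times> ('k, 'm, 'n) gl \<Rightarrow>\<^sub>0 'k) set" where
  "tensor_rels =
     {pm_basis (a + a', b) - pm_basis (a, b) - pm_basis (a', b) | a a' b. True}
   \<union> {pm_basis (a, b + b') - pm_basis (a, b) - pm_basis (a, b') | a b b'. True}
   \<union> {pm_basis (gl_scale c a, b) - pm_scale c (pm_basis (a, b)) | c a b. True}
   \<union> {pm_basis (a, gl_scale c b) - pm_scale c (pm_basis (a, b)) | c a b. True}"

quotient_type (overloaded) ('k, 'm, 'n) gl2 =
  "('k::field_char_0, 'm::finite, 'n::finite) gl \<times> ('k, 'm, 'n) gl \<Rightarrow>\<^sub>0 'k" /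
  "\<lambda>x y. x - y \<in> pm.span tensor_rels"
proof (rule equivpI)
  show "reflp (\<lambda>x y. x - y \<in> pm.span tensor_rels)"
    by (auto simp: reflp_def pm.span_zero)
  show "symp (\<lambda>x y. x - y \<in> pm.span tensor_rels)"
    by (rule sympI) (drule pm.span_neg, simp)
  show "transp (\<lambda>x y. x - y \<in> pm.span tensor_rels)"
    by (rule transpI) (drule (1) pm.span_add, simp)
qed

instantiation gl2 :: (field_char_0, finite, finite) ab_group_add
begin
lift_definition zero_gl2 :: "('a, 'b, 'c) gl2" is 0 .
lift_definition plus_gl2 :: "('a, 'b, 'c) gl2 \<Rightarrow> ('a, 'b, 'c) gl2 \<Rightarrow> ('a, 'b, 'c) gl2" is "(+)"
  by (metis add_diff_add pm.span_add)
lift_definition minus_gl2 :: "('a, 'b, 'c) gl2 \<Rightarrow> ('a, 'b, 'c) gl2 \<Rightarrow> ('a, 'b, 'c) gl2" is "(-)"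
proof -
  fix a b c d :: "('a, 'b, 'c) gl \<times> ('a, 'b, 'c) gl \<Rightarrow>\<^sub>0 'a"
  assume "a - b \<in> pm.span tensor_rels" "c - d \<in> pm.span tensor_rels"
  from pm.span_diff[OF this] show "a - c - (b - d) \<in> pm.span tensor_rels"
    by (simp add: algebra_simps)
qed
lift_definition uminus_gl2 :: "('a, 'b, 'c) gl2 \<Rightarrow> ('a, 'b, 'c) gl2" is uminus
  by (metis pm.span_neg minus_diff_minus)
instance
  by standard (transfer; simp add: algebra_simps pm.span_zero)+
end

lift_definition gl2_scale :: "'k \<Rightarrow> ('k::field_char_0, 'm::finite, 'n::finite) gl2 \<Rightarrow> ('k, 'm, 'n) gl2"
  is pm_scale
  by (metis pm.span_scale pm.scale_right_diff_distrib)

global_interpretation gl2: vector_space gl2_scale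
  by standard (transfer; simp add: pm.scale_right_distrib pm.scale_left_distrib pm.span_zero)+

definition tens :: "('k::field_char_0, 'm::finite, 'n::finite) gl \<Rightarrow> ('k, 'm, 'n) gl \<Rightarrow> ('k, 'm, 'n) gl2"
  where "tens a b = abs_gl2 (pm_basis (a, b))"

text \<open>The linear map out of the tensor square induced by a bilinear map \<^term>\<open>\<beta>\<close>
  into a vector space with scalar multiplication \<^term>\<open>s\<close>; for bilinear \<^term>\<open>\<beta>\<close> the chosen
  representative is irrelevant.\<close>

definition pm_lift :: "('k \<Rightarrow> 'v \<Rightarrow> 'v) \<Rightarrow> ('x \<Rightarrow> 'v) \<Rightarrow> ('x \<Rightarrow>\<^sub>0 'k::field) \<Rightarrow> 'v::comm_monoid_add" where
  "pm_lift s g f = (\<Sum>x\<in>Poly_Mapping.keys f. s (Poly_Mapping.lookup f x) (g x))"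

definition tensor_lift ::
  "('k \<Rightarrow> 'v \<Rightarrow> 'v) \<Rightarrow> (('k, 'm, 'n) gl \<Rightarrow> ('k, 'm, 'n) gl \<Rightarrow> 'v)
    \<Rightarrow> ('k::field_char_0, 'm::finite, 'n::finite) gl2 \<Rightarrow> 'v::ab_group_add" where
  "tensor_lift s \<beta> t = pm_lift s (\<lambda>(a, b). \<beta> a b) (rep_gl2 t)"

definition gl_bilinear ::
  "('k \<Rightarrow> 'v \<Rightarrow> 'v) \<Rightarrow> (('k::field_char_0, 'm::finite, 'n::finite) gl \<Rightarrow> ('k, 'm, 'n) gl \<Rightarrow> 'v::ab_group_add) \<Rightarrow> bool" where
  "gl_bilinear s \<beta> \<longleftrightarrow>
     (\<forall>b. Vector_Spaces.linear gl_scale s (\<lambda>a. \<beta> a b)) \<and> (\<forall>a. Vector_Spaces.linear gl_scale s (\<beta> a))"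

lemma linearI:
  assumes "vector_space s1" "vector_space s2" "\<And>x y. f (x + y) = f x + f y" "\<And>c x. f (s1 c x) = s2 c (f x)"
  shows "Vector_Spaces.linear s1 s2 f"
  using assms by (simp add: Vector_Spaces.linear_def module_hom_def module_hom_axioms_def module_iff_vector_space)

lemma linearD:
  assumes "Vector_Spaces.linear s1 s2 f"
  shows "f (x + y) = f x + f y" "f (s1 c x) = s2 c (f x)" "f 0 = 0" "f (x - y) = f x - f y" "f (- x) = - f x"
    "f (sum g A) = (\<Sum>a\<in>A. f (g a))"
proof -
  interpret Vector_Spaces.linear s1 s2 f by fact
  show "f (x + y) = f x + f y" "f (s1 c x) = s2 c (f x)" "f 0 = 0" "f (x - y) = f x - f y" "f (- x) = - f x"
    "f (sum g A) = (\<Sum>a\<in>A. f (g a))"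
    by (simp_all add: add scale zero diff neg sum)
qed

lemma pm_lift_basis: "vector_space s \<Longrightarrow> pm_lift s g (Poly_Mapping.single x c) = s c (g x)"
  by (cases "c = 0") (simp_all add: pm_lift_def module.scale_zero_left module_iff_vector_space)

lemma pm_lift_linear:
  assumes "vector_space s" shows "Vector_Spaces.linear pm_scale s (pm_lift s g)"
proof -
  interpret s: vector_space s by fact
  show ?thesis
  proof (rule linearI)
    show "pm_lift s g (f + h) = pm_lift s g f + pm_lift s g h" for f h
      unfolding pm_lift_def by (rule sum_keys_add) (auto simp: s.scale_left_distrib)
    show "pm_lift s g (pm_scale c f) = s c (pm_lift s g f)" for c f
    proof -
      have "pm_lift s g (pm_scale c f)
        = (\<Sum>x\<in>Poly_Mapping.keys f. s (Poly_Mapping.lookup (pm_scale c f) x) (g x))"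
        unfolding pm_lift_def
        by (rule sum.mono_neutral_left) (auto simp: in_keys_iff lookup_pm_scale)
      then show ?thesis by (simp add: pm_lift_def lookup_pm_scale s.scale_sum_right)
    qed
  qed (fact assms pm.vector_space_axioms)+
qed

lemma pm_lift_tensor_rels:
  assumes "vector_space s" "gl_bilinear s \<beta>" "r \<in> pm.span tensor_rels"
  shows "pm_lift s (\<lambda>(a, b). \<beta> a b) r = 0"
proof -
  note lin = linearD[OF pm_lift_linear[OF assms(1)]]
  have b: "\<beta> (a + a') b = \<beta> a b + \<beta> a' b" "\<beta> a (b + b') = \<beta> a b + \<beta> a b'"
    "\<beta> (gl_scale c a) b = s c (\<beta> a b)" "\<beta> a (gl_scale c b) = s c (\<beta> a b)" for a a' b b' c
    using assms(2) linearD[of gl_scale s "\<lambda>a. \<beta> a b"] linearD[of gl_scale s "\<beta> a"]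
    unfolding gl_bilinear_def by auto
  interpret s: vector_space s by fact
  interpret L: Vector_Spaces.linear pm_scale s "pm_lift s (\<lambda>(a, b). \<beta> a b)"
    by (rule pm_lift_linear) fact
  show ?thesis
    by (rule L.eq_0_on_span[OF _ assms(3)])
      (auto simp: tensor_rels_def lin pm_lift_basis[OF assms(1)] b)
qed

lemma rep_gl2_abs: "rep_gl2 (abs_gl2 r) - r \<in> pm.span tensor_rels"
  using Quotient3_rep_abs[OF Quotient3_gl2, of r] by (simp add: pm.span_zero)

lemma tensor_lift_abs:
  assumes "vector_space s" "gl_bilinear s \<beta>"
  shows "tensor_lift s \<beta> (abs_gl2 r) = pm_lift s (\<lambda>(a, b). \<beta> a b) r"
  using pm_lift_tensor_rels[OF assms rep_gl2_abs[of r]]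
  by (simp add: tensor_lift_def linearD(4)[OF pm_lift_linear[OF assms(1)]])

lemma tensor_lift_tens:
  assumes "vector_space s" "gl_bilinear s \<beta>"
  shows "tensor_lift s \<beta> (tens a b) = \<beta> a b"
proof -
  interpret s: vector_space s by fact
  show ?thesis by (simp add: tens_def tensor_lift_abs[OF assms] pm_lift_basis assms)
qed

lemma gl2_cases: obtains r where "t = abs_gl2 r"
  by (metis Quotient3_abs_rep[OF Quotient3_gl2])

lemma tensor_lift_linear:
  assumes "vector_space s" "gl_bilinear s \<beta>"
  shows "Vector_Spaces.linear gl2_scale s (tensor_lift s \<beta>)"
proof (rule linearI)
  note lin = linearD[OF pm_lift_linear[OF assms(1)]]
  show "tensor_lift s \<beta> (t + u) = tensor_lift s \<beta> t + tensor_lift s \<beta> u" for t u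
    by (cases t rule: gl2_cases; cases u rule: gl2_cases)
      (simp add: plus_gl2.abs_eq tensor_lift_abs[OF assms] lin)
  show "tensor_lift s \<beta> (gl2_scale c t) = s c (tensor_lift s \<beta> t)" for c t
    by (cases t rule: gl2_cases)
      (simp add: gl2_scale.abs_eq tensor_lift_abs[OF assms] lin)
qed (fact assms gl2.vector_space_axioms)+

lemma tens_add: "tens (a + a') b = tens a b + tens a' b" "tens a (b + b') = tens a b + tens a b'"
  unfolding tens_def plus_gl2.abs_eq gl2.abs_eq_iff
  by (rule pm.span_base; simp only: tensor_rels_def Un_iff mem_Collect_eq diff_diff_eq[symmetric]; blast)+

lemma tens_scale: "tens (gl_scale c a) b = gl2_scale c (tens a b)" "tens a (gl_scale c b) = gl2_scale c (tens a b)"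
  unfolding tens_def gl2_scale.abs_eq gl2.abs_eq_iff
  by (rule pm.span_base; simp only: tensor_rels_def Un_iff mem_Collect_eq; blast)+

lemma tens_bilinear: "gl_bilinear gl2_scale tens"
  unfolding gl_bilinear_def
  by (auto intro!: linearI gl.vector_space_axioms gl2.vector_space_axioms simp: tens_add tens_scale)

lemmas tens_linear = tens_bilinear[unfolded gl_bilinear_def, THEN conjunct1, rule_format]
  tens_bilinear[unfolded gl_bilinear_def, THEN conjunct2, rule_format]

lemmas tens_simps = linearD[OF tens_linear(1)] linearD[OF tens_linear(2)]

lemma gl2_induct [case_names zero add tens]:
  assumes "P 0" "\<And>t u. P t \<Longrightarrow> P u \<Longrightarrow> P (t + u)"
    "\<And>a b p q. gl_part p a = a \<Longrightarrow> gl_part q b = b \<Longrightarrow> P (tens a b)"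
  shows "P t"
proof (cases t rule: gl2_cases)
  case (1 r)
  have hom: "P (tens a b)" for a b
  proof -
    have 1: "P (tens (gl_part p a) (gl_part q b))" for p q
      by (rule assms(3)[of p _ q]) (auto simp: gl_part_part)
    have "tens a b = tens (gl_part True a + gl_part False a) (gl_part True b + gl_part False b)"
      by (simp add: gl_part_sum_parts)
    also have "\<dots> = tens (gl_part True a) (gl_part True b) + tens (gl_part True a) (gl_part False b)
       + (tens (gl_part False a) (gl_part True b) + tens (gl_part False a) (gl_part False b))"
      by (simp only: tens_add add_ac)
    finally show ?thesis using 1 assms(2) by simp
  qed
  have "P (abs_gl2 r)"
  proof (induction r rule: poly_mapping_add_induct)
    case zero
    then show ?case using assms(1) by (simp add: zero_gl2.abs_eq)
  next
    case (add f w c)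
    have "Poly_Mapping.single w c = pm_scale c (pm_basis w)"
      by (rule poly_mapping_eqI) (simp add: lookup_pm_scale lookup_single when_def)
    then have "abs_gl2 (Poly_Mapping.single w c) = tens (gl_scale c (fst w)) (snd w)"
      unfolding tens_scale by (simp add: tens_def gl2_scale.abs_eq)
    then show ?case using assms(2)[OF hom add] by (simp add: plus_gl2.abs_eq[symmetric])
  qed
  with 1 show ?thesis by simp
qed


subsection \<open>Counit and comultiplication\<close>

lift_definition gl_eps :: "('k::field_char_0, 'm::finite, 'n::finite) gl \<Rightarrow> 'k"
  is "free_eval (\<lambda>c. c) eps_gen"
  using eps_ideal by (metis eps_hom free_eval_hom.fe_minus right_minus_eq)

lemma gl_eps_simps:
  "gl_eps (f + g) = gl_eps f + gl_eps g" "gl_eps (f * g) = gl_eps f * gl_eps g"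
  "gl_eps 1 = 1" "gl_eps (gl_scale c f) = c * gl_eps f" "gl_eps (gl_gen x) = eps_gen x"
  by (transfer; simp add: eval_simps[OF eps_hom] free_eval_hom.fe_single[OF eps_hom])+

lemma field_vector_space: "vector_space ((*) :: 'k::field \<Rightarrow> 'k \<Rightarrow> 'k)"
  by standard (auto simp: algebra_simps)

text \<open>The multiplication
  $(a\otimes b)(a'\otimes b') = (-1)^{|b||a'|}\, aa'\otimes bb'$ of the tensor square.\<close>

definition tens_mult_aux ::
  "('k::field_char_0, 'm::finite, 'n::finite) gl \<Rightarrow> ('k, 'm, 'n) gl \<Rightarrow> ('k, 'm, 'n) gl \<Rightarrow> ('k, 'm, 'n) gl
    \<Rightarrow> ('k, 'm, 'n) gl2" where
  "tens_mult_aux a b a' b' =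
     (\<Sum>p\<in>UNIV. \<Sum>q\<in>UNIV. gl2_scale (ksign p q) (tens (a * gl_part q a') (gl_part p b * b')))"

lemma ksign_commute: "ksign p q * x = x * ksign p q"
  by (simp add: ksign_def)

lemma tens_mult_aux_bilinear: "gl_bilinear gl2_scale (tens_mult_aux a b)"
  unfolding gl_bilinear_def tens_mult_aux_def
  by (auto intro!: linearI gl.vector_space_axioms gl2.vector_space_axioms
      simp: tens_add tens_scale gl_part_add gl_part_scale distrib_left distrib_right sum.distrib
        gl2.scale_right_distrib gl2.scale_sum_right ksign_commute simp flip: gl_scale_mult)

lemma tens_mult_aux_linear:
  "tens_mult_aux (a1 + a2) b a' b' = tens_mult_aux a1 b a' b' + tens_mult_aux a2 b a' b'"
  "tens_mult_aux a (b1 + b2) a' b' = tens_mult_aux a b1 a' b' + tens_mult_aux a b2 a' b'"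
  "tens_mult_aux (gl_scale c a) b a' b' = gl2_scale c (tens_mult_aux a b a' b')"
  "tens_mult_aux a (gl_scale c b) a' b' = gl2_scale c (tens_mult_aux a b a' b')"
  unfolding tens_mult_aux_def
  by (auto simp: tens_add tens_scale gl_part_add gl_part_scale distrib_left distrib_right sum.distrib
        gl2.scale_right_distrib gl2.scale_sum_right ksign_commute simp flip: gl_scale_mult)

lemma tens_mult_aux_fun:
  "tens_mult_aux (a1 + a2) b = (\<lambda>a' b'. tens_mult_aux a1 b a' b' + tens_mult_aux a2 b a' b')"
  "tens_mult_aux a (b1 + b2) = (\<lambda>a' b'. tens_mult_aux a b1 a' b' + tens_mult_aux a b2 a' b')"
  "tens_mult_aux (gl_scale c a) b = (\<lambda>a' b'. gl2_scale c (tens_mult_aux a b a' b'))"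
  "tens_mult_aux a (gl_scale c b) = (\<lambda>a' b'. gl2_scale c (tens_mult_aux a b a' b'))"
  by (intro ext tens_mult_aux_linear)+

lemma tensor_lift_param:
  assumes "vector_space s"
  shows "tensor_lift s (\<lambda>a b. \<beta> a b + \<gamma> a b) t = tensor_lift s \<beta> t + tensor_lift s \<gamma> t"
    "tensor_lift s (\<lambda>a b. s c (\<beta> a b)) t = s c (tensor_lift s \<beta> t)"
proof -
  interpret s: vector_space s by fact
  show "tensor_lift s (\<lambda>a b. \<beta> a b + \<gamma> a b) t = tensor_lift s \<beta> t + tensor_lift s \<gamma> t"
    "tensor_lift s (\<lambda>a b. s c (\<beta> a b)) t = s c (tensor_lift s \<beta> t)"
    by (simp_all add: tensor_lift_def pm_lift_def s.scale_right_distrib sum.distrib case_prod_beta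
        s.scale_sum_right mult.commute)
qed

lemma tens_mult_outer_bilinear:
  "gl_bilinear gl2_scale (\<lambda>a b. tensor_lift gl2_scale (tens_mult_aux a b) t)"
  unfolding gl_bilinear_def
  by (auto intro!: linearI gl.vector_space_axioms gl2.vector_space_axioms
      simp: tens_mult_aux_fun tensor_lift_param[OF gl2.vector_space_axioms])

instantiation gl2 :: (field_char_0, finite, finite) ring_1
begin
definition one_gl2 :: "('a, 'b, 'c) gl2" where "1 = tens 1 1"
definition times_gl2 :: "('a, 'b, 'c) gl2 \<Rightarrow> ('a, 'b, 'c) gl2 \<Rightarrow> ('a, 'b, 'c) gl2" where
  "t * u = tensor_lift gl2_scale (\<lambda>a b. tensor_lift gl2_scale (tens_mult_aux a b) u) t"

lemma times_gl2_tens: "tens a b * tens a' b' = tens_mult_aux a b a' b'"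
  unfolding times_gl2_def tensor_lift_tens[OF gl2.vector_space_axioms tens_mult_outer_bilinear]
  by (rule tensor_lift_tens[OF gl2.vector_space_axioms tens_mult_aux_bilinear])

lemma times_gl2_hom:
  assumes "gl_part p b = b" "gl_part q a' = (a' :: ('a, 'b, 'c) gl)"
  shows "tens a b * tens a' b' = gl2_scale (ksign p q) (tens (a * a') (b * b'))"
proof -
  have "gl_part (\<not> p) b = 0" "gl_part (\<not> q) a' = 0"
    using assms by (metis gl_part_part)+
  with assms show ?thesis
    by (cases p; cases q) (auto simp: times_gl2_tens tens_mult_aux_def UNIV_bool tens_simps ksign_def)
qed

lemma times_gl2_linear:
  fixes t u v :: "('a, 'b, 'c) gl2"
  shows "(t + u) * v = t * v + u * v" "t * (u + v) = t * u + t * v"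
    "gl2_scale c t * u = gl2_scale c (t * u)" "t * gl2_scale c u = gl2_scale c (t * u)"
    "t * 0 = 0" "0 * t = 0"
proof -
  note l1 = linearD[OF tensor_lift_linear[OF gl2.vector_space_axioms tens_mult_outer_bilinear]]
  note l2 = linearD[OF tensor_lift_linear[OF gl2.vector_space_axioms tens_mult_aux_bilinear]]
  note p = tensor_lift_param[OF gl2.vector_space_axioms]
  show "(t + u) * v = t * v + u * v" "t * (u + v) = t * u + t * v"
    "gl2_scale c t * u = gl2_scale c (t * u)" "t * gl2_scale c u = gl2_scale c (t * u)"
    "0 * t = 0"
    unfolding times_gl2_def by (simp_all add: l1 l2 p)
  show "t * 0 = 0"
    unfolding times_gl2_def by (simp add: l2) (simp add: tensor_lift_def pm_lift_def case_prod_beta)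
qed

lemma gl_part_mult_hom: "gl_part p f = f \<Longrightarrow> gl_part q g = g \<Longrightarrow> gl_part (p \<noteq> q) (f * g) = (f * g :: ('a, 'b, 'c) gl)"
proof -
  assume 1: "gl_part p f = f" "gl_part q g = g"
  then have "gl_part (\<not> p) f = 0" "gl_part (\<not> q) g = 0"
    by (metis gl_part_part)+
  with 1 show ?thesis
    by (cases p; cases q) (simp_all add: gl_part_mult)
qed

lemma times_gl2_assoc_hom:
  fixes a b a' b' a'' b'' :: "('a, 'b, 'c) gl"
  assumes "gl_part q b = b" "gl_part p' a' = a'" "gl_part q' b' = b'" "gl_part p'' a'' = a''"
  shows "tens a b * tens a' b' * tens a'' b'' = tens a b * (tens a' b' * tens a'' b'')"
proof -
  have "tens a b * tens a' b' * tens a'' b''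
    = gl2_scale (ksign q p') (gl2_scale (ksign (q \<noteq> q') p'') (tens (a * a' * a'') (b * b' * b'')))"
    using times_gl2_hom[OF gl_part_mult_hom[OF assms(1,3)] assms(4), of "a * a'" b'']
    by (simp add: times_gl2_hom[OF assms(1,2)] times_gl2_linear)
  also have "\<dots> = gl2_scale (ksign q' p'') (gl2_scale (ksign q (p' \<noteq> p'')) (tens (a * a' * a'') (b * b' * b'')))"
    by (cases q; cases q'; cases p'; cases p'') (simp_all add: ksign_def)
  also have "\<dots> = tens a b * (tens a' b' * tens a'' b'')"
    using times_gl2_hom[OF assms(1) gl_part_mult_hom[OF assms(2,4)], of a "b' * b''"]
    by (simp add: times_gl2_hom[OF assms(3,4)] times_gl2_linear mult.assoc)
  finally show ?thesis .
qed

instance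
proof
  fix t u v :: "('a, 'b, 'c) gl2"
  show "t * u * v = t * (u * v)"
  proof (induction t rule: gl2_induct)
    case (tens a b p q)
    note t = this
    show ?case
    proof (induction u rule: gl2_induct)
      case (tens a' b' p' q')
      note u = this
      show ?case
      proof (induction v rule: gl2_induct)
        case (tens a'' b'' p'' q'')
        then show ?case using t u times_gl2_assoc_hom by blast
      qed (simp_all add: times_gl2_linear)
    qed (simp_all add: times_gl2_linear)
  qed (simp_all add: times_gl2_linear)
  show "1 * t = t"
    by (induction t rule: gl2_induct)
      (simp_all add: times_gl2_linear one_gl2_def times_gl2_hom[where p = False] gl_part_one ksign_def)
  show "t * 1 = t"
    by (induction t rule: gl2_induct)
      (simp_all add: times_gl2_linear one_gl2_def times_gl2_hom[where q = False] gl_part_one ksign_def)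
  show "(t + u) * v = t * v + u * v" "t * (u + v) = t * u + t * v"
    by (rule times_gl2_linear)+
  have "gl_bilinear (*) (\<lambda>a b :: ('a, 'b, 'c) gl. gl_eps a * gl_eps b)"
    unfolding gl_bilinear_def
    by (auto intro!: linearI gl.vector_space_axioms field_vector_space simp: gl_eps_simps algebra_simps)
  then have "tensor_lift (*) (\<lambda>a b. gl_eps a * gl_eps b) (1 :: ('a, 'b, 'c) gl2) = 1"
    "tensor_lift (*) (\<lambda>a b. gl_eps a * gl_eps b) (0 :: ('a, 'b, 'c) gl2) = 0"
    using linearD(3)[OF tensor_lift_linear[OF field_vector_space]]
    by (simp_all add: one_gl2_def tensor_lift_tens field_vector_space gl_eps_simps)
  then show "(0 :: ('a, 'b, 'c) gl2) \<noteq> 1"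
    by (metis zero_neq_one)
qed
end

text \<open>$\Delta(c_{ij}) = \sum_k c_{ik}\otimes c_{kj}$; the value on the inverse matrix is then forced:
  with $S' = (s_{ij}\otimes 1)$ and $S'' = (1\otimes s_{ij})$ it is the matrix product $S''S'$.\<close>

fun delta_gen :: "('m, 'n) gen \<Rightarrow> ('k::field_char_0, 'm::finite, 'n::finite) gl2" where
  "delta_gen (Cgen i j) = (\<Sum>k\<in>UNIV. tens (cc i k) (cc k j))"
| "delta_gen (Sgen i j) = (\<Sum>k\<in>UNIV. tens 1 (ss i k) * tens (ss k j) 1)"

lemma delta_hom: "free_eval_hom (\<lambda>c::'k. gl2_scale c (1 :: ('k::field_char_0, 'm::finite, 'n::finite) gl2))"
  by standard (simp_all add: gl2.scale_left_distrib times_gl2_linear)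

lemma abs_gl_simps:
  "abs_gl (f + g) = abs_gl f + abs_gl g" "abs_gl (f - g) = abs_gl f - abs_gl g"
  "abs_gl (f * g) = abs_gl f * abs_gl g" "abs_gl 0 = 0" "abs_gl 1 = 1"
  "abs_gl (- f) = - abs_gl f" "abs_gl (free_gen x) = gl_gen x"
  by (simp_all add: plus_gl.abs_eq minus_gl.abs_eq times_gl.abs_eq zero_gl_def one_gl_def
      uminus_gl.abs_eq gl_gen.abs_eq)

lemma abs_gl_sum: "abs_gl (sum F A) = (\<Sum>k\<in>A. abs_gl (F k))"
  by (induction A rule: infinite_finite_induct) (simp_all add: abs_gl_simps)

lemma abs_gl_more: "abs_gl (ksign p q) = ksign p q" "abs_gl (of_bool b) = of_bool b"
  by (cases b; simp add: ksign_def abs_gl_simps)+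

lemma abs_gl_rel: "r \<in> gl_rels \<Longrightarrow> abs_gl r = 0"
  by (simp add: zero_gl_def gl.abs_eq_iff ideal_gen_superset)

lemma gl_gen_commute:
  "gl_gen x * gl_gen y = ksign (gen_par x) (gen_par y) * (gl_gen y * gl_gen x)"
proof -
  have "abs_gl (free_gen x * free_gen y - ksign (gen_par x) (gen_par y) * (free_gen y * free_gen x)) = 0"
    by (rule abs_gl_rel) (auto simp: gl_rels_def)
  then show ?thesis by (simp add: abs_gl_simps abs_gl_more)
qed

lemma gl_inverse:
  "(\<Sum>k\<in>UNIV. cc i k * ss k j) = of_bool (i = j)"
  "(\<Sum>k\<in>UNIV. ss i k * cc k j) = of_bool (i = j)"
proof -
  have "abs_gl ((\<Sum>k\<in>UNIV. free_gen (Cgen i k) * free_gen (Sgen k j)) - of_bool (i = j)) = 0"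
    "abs_gl ((\<Sum>k\<in>UNIV. free_gen (Sgen i k) * free_gen (Cgen k j)) - of_bool (i = j)) = 0"
    by (rule abs_gl_rel; auto simp: gl_rels_def)+
  then show "(\<Sum>k\<in>UNIV. cc i k * ss k j) = of_bool (i = j)"
    "(\<Sum>k\<in>UNIV. ss i k * cc k j) = of_bool (i = j)"
    by (simp_all add: abs_gl_simps abs_gl_more abs_gl_sum)
qed

lemma ksign_scale: "ksign p q * t = gl_scale (ksign p q) t" "ksign p q * u = gl2_scale (ksign p q) u"
  by (simp_all add: ksign_def)

lemma tens_gen_commute:
  fixes u v u' v' :: "('m::finite, 'n::finite) gen"
  shows "tens (gl_gen u) (gl_gen v) * tens (gl_gen u') (gl_gen v')
    = gl2_scale (ksign (gen_par u \<noteq> gen_par v) (gen_par u' \<noteq> gen_par v'))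
        (tens (gl_gen u') (gl_gen v') * tens (gl_gen u) (gl_gen v) :: ('k::field_char_0, 'm, 'n) gl2)"
proof -
  have 1: "gl_part (gen_par x) (gl_gen x) = (gl_gen x :: ('k, 'm, 'n) gl)" for x
    by (simp add: gl_part_gen)
  have "tens (gl_gen u * gl_gen u') (gl_gen v * gl_gen v')
    = gl2_scale (ksign (gen_par u) (gen_par u')) (gl2_scale (ksign (gen_par v) (gen_par v'))
        (tens (gl_gen u' * gl_gen u) (gl_gen v' * gl_gen v) :: ('k, 'm, 'n) gl2))"
    unfolding gl_gen_commute[of u u'] gl_gen_commute[of v v'] ksign_scale tens_scale
    by (rule gl2.scale_left_commute)
  then show ?thesis
    unfolding times_gl2_hom[OF 1 1]
    by (cases "gen_par u"; cases "gen_par v"; cases "gen_par u'"; cases "gen_par v'")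
      (simp_all add: ksign_def)
qed

lemma delta_gen_Sgen:
  "(delta_gen (Sgen i j) :: ('k::field_char_0, 'm::finite, 'n::finite) gl2)
    = (\<Sum>k\<in>UNIV. gl2_scale (ksign (odd_index i \<noteq> odd_index k) (odd_index k \<noteq> odd_index j)) (tens (ss k j) (ss i k)))"
proof -
  have "tens 1 (ss i k) * tens (ss k j) 1 = gl2_scale (ksign (gen_par (Sgen i k)) (gen_par (Sgen k j))) (tens (1 * ss k j) (ss i k * 1) :: ('k, 'm, 'n) gl2)" for k
    by (rule times_gl2_hom) (simp_all add: gl_part_gen)
  then show ?thesis by simp
qed

lemma delta_gen_form:
  fixes x :: "('m::finite, 'n::finite) gen"
  shows "\<exists>(a :: 'm + 'n \<Rightarrow> 'k::field_char_0) (u :: 'm + 'n \<Rightarrow> ('m, 'n) gen) v.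
    delta_gen x = (\<Sum>k\<in>UNIV. gl2_scale (a k) (tens (gl_gen (u k)) (gl_gen (v k))))
    \<and> (\<forall>k. (gen_par (u k) \<noteq> gen_par (v k)) = gen_par x)"
proof (cases x)
  case (Cgen i j)
  show ?thesis
    by (rule exI[of _ "\<lambda>k. 1"], rule exI[of _ "\<lambda>k. Cgen i k"], rule exI[of _ "\<lambda>k. Cgen k j"]) (auto simp: Cgen)
next
  case (Sgen i j)
  show ?thesis
    by (rule exI[of _ "\<lambda>k. ksign (odd_index i \<noteq> odd_index k) (odd_index k \<noteq> odd_index j)"],
        rule exI[of _ "\<lambda>k. Sgen k j"], rule exI[of _ "\<lambda>k. Sgen i k"])
      (auto simp: Sgen delta_gen_Sgen simp del: delta_gen.simps)
qed

lemma delta_gen_commute: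
  fixes x y :: "('m::finite, 'n::finite) gen"
  shows "(delta_gen x * delta_gen y :: ('k::field_char_0, 'm, 'n) gl2)
    = ksign (gen_par x) (gen_par y) * (delta_gen y * delta_gen x)"
proof -
  obtain a :: "'m + 'n \<Rightarrow> 'k" and u v :: "'m + 'n \<Rightarrow> ('m, 'n) gen" where x: "delta_gen x = (\<Sum>k\<in>UNIV. gl2_scale (a k) (tens (gl_gen (u k)) (gl_gen (v k))))"
    "\<And>k. (gen_par (u k) \<noteq> gen_par (v k)) = gen_par x"
    using delta_gen_form[of x, where 'k = 'k] by (elim exE conjE) (erule that, blast)
  obtain a' :: "'m + 'n \<Rightarrow> 'k" and u' v' :: "'m + 'n \<Rightarrow> ('m, 'n) gen" where y: "delta_gen y = (\<Sum>k\<in>UNIV. gl2_scale (a' k) (tens (gl_gen (u' k)) (gl_gen (v' k))))"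
    "\<And>k. (gen_par (u' k) \<noteq> gen_par (v' k)) = gen_par y"
    using delta_gen_form[of y, where 'k = 'k] by (elim exE conjE) (erule that, blast)
  have "delta_gen x * delta_gen y = (\<Sum>k\<in>UNIV. \<Sum>l\<in>UNIV. gl2_scale (a k * a' l)
      (tens (gl_gen (u k)) (gl_gen (v k)) * tens (gl_gen (u' l)) (gl_gen (v' l))))"
    unfolding x(1) y(1) sum_product times_gl2_linear gl2.scale_scale by (intro sum.cong refl arg_cong2[of _ _ _ _ gl2_scale] mult.commute)
  also have "\<dots> = (\<Sum>k\<in>UNIV. \<Sum>l\<in>UNIV. gl2_scale (ksign (gen_par x) (gen_par y)) (gl2_scale (a k * a' l)
      (tens (gl_gen (u' l)) (gl_gen (v' l)) * tens (gl_gen (u k)) (gl_gen (v k)))))"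
  proof (intro sum.cong refl)
    fix k l
    show "gl2_scale (a k * a' l) (tens (gl_gen (u k)) (gl_gen (v k)) * tens (gl_gen (u' l)) (gl_gen (v' l)))
      = gl2_scale (ksign (gen_par x) (gen_par y)) (gl2_scale (a k * a' l)
        (tens (gl_gen (u' l)) (gl_gen (v' l)) * tens (gl_gen (u k)) (gl_gen (v k))))"
      unfolding tens_gen_commute[of "u k" "v k" "u' l" "v' l"] x(2) y(2)
      by (rule gl2.scale_left_commute)
  qed
  also have "\<dots> = gl2_scale (ksign (gen_par x) (gen_par y)) (delta_gen y * delta_gen x)"
    unfolding x(1) y(1) sum_product times_gl2_linear gl2.scale_scale gl2.scale_sum_right
    by (rule sum.swap)
  finally show ?thesis by (simp add: ksign_scale)
qed

lemma tens_mult_side: "tens a 1 * tens a' b' = tens (a * a') b'" "tens a b * tens 1 b' = tens a (b * b')"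
proof -
  have 1: "gl_part False 1 = 1" by (simp add: gl_part_one)
  have 2: "tens a 1 * tens (gl_part p a') b' = tens (a * gl_part p a') b'" for p
    using times_gl2_hom[OF 1, of p "gl_part p a'" a b'] by (simp add: gl_part_part ksign_def)
  have 3: "tens a (gl_part p b) * tens 1 b' = tens a (gl_part p b * b')" for p
    using times_gl2_hom[OF _ 1, of p "gl_part p b" a b'] by (simp add: gl_part_part ksign_def)
  have "tens a 1 * tens (gl_part True a' + gl_part False a') b' = tens (a * (gl_part True a' + gl_part False a')) b'"
    by (simp only: tens_add distrib_left 2)
  then show "tens a 1 * tens a' b' = tens (a * a') b'" by (simp only: gl_part_sum_parts)
  have "tens a (gl_part True b + gl_part False b) * tens 1 b' = tens a ((gl_part True b + gl_part False b) * b')"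
    by (simp only: tens_add distrib_right 3)
  then show "tens a b * tens 1 b' = tens a (b * b')" by (simp only: gl_part_sum_parts)
qed

lemma matrix_inverse_product:
  fixes A A' B B' :: "'i::finite \<Rightarrow> 'i \<Rightarrow> 'r::ring_1"
  assumes "\<And>i j. (\<Sum>k\<in>UNIV. A i k * A' k j) = of_bool (i = j)" "\<And>i j. (\<Sum>k\<in>UNIV. B i k * B' k j) = of_bool (i = j)"
  shows "(\<Sum>k\<in>UNIV. (\<Sum>l\<in>UNIV. A i l * B l k) * (\<Sum>l\<in>UNIV. B' k l * A' l j)) = of_bool (i = j)"
proof -
  have "(\<Sum>k\<in>UNIV. (\<Sum>l\<in>UNIV. A i l * B l k) * (\<Sum>l\<in>UNIV. B' k l * A' l j))
    = (\<Sum>k\<in>UNIV. \<Sum>l\<in>UNIV. \<Sum>l'\<in>UNIV. A i l * (B l k * B' k l') * A' l' j)"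
    by (simp add: sum_distrib_left sum_distrib_right mult.assoc) (subst sum.swap, rule refl)
  also have "\<dots> = (\<Sum>l\<in>UNIV. \<Sum>l'\<in>UNIV. \<Sum>k\<in>UNIV. A i l * (B l k * B' k l') * A' l' j)"
    by (subst sum.swap) (intro sum.cong refl sum.swap)
  also have "\<dots> = (\<Sum>l\<in>UNIV. \<Sum>l'\<in>UNIV. A i l * of_bool (l = l') * A' l' j)"
    by (simp add: assms(2) flip: sum_distrib_left sum_distrib_right)
  also have "\<dots> = (\<Sum>l\<in>UNIV. A i l * A' l j)"
    by (simp add: mult.assoc sum_of_bool_mult flip: sum_distrib_left)
  finally show ?thesis by (simp add: assms(1))
qed

lemma delta_gen_inverse:
  "(\<Sum>k\<in>UNIV. delta_gen (Cgen i k) * delta_gen (Sgen k j)) = of_bool (i = j)"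
  "(\<Sum>k\<in>UNIV. delta_gen (Sgen i k) * delta_gen (Cgen k j)) = of_bool (i = j)"
proof -
  have b: "tens (of_bool c) 1 = of_bool c" "tens 1 (of_bool c) = of_bool c" for c
    by (cases c; simp add: one_gl2_def tens_simps)+
  have 1: "(\<Sum>k\<in>UNIV. tens (cc i k) 1 * tens (ss k j) 1) = of_bool (i = j)"
    "(\<Sum>k\<in>UNIV. tens (ss i k) 1 * tens (cc k j) 1) = of_bool (i = j)"
    "(\<Sum>k\<in>UNIV. tens 1 (cc i k) * tens 1 (ss k j)) = of_bool (i = j)"
    "(\<Sum>k\<in>UNIV. tens 1 (ss i k) * tens 1 (cc k j)) = of_bool (i = j)" for i j
    unfolding tens_mult_side linearD(6)[OF tens_linear(1), symmetric] linearD(6)[OF tens_linear(2), symmetric] gl_inverse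
    by (rule b)+
  have d: "delta_gen (Cgen i j) = (\<Sum>k\<in>UNIV. tens (cc i k) 1 * tens 1 (cc k j))" for i j
    by (simp add: tens_mult_side)
  show "(\<Sum>k\<in>UNIV. delta_gen (Cgen i k) * delta_gen (Sgen k j)) = of_bool (i = j)"
    "(\<Sum>k\<in>UNIV. delta_gen (Sgen i k) * delta_gen (Cgen k j)) = of_bool (i = j)"
    unfolding d delta_gen.simps(2) by (rule matrix_inverse_product; rule 1)+
qed

lemma delta_rels: "r \<in> gl_rels \<Longrightarrow> free_eval (\<lambda>c. gl2_scale c 1) delta_gen r = 0"
  unfolding gl_rels_def
  by (auto simp: eval_simps[OF delta_hom] delta_gen_inverse simp del: delta_gen.simps)
    (metis delta_gen_commute right_minus_eq)

lemma delta_ideal: "r \<in> ideal_gen gl_rels \<Longrightarrow> free_eval (\<lambda>c. gl2_scale c 1) delta_gen r = 0"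
  by (rule free_eval_hom.fe_ideal[OF delta_hom]) (auto intro: delta_rels)

lift_definition gl_delta :: "('k::field_char_0, 'm::finite, 'n::finite) gl \<Rightarrow> ('k, 'm, 'n) gl2"
  is "free_eval (\<lambda>c. gl2_scale c 1) delta_gen"
  by (drule delta_ideal) (simp add: free_eval_hom.fe_minus[OF delta_hom])


lemma gl_delta_simps:
  "gl_delta (f + g) = gl_delta f + gl_delta g" "gl_delta (f * g) = gl_delta f * gl_delta g"
  "gl_delta 1 = 1" "gl_delta (gl_gen x) = delta_gen x"
  by (transfer; simp add: eval_simps[OF delta_hom])+

lemma gl_delta_scale: "gl_delta (gl_scale c f) = gl2_scale c (gl_delta f)"
  by transfer (simp add: free_eval_hom.fe_mult[OF delta_hom] free_eval_hom.fe_single[OF delta_hom] times_gl2_linear)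

section \<open>Supermodules\<close>

text \<open>All supermodules that occur are subquotients of $K[G]$ with the structure
  $\rho_r = \Delta$.  The supercomodule condition $\rho_r(N)\subseteq N\otimes K[G]$ is expressed
  inside $K[G]\otimes K[G]$.\<close>

definition subsupermodule :: "('k::field_char_0, 'm::finite, 'n::finite) gl set \<Rightarrow> bool" where
  "subsupermodule N \<longleftrightarrow> gl.subspace N \<and> (\<forall>f\<in>N. \<forall>p. gl_part p f \<in> N)
     \<and> (\<forall>f\<in>N. gl_delta f \<in> gl2.span {tens a b | a b. a \<in> N})"

text \<open>The pairs $N_1\subset N_2$ with irreducible quotient $N_2/N_1$.\<close>

definition simple_section ::
  "('k::field_char_0, 'm::finite, 'n::finite) gl set \<Rightarrow> ('k, 'm, 'n) gl set \<Rightarrow> bool" where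
  "simple_section N1 N2 \<longleftrightarrow> subsupermodule N1 \<and> subsupermodule N2 \<and> N1 \<subset> N2
     \<and> (\<forall>N. subsupermodule N \<and> N1 \<subseteq> N \<and> N \<subseteq> N2 \<longrightarrow> N = N1 \<or> N = N2)"

definition gl_socle :: "('k::field_char_0, 'm::finite, 'n::finite) gl set \<Rightarrow> ('k, 'm, 'n) gl set" where
  "gl_socle M = gl.span (\<Union>{N. simple_section {0} N \<and> N \<subseteq> M})"

definition gl_tensor_map ::
  "(('k, 'm, 'n) gl \<Rightarrow> ('k, 'm, 'n) gl) \<Rightarrow> (('k, 'm, 'n) gl \<Rightarrow> ('k, 'm, 'n) gl)
    \<Rightarrow> ('k::field_char_0, 'm::finite, 'n::finite) gl2 \<Rightarrow> ('k, 'm, 'n) gl2" where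
  "gl_tensor_map \<theta> \<eta> = tensor_lift gl2_scale (\<lambda>a b. tens (\<theta> a) (\<eta> b))"

text \<open>\<open>section_iso p N1 N2 L\<close>: the supermodule $N_2/N_1$ is isomorphic, by an even isomorphism, to $L$ if
  \<^term>\<open>p\<close> is \<^const>\<open>False\<close>, and to $\Pi L$ if \<^term>\<open>p\<close> is \<^const>\<open>True\<close>.  The isomorphism is given by a surjection
  $\theta : N_2\to L$ with kernel $N_1$, extended arbitrarily to a linear map on $K[G]$; an
  even map to $\Pi L$ is an odd map to $L$.  No sign occurs, because $\Pi$ acts on the left tensor factor
  and so does not change the comodule structure map.\<close>

definition section_iso ::
  "bool \<Rightarrow> ('k::field_char_0, 'm::finite, 'n::finite) gl set \<Rightarrow> ('k, 'm, 'n) gl set \<Rightarrow> ('k, 'm, 'n) gl set \<Rightarrow> bool" where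
  "section_iso p N1 N2 L \<longleftrightarrow> (\<exists>\<theta>. Vector_Spaces.linear gl_scale gl_scale \<theta>
     \<and> \<theta> ` N2 = L \<and> {f \<in> N2. \<theta> f = 0} = N1
     \<and> (\<forall>f\<in>N2. \<forall>q. \<theta> (gl_part q f) = gl_part (p \<noteq> q) (\<theta> f))
     \<and> (\<forall>f\<in>N2. gl_delta (\<theta> f) = gl_tensor_map \<theta> id (gl_delta f)))"

section \<open>Weights and the supermodules $L_-(\lambda)$\<close>

text \<open>The weight $\sum_i\lambda_i\epsilon_i$ is the function wt on the indices.  Indices
  are ordered with all even ones before all odd ones.\<close>

type_synonym ('m, 'n) weight = "'m + 'n \<Rightarrow> int"

fun index_less :: "'m::linorder + 'n::linorder \<Rightarrow> 'm + 'n \<Rightarrow> bool" where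
  "index_less (Inl i) (Inl j) = (i < j)"
| "index_less (Inl i) (Inr j) = True"
| "index_less (Inr i) (Inl j) = False"
| "index_less (Inr i) (Inr j) = (i < j)"

definition index_list :: "('m::{finite, linorder} + 'n::{finite, linorder}) list" where
  "index_list = map Inl (sorted_list_of_set UNIV) @ map Inr (sorted_list_of_set UNIV)"

definition dominant_weights :: "('m::{finite, linorder}, 'n::{finite, linorder}) weight set" where
  "dominant_weights = {wt. (\<forall>i j. i < j \<longrightarrow> wt (Inl j) \<le> wt (Inl i)) \<and> (\<forall>i j. i < j \<longrightarrow> wt (Inr j) \<le> wt (Inr i))}"

definition weight_degree :: "('m::finite, 'n::finite) weight \<Rightarrow> int" where
  "weight_degree wt = (\<Sum>i\<in>UNIV. wt i)"

definition dominant_weights_of_degree :: "int \<Rightarrow> ('m::{finite, linorder}, 'n::{finite, linorder}) weight set" where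
  "dominant_weights_of_degree l = {wt \<in> dominant_weights. weight_degree wt = l}"

text \<open>The Hopf superideal of functions vanishing on the lower triangular Borel subgroup $B^-$.\<close>

definition borel_ideal :: "('k::field_char_0, 'm::{finite, linorder}, 'n::{finite, linorder}) gl set" where
  "borel_ideal = ideal_gen {cc i j | i j. index_less i j}"

text \<open>A lift to $K[G]$ of the group-like element $\prod_i c_{ii}^{\lambda_i}$ of $K[B^-]$; there
  $s_{ii}$ is the inverse of $c_{ii}$.\<close>

definition weight_character ::
  "('m, 'n) weight \<Rightarrow> ('k::field_char_0, 'm::{finite, linorder}, 'n::{finite, linorder}) gl" where
  "weight_character wt = prod_list (map (\<lambda>i. cc i i ^ nat (wt i) * ss i i ^ nat (- wt i)) index_list)"

text \<open>$H^0_-(\lambda) = \mathrm{ind}^G_{B^-}K_\lambda$ is the cotensor product of $K_\lambda$ and $K[G]$ over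
  $K[B^-]$, i.e. it consists of all $f$ with
  $\Delta(f) = \prod_i c_{ii}^{\lambda_i}\otimes f$ in $K[B^-]\otimes K[G]$.  The kernel of
  $K[G]\otimes K[G]\to K[B^-]\otimes K[G]$ is spanned by the $a\otimes b$ with $a$ in the ideal of $B^-$.\<close>

definition H0_minus ::
  "('m, 'n) weight \<Rightarrow> ('k::field_char_0, 'm::{finite, linorder}, 'n::{finite, linorder}) gl set" where
  "H0_minus wt = {f. gl_delta f - tens (weight_character wt) f \<in> gl2.span {tens a b | a b. a \<in> borel_ideal}}"

definition L_minus ::
  "('m, 'n) weight \<Rightarrow> ('k::field_char_0, 'm::{finite, linorder}, 'n::{finite, linorder}) gl set" where
  "L_minus wt = gl_socle (H0_minus wt)"

definition belongs_to ::
  "('k::field_char_0, 'm::{finite, linorder}, 'n::{finite, linorder}) gl set \<Rightarrow> ('m, 'n) weight set \<Rightarrow> bool" where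
  "belongs_to N \<Gamma> \<longleftrightarrow>
     (\<forall>N1 N2. simple_section N1 N2 \<and> N2 \<subseteq> N \<longrightarrow> (\<exists>wt\<in>\<Gamma>. \<exists>p. section_iso p N1 N2 (L_minus wt)))"

text \<open>$C_\Gamma = O_\Gamma(K[G])$: the sum of all subsupermodules belonging to $\Gamma$, which is the
  largest such one.\<close>

definition C_sub ::
  "('m, 'n) weight set \<Rightarrow> ('k::field_char_0, 'm::{finite, linorder}, 'n::{finite, linorder}) gl set" where
  "C_sub \<Gamma> = gl.span (\<Union>{N. subsupermodule N \<and> belongs_to N \<Gamma>})"

section \<open>The distribution superalgebra\<close>

type_synonym ('k, 'm, 'n) gl_fun = "('k, 'm, 'n) gl \<Rightarrow> 'k"

definition aug_power :: "nat \<Rightarrow> ('k::field_char_0, 'm::finite, 'n::finite) gl set" where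
  "aug_power t = gl.span {prod_list fs | fs. length fs = t \<and> (\<forall>f\<in>set fs. gl_eps f = 0)}"

definition Dist :: "('k::field_char_0, 'm::finite, 'n::finite) gl_fun set" where
  "Dist = {\<phi>. Vector_Spaces.linear gl_scale (*) \<phi> \<and> (\<exists>t. \<forall>f\<in>aug_power (Suc t). \<phi> f = 0)}"

text \<open>$Dist(T)$: the distributions factoring through $K[G]\to K[T]$.\<close>

definition torus_ideal :: "('k::field_char_0, 'm::finite, 'n::finite) gl set" where
  "torus_ideal = ideal_gen {cc i j | i j. i \<noteq> j}"

definition DistT :: "('k::field_char_0, 'm::finite, 'n::finite) gl_fun set" where
  "DistT = {\<phi> \<in> Dist. \<forall>f\<in>torus_ideal. \<phi> f = 0}"

text \<open>$\phi\psi(f) = \sum(-1)^{|\psi||f_1|}\phi(f_1)\psi(f_2)$, extended bilinearly; the component of parity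
  \<^term>\<open>q\<close> of a functional \<^term>\<open>\<psi>\<close> is \<^term>\<open>\<lambda>f. \<psi> (gl_part q f)\<close>.\<close>

definition dist_mult ::
  "('k, 'm, 'n) gl_fun \<Rightarrow> ('k, 'm, 'n) gl_fun \<Rightarrow> ('k::field_char_0, 'm::finite, 'n::finite) gl_fun" where
  "dist_mult \<phi> \<psi> f = tensor_lift (*)
     (\<lambda>f1 f2. \<Sum>p\<in>UNIV. \<Sum>q\<in>UNIV. ksign q p * \<phi> (gl_part p f1) * \<psi> (gl_part q f2)) (gl_delta f)"

definition dist_superideal :: "('k::field_char_0, 'm::finite, 'n::finite) gl_fun set \<Rightarrow> bool" where
  "dist_superideal I \<longleftrightarrow> I \<subseteq> Dist \<and> (\<lambda>f. 0) \<in> I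
     \<and> (\<forall>\<phi>\<in>I. \<forall>\<psi>\<in>I. (\<lambda>f. \<phi> f + \<psi> f) \<in> I)
     \<and> (\<forall>\<phi>\<in>I. \<forall>c. (\<lambda>f. c * \<phi> f) \<in> I)
     \<and> (\<forall>\<phi>\<in>I. \<forall>p. (\<lambda>f. \<phi> (gl_part p f)) \<in> I)
     \<and> (\<forall>\<phi>\<in>I. \<forall>\<psi>\<in>Dist. dist_mult \<phi> \<psi> \<in> I \<and> dist_mult \<psi> \<phi> \<in> I)"

definition dist_superideal_gen ::
  "('k::field_char_0, 'm::finite, 'n::finite) gl_fun set \<Rightarrow> ('k, 'm, 'n) gl_fun set" where
  "dist_superideal_gen J = \<Inter>{I. dist_superideal I \<and> J \<subseteq> I}"

text \<open>$S_\Gamma = C_\Gamma^*$ consists of functions that are \<^const>\<open>undefined\<close> outside $C_\Gamma$.\<close>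

definition pi_map ::
  "('m, 'n) weight set \<Rightarrow> ('k::field_char_0, 'm::{finite, linorder}, 'n::{finite, linorder}) gl_fun \<Rightarrow> ('k, 'm, 'n) gl_fun" where
  "pi_map \<Gamma> \<xi> = restrict \<xi> (C_sub \<Gamma>)"

definition pi_kernel ::
  "('m, 'n) weight set \<Rightarrow> ('k::field_char_0, 'm::{finite, linorder}, 'n::{finite, linorder}) gl_fun set" where
  "pi_kernel \<Gamma> = {\<xi> \<in> Dist. pi_map \<Gamma> \<xi> = (\<lambda>f\<in>C_sub \<Gamma>. 0)}"

end

theory Submission
  imports Defs "HOL-Library.Function_Algebras" "HOL-Computational_Algebra.Formal_Power_Series" "HOL-Analysis.Determinants"
begin

text \<open>Let $K[G]_d$ be the space of functions of degree $d$ under the scalar matrices.  A weight of maximal height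
  in a simple section $N_2/N_1$ of $K[G]$ is dominant, and left convolution with a suitable functional embeds the
  section into $H^0_-(\lambda)$.  There the simple subsupermodule is unique: expanding a highest weight vector along the
  triangular decomposition of the curve $1+t(C-1)$, $C$ the generic matrix, shows that it is determined by its
  restriction to $B^-$ and does not vanish at the identity.  Hence
  the simple sections of $K[G]_l$ are the $L_-(\lambda)$ with $|\lambda|=l$ up to parity, and the subsupercoalgebra in
  question is $K[G]_l$.

  Now let $\xi$ be a distribution killing $K[G]_l$ and $\mathfrak m^{t+1}$, and put $y=c_{ii}-1$.  On functions $f$ of
  degree $d$, multiplication by the truncated binomial series of $(1+y)^{l-d}$ leads into $K[G]_l+\mathfrak m^{t+1}$, so
  $\sum_{j\le t}{l-d \choose j}\,\xi(y^jf)=0$.  All terms with $j>0$ are divisible by $l-d$, which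
  gives $\xi=(z-l)\eta$ with the Euler element $z\in Dist(T)$, and $z-l\in J_l$.\<close>

section \<open>Points of $GL(m|n)$ and matrix coefficients\<close>

text \<open>\<open>C_sub\<close> is defined through composition factors, so identifying it forces a
  classification of the simple sections of K[G] before any distribution enters. The obstacle is that
  K[G] is given only by generators and relations: no basis is at hand, and nothing is known about
  zero divisors or dense subsets. Hence linear identities are checked on matrix coefficients, a
  spanning set on which comultiplication is matrix multiplication, and elements are detected by
  algebra maps into other rings. Density of the big cell is replaced by power series: a curve with
  constant term 1 has a triangular decomposition without inverting minors, and evaluation along it
  is injective because, after clearing denominators by a central unit, values are polynomials in t
  that return the function at t = 1. In the last step the delicate point is that the quotient \<eta>
  is again a distribution although its formula involves polynomials in the degree. The degree
  operator is a derivation, so a binomial coefficient of order j in it costs at most j orders of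
  vanishing at the identity. Characteristic zero permits the divisions by j+1.\<close>

abbreviation gl_functional :: "('k::field_char_0, 'm::finite, 'n::finite) gl_fun \<Rightarrow> bool" where
  "gl_functional \<phi> \<equiv> Vector_Spaces.linear gl_scale (*) \<phi>"

lemma gl_scale_one_mult: "gl_scale c 1 * f = gl_scale c f" "f * gl_scale c 1 = gl_scale c f"
  by (simp_all flip: gl_scale_mult)

text \<open>K[G] is spanned by the images of words, and a word arises from 1 by left multiplication
  with its letters.\<close>

lemma gl_gen_induct [case_names add scale one gen]:
  assumes add: "\<And>f g. P f \<Longrightarrow> P g \<Longrightarrow> P (f + g)" and scale: "\<And>c f. P f \<Longrightarrow> P (gl_scale c f)"
    and one: "P 1" and gen: "\<And>x f. P f \<Longrightarrow> P (gl_gen x * f)"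
  shows "P f"
proof -
  have zero: "P 0" using scale[OF one, of 0] by simp
  have w: "P (abs_gl (Poly_Mapping.single (Word xs) 1))" for xs
  proof (induction xs)
    case Nil
    have "Poly_Mapping.single (Word []) 1 = (1 :: ('b, 'c) gen word \<Rightarrow>\<^sub>0 'a)"
      by (simp flip: zero_word_def)
    with one show ?case by (simp add: abs_gl_simps)
  next
    case (Cons x xs)
    have "Poly_Mapping.single (Word (x # xs)) 1 = free_gen x * (Poly_Mapping.single (Word xs) 1 :: ('b, 'c) gen word \<Rightarrow>\<^sub>0 'a)"
      by (simp add: free_gen_def mult_single plus_word_def)
    with gen[OF Cons] show ?case by (simp add: abs_gl_simps)
  qed
  have "P (abs_gl x)" for x
  proof (induction x rule: poly_mapping_add_induct)
    case zero
    then show ?case using \<open>P 0\<close> by (simp add: abs_gl_simps)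
  next
    case (add f w c)
    have "abs_gl (Poly_Mapping.single w c) = gl_scale c (abs_gl (Poly_Mapping.single w 1))"
      by (simp add: gl_scale.abs_eq mult_single)
    then have "P (abs_gl (Poly_Mapping.single w c))"
      using w[of "letters w"] scale by simp
    with add assms(1) show ?case by (simp add: abs_gl_simps)
  qed
  then show ?thesis by (metis Quotient3_abs_rep[OF Quotient3_gl])
qed

text \<open>A point of G with values in R. As R may be any ring, the sign rule is demanded of the
  images of the generators. Instances are the restriction to T, points over K[G][[t]], and
  permutation matrices over K.\<close>

locale gl_point = free_eval_hom \<iota> g
  for \<iota> :: "'k::field_char_0 \<Rightarrow> 'r::ring_1" and g :: "('m::finite, 'n::finite) gen \<Rightarrow> 'r" +
  assumes gen_commute: "g x * g y = ksign (gen_par x) (gen_par y) * (g y * g x)"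
    and gen_inverse: "(\<Sum>k\<in>UNIV. g (Cgen i k) * g (Sgen k j)) = of_bool (i = j)"
      "(\<Sum>k\<in>UNIV. g (Sgen i k) * g (Cgen k j)) = of_bool (i = j)"
begin

definition point :: "('k, 'm, 'n) gl \<Rightarrow> 'r" where "point f = free_eval \<iota> g (rep_gl f)"

lemma hom: "free_eval_hom \<iota>" by (rule free_eval_hom_axioms)

lemma eval_rels: "r \<in> gl_rels \<Longrightarrow> free_eval \<iota> g r = 0"
  unfolding gl_rels_def
  by (auto simp: eval_simps[OF hom] gen_inverse simp flip: gen_commute)

text \<open>The defining relations are killed, so the representative chosen by \<open>rep_gl\<close>
  does not matter.\<close>

lemma point_abs: "point (abs_gl x) = free_eval \<iota> g x"
proof -
  have "rep_gl (abs_gl x) - x \<in> ideal_gen gl_rels"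
    using Quotient3_rep_abs[OF Quotient3_gl, of x] by (simp add: ideal_gen.zero)
  from fe_ideal[OF eval_rels this] show ?thesis
    by (simp add: point_def fe_minus)
qed

lemma point_simps:
  "point (a + b) = point a + point b" "point (a - b) = point a - point b" "point (a * b) = point a * point b"
  "point 0 = 0" "point 1 = 1" "point (gl_scale c a) = \<iota> c * point a" "point (gl_gen u) = g u"
proof -
  obtain x y where a: "a = abs_gl x" and b: "b = abs_gl y"
    by (metis Quotient3_abs_rep[OF Quotient3_gl])
  show "point (a + b) = point a + point b" "point (a - b) = point a - point b" "point (a * b) = point a * point b"
    "point 0 = 0" "point 1 = 1" "point (gl_gen u) = g u"
    unfolding a b abs_gl_simps[symmetric] by (simp_all only: point_abs eval_simps[OF hom] fe_one fe_zero)
  show "point (gl_scale c a) = \<iota> c * point a"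
    unfolding a gl_scale.abs_eq by (simp add: point_abs fe_mult fe_single)
qed

lemma iota_vector_space: "vector_space (\<lambda>c x. \<iota> c * x)"
  by standard (simp_all add: iota_add iota_mult iota_one algebra_simps)

lemma point_linear: "Vector_Spaces.linear gl_scale (\<lambda>c x. \<iota> c * x) point"
  by (intro linearI gl.vector_space_axioms iota_vector_space) (simp_all add: point_simps)

end

text \<open>The functions \<open>gl_ent False i j\<close> are the entries of the inverse supertranspose of the generic matrix:
  with this sign the comultiplication takes the same form as on the entries of the generic matrix.\<close>

fun gl_ent :: "bool \<Rightarrow> 'm + 'n \<Rightarrow> 'm + 'n \<Rightarrow> ('k::field_char_0, 'm::finite, 'n::finite) gl" where
  "gl_ent True i j = cc i j"
| "gl_ent False i j = gl_scale (ksign (odd_index i) (\<not> odd_index j)) (ss j i)"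

fun list_par :: "('m + 'n) list \<Rightarrow> bool" where
  "list_par [] = False"
| "list_par (i # is) = (odd_index i \<noteq> list_par is)"

text \<open>Matrix coefficients of a tensor product of copies of the natural supermodule and its dual.\<close>

fun mcoef :: "bool list \<Rightarrow> ('m + 'n) list \<Rightarrow> ('m + 'n) list \<Rightarrow> ('k::field_char_0, 'm::finite, 'n::finite) gl" where
  "mcoef [] [] [] = 1"
| "mcoef (t # ts) (i # is) (j # js) =
     gl_scale (ksign (odd_index j) (list_par is \<noteq> list_par js)) (gl_ent t i j * mcoef ts is js)"
| "mcoef _ _ _ = 0"

definition idx :: "nat \<Rightarrow> ('m + 'n) list set" where "idx n = {ks. length ks = n}"

lemma finite_idx [simp]: "finite (idx n :: ('m::finite + 'n::finite) list set)"
  using finite_lists_length_eq[of "UNIV :: ('m + 'n) set" n] by (simp add: idx_def)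

lemma sum_idx_0: "(\<Sum>ks\<in>idx 0. F ks) = F []"
  by (simp add: idx_def)

lemma sum_idx_Suc:
  fixes F :: "('m::finite + 'n::finite) list \<Rightarrow> 'a::comm_monoid_add"
  shows "(\<Sum>ks\<in>idx (Suc n). F ks) = (\<Sum>k\<in>UNIV. \<Sum>ks\<in>idx n. F (k # ks))"
proof -
  have "idx (Suc n) = (\<lambda>(k, ks). k # ks) ` (UNIV \<times> (idx n :: ('m + 'n) list set))"
    by (auto simp: idx_def length_Suc_conv)
  then have "(\<Sum>ks\<in>idx (Suc n). F ks) = (\<Sum>(k, ks)\<in>UNIV \<times> idx n. F (k # ks))"
    by (simp add: sum.reindex inj_on_def case_prod_beta)
  then show ?thesis by (simp add: sum.cartesian_product)
qed

lemma ksign_simps [simp]: "ksign False q = 1" "ksign p False = 1" "ksign True True = -1"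
  by (simp_all add: ksign_def)

lemma list_par_append [simp]: "list_par (u @ v) = (list_par u \<noteq> list_par v)"
  by (induction u) auto

lemma gl_part_ent: "gl_part p (gl_ent t i j) = (if p = (odd_index i \<noteq> odd_index j) then gl_ent t i j else 0)"
  by (cases t) (auto simp: gl_part_gen gl_part_scale)

lemma gl_part_mult_part:
  assumes "\<And>p. gl_part p f = (if p = a then f else 0)" "\<And>p. gl_part p g = (if p = b then g else 0)"
  shows "gl_part p (f * g) = (if p = (a \<noteq> b) then f * g else 0)"
  unfolding gl_part_mult assms by auto

lemma gl_part_mcoef:
  "gl_part p (mcoef ts is js :: ('k::field_char_0, 'm::finite, 'n::finite) gl) = (if p = (list_par is \<noteq> list_par js) then mcoef ts is js else 0)"
proof (induction ts "is" js arbitrary: p rule: mcoef.induct)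
  case (2 t ts i "is" j js)
  have "gl_part p (gl_ent t i j * mcoef ts is js :: ('k, 'm, 'n) gl)
     = (if p = ((odd_index i \<noteq> odd_index j) \<noteq> (list_par is \<noteq> list_par js)) then gl_ent t i j * mcoef ts is js else 0)"
    by (rule gl_part_mult_part; rule gl_part_ent 2)
  then show ?case by (auto simp: gl_part_scale)
qed (simp_all add: gl_part_one)

lemma gl_delta_ent: "gl_delta (gl_ent t i j) = (\<Sum>k\<in>UNIV. tens (gl_ent t i k) (gl_ent t k j))"
proof (cases t)
  case False
  then show ?thesis
    by (simp add: gl_delta_scale gl_delta_simps delta_gen_Sgen tens_scale gl2.scale_sum_right del: delta_gen.simps)
      (intro sum.cong refl, simp add: ksign_def)
qed (simp add: gl_delta_simps)

lemma mcoef_mismatch: "\<not> (length is = length ts \<and> length js = length ts) \<Longrightarrow> mcoef ts is js = 0"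
  by (induction ts "is" js rule: mcoef.induct) auto

text \<open>The sign in \<open>mcoef\<close> is tailored to this formula. With i', j', k' the
  parities of the tails, multiplication in the tensor square contributes (k+j)(i'+k'), and j(i'+j')
  + (k+j)(i'+k') = k(i'+k') + j(k'+j') modulo 2, so all signs are absorbed.\<close>

lemma gl_delta_mcoef:
  assumes "length is = length ts" "length js = length ts"
  shows "gl_delta (mcoef ts is js :: ('k::field_char_0, 'm::finite, 'n::finite) gl) = (\<Sum>ks\<in>idx (length ts). tens (mcoef ts is ks) (mcoef ts ks js))"
  using assms
proof (induction ts arbitrary: "is" js)
  case Nil
  then show ?case by (simp add: sum_idx_0 gl_delta_simps one_gl2_def)
next
  case (Cons t ts)
  then obtain i is' j js' where ij: "is = i # is'" "js = j # js'" "length is' = length ts" "length js' = length ts"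
    by (metis length_Suc_conv list.size(4) add.right_neutral add_Suc_right)
  have "gl_delta (mcoef (t # ts) is js :: ('k, 'm, 'n) gl) =
    (\<Sum>k\<in>UNIV. \<Sum>ks\<in>idx (length ts). gl2_scale (ksign (odd_index j) (list_par is' \<noteq> list_par js'))
      (tens (gl_ent t i k) (gl_ent t k j) * tens (mcoef ts is' ks) (mcoef ts ks js')))"
    by (simp add: ij gl_delta_scale gl_delta_simps gl_delta_ent Cons.IH[OF ij(3,4)] sum_product gl2.scale_sum_right)
  also have "\<dots> = (\<Sum>k\<in>UNIV. \<Sum>ks\<in>idx (length ts). tens (mcoef (t # ts) is (k # ks)) (mcoef (t # ts) (k # ks) js))"
  proof (intro sum.cong refl)
    fix k :: "'m + 'n" and ks :: "('m + 'n) list"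
    have "tens (gl_ent t i k :: ('k, 'm, 'n) gl) (gl_ent t k j) * tens (mcoef ts is' ks) (mcoef ts ks js')
       = gl2_scale (ksign (odd_index k \<noteq> odd_index j) (list_par is' \<noteq> list_par ks))
          (tens (gl_ent t i k * mcoef ts is' ks) (gl_ent t k j * mcoef ts ks js'))"
      by (rule times_gl2_hom) (auto simp: gl_part_ent gl_part_mcoef)
    then show "gl2_scale (ksign (odd_index j) (list_par is' \<noteq> list_par js'))
      (tens (gl_ent t i k) (gl_ent t k j) * tens (mcoef ts is' ks) (mcoef ts ks js'))
      = (tens :: _ \<Rightarrow> _ \<Rightarrow> ('k, 'm, 'n) gl2) (mcoef (t # ts) is (k # ks)) (mcoef (t # ts) (k # ks) js)"
      by (auto simp: ij tens_scale ksign_def)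
  qed
  finally show ?case by (simp add: sum_idx_Suc)
qed

lemma gl_eps_ent: "gl_eps (gl_ent t i j) = of_bool (i = j)"
  by (cases t) (auto simp: gl_eps_simps ksign_def)

lemma gl_eps_mcoef:
  assumes "length is = length ts" "length js = length ts"
  shows "gl_eps (mcoef ts is js) = of_bool (is = js)"
  using assms
  by (induction ts "is" js rule: mcoef.induct) (auto simp: gl_eps_simps gl_eps_ent)

lemma mcoef_append:
  assumes "length is = length ts" "length js = length ts" "length is' = length ts'" "length js' = length ts'"
  shows "mcoef ts is js * mcoef ts' is' js'
    = gl_scale (ksign (list_par js) (list_par is' \<noteq> list_par js')) (mcoef (ts @ ts') (is @ is') (js @ js'))"
  using assms
  by (induction ts "is" js rule: mcoef.induct)
    (auto simp: mult.assoc ksign_def simp flip: gl_scale_mult)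

text \<open>Matrix coefficients span K[G] because prepending a letter multiplies by an entry up to
  sign. Their advantage over words is that comultiplication, weights and degree can be read off from
  the index lists.\<close>

lemma mcoef_induct [case_names add scale mcoef]:
  assumes add: "\<And>f g. P f \<Longrightarrow> P g \<Longrightarrow> P (f + g)" and scale: "\<And>c f. P f \<Longrightarrow> P (gl_scale c f)"
    and mcoef: "\<And>ts is js. length is = length ts \<Longrightarrow> length js = length ts \<Longrightarrow> P (mcoef ts is js)"
  shows "P (f :: ('k::field_char_0, 'm::finite, 'n::finite) gl)"
proof -
  let ?M = "{mcoef ts is js :: ('k, 'm, 'n) gl | ts is js. length is = length ts \<and> length js = length ts}"
  have "f \<in> gl.span ?M"
  proof (induction f rule: gl_gen_induct)
    case one
    have "mcoef [] [] [] \<in> gl.span ?M"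
      by (rule gl.span_base, simp only: mem_Collect_eq, intro exI conjI, rule refl) simp_all
    then show ?case by simp
  next
    case (gen x f)
    from gen show ?case
    proof (induction rule: gl.span_induct_alt)
      case (step c g h)
      then obtain ts "is" js where g: "g = mcoef ts is js" "length is = length ts" "length js = length ts" by blast
      obtain t i j s where x: "gl_gen x = gl_scale s (gl_ent t i j :: ('k, 'm, 'n) gl)"
      proof (cases x)
        case (Cgen i j)
        then show ?thesis using that[of 1 True i j] by simp
      next
        case (Sgen i j)
        then show ?thesis
          using that[of "ksign (odd_index j) (\<not> odd_index i)" False j i] by (auto simp: ksign_def)
      qed
      have gx: "gl_gen x * g = gl_scale (s * ksign (odd_index j) (list_par is \<noteq> list_par js)) (mcoef (t # ts) (i # is) (j # js))"
        by (simp add: x g ksign_def flip: gl_scale_mult)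
      have "length (i # is) = length (t # ts)" "length (j # js) = length (t # ts)"
        using g by simp_all
      then have "mcoef (t # ts) (i # is) (j # js) \<in> gl.span ?M"
        by (intro gl.span_base) blast
      then have "gl_gen x * g \<in> gl.span ?M"
        unfolding gx by (rule gl.span_scale)
      with step show ?case
        by (simp add: distrib_left gl.span_add gl.span_scale flip: gl_scale_mult)
    qed (simp add: gl.span_zero)
  qed (auto intro: gl.span_add gl.span_scale)
  then show ?thesis
  proof (induction rule: gl.span_induct_alt)
    case base
    show ?case using scale[OF mcoef[of "[]" "[]" "[]"], of 0] by simp
  next
    case (step c g h)
    then show ?case using add scale mcoef by blast
  qed
qed

section \<open>Convolution with functionals\<close>

text \<open>For mismatching lengths the left side is 0 and every summand has a zero factor, so the
  formula can be iterated unconditionally.\<close>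

lemma gl_delta_mcoef_sum:
  "gl_delta (mcoef ts is js :: ('k::field_char_0, 'm::finite, 'n::finite) gl)
    = (\<Sum>ks\<in>idx (length ts). tens (mcoef ts is ks) (mcoef ts ks js))"
proof (cases "length is = length ts \<and> length js = length ts")
  case False
  then have "mcoef ts is js = (0 :: ('k, 'm, 'n) gl)"
    by (rule mcoef_mismatch)
  moreover have "tens (mcoef ts is ks) (mcoef ts ks js) = (0 :: ('k, 'm, 'n) gl2)" for ks
  proof -
    have "mcoef ts is ks = (0 :: ('k, 'm, 'n) gl) \<or> mcoef ts ks js = (0 :: ('k, 'm, 'n) gl)"
      using False mcoef_mismatch by blast
    then show ?thesis by (auto simp: tens_simps)
  qed
  moreover have "gl_delta (0 :: ('k, 'm, 'n) gl) = 0"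
    using gl_delta_scale[of 0 "0 :: ('k, 'm, 'n) gl"] by simp
  ultimately show ?thesis by simp
qed (simp add: gl_delta_mcoef)

text \<open>The plain linear map id \<otimes> \<phi>, without Koszul sign, so that
  \<open>right_act\<close> is the ordinary action of the dual algebra on a comodule.\<close>

definition slice_right :: "('k, 'm, 'n) gl_fun \<Rightarrow> ('k::field_char_0, 'm::finite, 'n::finite) gl2 \<Rightarrow> ('k, 'm, 'n) gl" where
  "slice_right \<phi> = tensor_lift gl_scale (\<lambda>a b. gl_scale (\<phi> b) a)"

definition slice_left :: "('k, 'm, 'n) gl_fun \<Rightarrow> ('k::field_char_0, 'm::finite, 'n::finite) gl2 \<Rightarrow> ('k, 'm, 'n) gl" where
  "slice_left \<phi> = tensor_lift gl_scale (\<lambda>a b. gl_scale (\<phi> a) b)"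

definition right_act :: "('k, 'm, 'n) gl_fun \<Rightarrow> ('k::field_char_0, 'm::finite, 'n::finite) gl \<Rightarrow> ('k, 'm, 'n) gl" where
  "right_act \<phi> f = slice_right \<phi> (gl_delta f)"

definition left_act :: "('k, 'm, 'n) gl_fun \<Rightarrow> ('k::field_char_0, 'm::finite, 'n::finite) gl \<Rightarrow> ('k, 'm, 'n) gl" where
  "left_act \<phi> f = slice_left \<phi> (gl_delta f)"

lemma linear_intro:
  assumes "\<And>f g. F (f + g) = F f + F g" "\<And>c f. F (gl_scale c f) = gl_scale c (F f)"
  shows "Vector_Spaces.linear gl_scale gl_scale F"
  by (intro linearI gl.vector_space_axioms assms)

lemma functional_intro:
  assumes "\<And>f g. \<phi> (f + g) = \<phi> f + \<phi> g" "\<And>c f. \<phi> (gl_scale c f) = c * \<phi> f"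
  shows "gl_functional \<phi>"
  by (intro linearI gl.vector_space_axioms field_vector_space assms)

lemma gl_delta_linear: "Vector_Spaces.linear gl_scale gl2_scale gl_delta"
  by (intro linearI gl.vector_space_axioms gl2.vector_space_axioms) (simp_all add: gl_delta_simps gl_delta_scale)

context
  fixes \<phi> :: "('k::field_char_0, 'm::finite, 'n::finite) gl_fun"
  assumes \<phi>: "gl_functional \<phi>"
begin

lemma slice_bilinear:
  "gl_bilinear gl_scale (\<lambda>a b. gl_scale (\<phi> b) a)" "gl_bilinear gl_scale (\<lambda>a b. gl_scale (\<phi> a) b)"
  unfolding gl_bilinear_def
  by (auto intro!: linear_intro simp: linearD[OF \<phi>] gl.scale_left_distrib gl.scale_right_distrib mult.commute)

lemma slice_tens: "slice_right \<phi> (tens a b) = gl_scale (\<phi> b) a" "slice_left \<phi> (tens a b) = gl_scale (\<phi> a) b"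
  unfolding slice_right_def slice_left_def
  by (rule tensor_lift_tens[OF gl.vector_space_axioms] slice_bilinear)+

lemma slice_right_linear: "Vector_Spaces.linear gl2_scale gl_scale (slice_right \<phi>)"
  unfolding slice_right_def by (rule tensor_lift_linear[OF gl.vector_space_axioms slice_bilinear(1)])

lemma slice_left_linear: "Vector_Spaces.linear gl2_scale gl_scale (slice_left \<phi>)"
  unfolding slice_left_def by (rule tensor_lift_linear[OF gl.vector_space_axioms slice_bilinear(2)])

lemma right_act_linear: "Vector_Spaces.linear gl_scale gl_scale (right_act \<phi>)"
  by (rule linear_intro)
    (simp_all add: right_act_def linearD[OF gl_delta_linear] linearD[OF slice_right_linear])

lemma left_act_linear: "Vector_Spaces.linear gl_scale gl_scale (left_act \<phi>)"
  by (rule linear_intro)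
    (simp_all add: left_act_def linearD[OF gl_delta_linear] linearD[OF slice_left_linear])

lemma right_act_mcoef:
  "right_act \<phi> (mcoef ts is js) = (\<Sum>ks\<in>idx (length ts). gl_scale (\<phi> (mcoef ts ks js)) (mcoef ts is ks))"
  by (simp add: right_act_def gl_delta_mcoef_sum linearD[OF slice_right_linear] slice_tens)

lemma left_act_mcoef:
  "left_act \<phi> (mcoef ts is js) = (\<Sum>ks\<in>idx (length ts). gl_scale (\<phi> (mcoef ts is ks)) (mcoef ts ks js))"
  by (simp add: left_act_def gl_delta_mcoef_sum linearD[OF slice_left_linear] slice_tens)

end

lemma linear_eq_on_mcoef:
  assumes "Vector_Spaces.linear gl_scale s F" "Vector_Spaces.linear gl_scale s G"
    "\<And>ts is js. length is = length ts \<Longrightarrow> length js = length ts \<Longrightarrow> F (mcoef ts is js) = G (mcoef ts is js)"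
  shows "F f = G f"
  by (induction f rule: mcoef_induct) (simp_all add: assms(3) linearD[OF assms(1)] linearD[OF assms(2)])

lemma linear_compose: "Vector_Spaces.linear s1 s2 F \<Longrightarrow> Vector_Spaces.linear s2 s3 G \<Longrightarrow> Vector_Spaces.linear s1 s3 (\<lambda>x. G (F x))"
  using Vector_Spaces.linear_compose[of s1 s2 F s3 G] by (simp add: o_def)

text \<open>This is coassociativity; on matrix coefficients it is the interchange of two finite
  sums.\<close>

lemma right_left_act_commute:
  assumes "gl_functional \<phi>" "gl_functional \<psi>"
  shows "right_act \<phi> (left_act \<psi> f) = left_act \<psi> (right_act \<phi> f)"
proof (rule linear_eq_on_mcoef[of gl_scale "\<lambda>f. right_act \<phi> (left_act \<psi> f)" "\<lambda>f. left_act \<psi> (right_act \<phi> f)"])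
  fix ts :: "bool list" and "is" js :: "('b + 'c) list"
  assume l: "length is = length ts" "length js = length ts"
  show "right_act \<phi> (left_act \<psi> (mcoef ts is js)) = left_act \<psi> (right_act \<phi> (mcoef ts is js))"
    by (simp add: left_act_mcoef right_act_mcoef l assms linearD[OF right_act_linear[OF assms(1)]]
        linearD[OF left_act_linear[OF assms(2)]] gl.scale_sum_right mult.commute, rule sum.swap)
qed (rule linear_compose[OF left_act_linear right_act_linear] linear_compose[OF right_act_linear left_act_linear] assms)+

lemma gl_eps_functional: "gl_functional gl_eps"
  by (rule functional_intro) (simp_all add: gl_eps_simps)

lemma gl_eps_mcoef_of_bool:
  "gl_eps (mcoef ts is js :: ('k::field_char_0, 'm::finite, 'n::finite) gl) = of_bool (is = js \<and> length js = length ts)"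
  "gl_eps (mcoef ts is js :: ('k, 'm, 'n) gl) = of_bool (is = js \<and> length is = length ts)"
proof -
  show "gl_eps (mcoef ts is js :: ('k, 'm, 'n) gl) = of_bool (is = js \<and> length js = length ts)"
  proof (cases "length is = length ts \<and> length js = length ts")
  case False
  then have "mcoef ts is js = (0 :: ('k, 'm, 'n) gl)" by (rule mcoef_mismatch)
  with False show ?thesis using linearD(3)[OF gl_eps_functional] by auto
  qed (simp add: gl_eps_mcoef)
  then show "gl_eps (mcoef ts is js :: ('k, 'm, 'n) gl) = of_bool (is = js \<and> length is = length ts)"
    by auto
qed

lemma sum_idx_of_bool:
  fixes "is" :: "('m::finite + 'n::finite) list"
  assumes "length is = n"
  shows "(\<Sum>ks\<in>idx n. gl_scale (of_bool (is = ks)) (F ks)) = F is" "(\<Sum>ks\<in>idx n. gl_scale (of_bool (ks = is)) (F ks)) = F is"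
proof -
  have "is \<in> idx n" using assms by (simp add: idx_def)
  then show "(\<Sum>ks\<in>idx n. gl_scale (of_bool (is = ks)) (F ks)) = F is" "(\<Sum>ks\<in>idx n. gl_scale (of_bool (ks = is)) (F ks)) = F is"
    by (simp_all add: of_bool_def if_distrib[of "\<lambda>c. gl_scale c _"] cong: if_cong)
qed

lemma act_eps: "right_act gl_eps f = f" "left_act gl_eps f = f"
proof -
  have id: "Vector_Spaces.linear gl_scale gl_scale (\<lambda>f. f :: ('a, 'b, 'c) gl)"
    by (rule linear_intro) simp_all
  show "right_act gl_eps f = f"
    by (rule linear_eq_on_mcoef[OF right_act_linear[OF gl_eps_functional] id])
      (simp add: right_act_mcoef gl_eps_functional gl_eps_mcoef_of_bool(1) sum_idx_of_bool)
  show "left_act gl_eps f = f"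
    by (rule linear_eq_on_mcoef[OF left_act_linear[OF gl_eps_functional] id])
      (simp add: left_act_mcoef gl_eps_functional gl_eps_mcoef_of_bool(2) sum_idx_of_bool)
qed

lemma sum_idx_of_bool_mult:
  fixes "is" :: "('m::finite + 'n::finite) list"
  assumes "length is = n"
  shows "(\<Sum>ks\<in>idx n. F ks * of_bool (ks = is)) = (F is :: 'k::comm_ring_1)"
    "(\<Sum>ks\<in>idx n. F ks * of_bool (is = ks)) = (F is :: 'k::comm_ring_1)"
proof -
  have "is \<in> idx n" using assms by (simp add: idx_def)
  then show "(\<Sum>ks\<in>idx n. F ks * of_bool (ks = is)) = F is" "(\<Sum>ks\<in>idx n. F ks * of_bool (is = ks)) = F is"
    by (simp_all add: of_bool_def if_distrib[of "\<lambda>c. _ * c"] cong: if_cong)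
qed

lemma eps_act:
  assumes "gl_functional \<phi>"
  shows "gl_eps (right_act \<phi> f) = \<phi> f" "gl_eps (left_act \<phi> f) = \<phi> f"
proof -
  show "gl_eps (right_act \<phi> f) = \<phi> f"
    by (rule linear_eq_on_mcoef[OF linear_compose[OF right_act_linear[OF assms] gl_eps_functional] assms])
      (simp add: right_act_mcoef assms linearD[OF gl_eps_functional] gl_eps_mcoef_of_bool(2) sum_idx_of_bool_mult del: sum_mult_of_bool_eq)
  show "gl_eps (left_act \<phi> f) = \<phi> f"
    by (rule linear_eq_on_mcoef[OF linear_compose[OF left_act_linear[OF assms] gl_eps_functional] assms])
      (simp add: left_act_mcoef assms linearD[OF gl_eps_functional] gl_eps_mcoef_of_bool(1) sum_idx_of_bool_mult del: sum_mult_of_bool_eq)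
qed

lemma gl_part_linear: "Vector_Spaces.linear gl_scale gl_scale (gl_part p)"
  by (rule linear_intro) (simp_all add: gl_part_add gl_part_scale)

text \<open>The second assumption says that \<phi> is homogeneous of parity p. On a matrix
  coefficient only those intermediate indices survive whose parity differs from that of the row
  index by p.\<close>

lemma left_act_part:
  assumes \<phi>: "gl_functional \<phi>" and "\<And>f. \<phi> (gl_part (\<not> p) f) = 0"
  shows "left_act \<phi> (gl_part q f) = gl_part (p \<noteq> q) (left_act \<phi> f)"
proof (rule linear_eq_on_mcoef[of gl_scale "\<lambda>f. left_act \<phi> (gl_part q f)" "\<lambda>f. gl_part (p \<noteq> q) (left_act \<phi> f)"])
  fix ts :: "bool list" and "is" js :: "('b + 'c) list"
  assume l: "length is = length ts" "length js = length ts"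
  have 0: "\<phi> (mcoef ts is ks) = 0" if "p \<noteq> (list_par is \<noteq> list_par ks)" for ks
  proof -
    have "gl_part (\<not> p) (mcoef ts is ks) = (mcoef ts is ks :: ('a, 'b, 'c) gl)"
      using that by (auto simp: gl_part_mcoef)
    then show ?thesis using assms(2) by metis
  qed
  have 1: "gl_scale (\<phi> (mcoef ts is ks)) (gl_part (p \<noteq> q) (mcoef ts ks js))
      = gl_scale (of_bool (q = (list_par is \<noteq> list_par js))) (gl_scale (\<phi> (mcoef ts is ks)) (mcoef ts ks js))" for ks
    using 0[of ks] by (cases "p \<noteq> (list_par is \<noteq> list_par ks)") (auto simp: gl_part_mcoef)
  have "gl_part q (mcoef ts is js :: ('a, 'b, 'c) gl) = gl_scale (of_bool (q = (list_par is \<noteq> list_par js))) (mcoef ts is js)"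
    by (simp add: gl_part_mcoef)
  then show "left_act \<phi> (gl_part q (mcoef ts is js)) = gl_part (p \<noteq> q) (left_act \<phi> (mcoef ts is js))"
    by (simp only: linearD(2)[OF left_act_linear[OF \<phi>]] left_act_mcoef[OF \<phi>] linearD(6)[OF gl_part_linear]
        gl_part_scale 1 gl.scale_sum_right)
qed (rule linear_compose[OF left_act_linear gl_part_linear] linear_compose[OF gl_part_linear left_act_linear] \<phi>)+

lemma gl_tensor_map_tens:
  assumes "Vector_Spaces.linear gl_scale gl_scale \<theta>" "Vector_Spaces.linear gl_scale gl_scale \<eta>"
  shows "gl_tensor_map \<theta> \<eta> (tens a b) = tens (\<theta> a) (\<eta> b)" "Vector_Spaces.linear gl2_scale gl2_scale (gl_tensor_map \<theta> \<eta>)"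
proof -
  have "gl_bilinear gl2_scale (\<lambda>a b. tens (\<theta> a) (\<eta> b))"
    unfolding gl_bilinear_def
    by (auto intro!: linearI gl.vector_space_axioms gl2.vector_space_axioms simp: linearD[OF assms(1)] linearD[OF assms(2)] tens_add tens_scale)
  from tensor_lift_tens[OF gl2.vector_space_axioms this] tensor_lift_linear[OF gl2.vector_space_axioms this]
  show "gl_tensor_map \<theta> \<eta> (tens a b) = tens (\<theta> a) (\<eta> b)" "Vector_Spaces.linear gl2_scale gl2_scale (gl_tensor_map \<theta> \<eta>)"
    unfolding gl_tensor_map_def by blast+
qed

lemma id_linear: "Vector_Spaces.linear gl_scale gl_scale (id :: ('k::field_char_0, 'm::finite, 'n::finite) gl \<Rightarrow> _)"
  by (rule linear_intro) simp_all

text \<open>Coassociativity again: every functional yields a comodule endomorphism of K[G] by left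
  convolution. The homomorphisms into induced supermodules will be of this kind.\<close>

lemma delta_left_act:
  assumes \<phi>: "gl_functional \<phi>"
  shows "gl_delta (left_act \<phi> f) = gl_tensor_map (left_act \<phi>) id (gl_delta f)"
proof (rule linear_eq_on_mcoef[of gl2_scale "\<lambda>f. gl_delta (left_act \<phi> f)" "\<lambda>f. gl_tensor_map (left_act \<phi>) id (gl_delta f)"])
  note tm = gl_tensor_map_tens[OF left_act_linear[OF \<phi>] id_linear]
  show "Vector_Spaces.linear gl_scale gl2_scale (\<lambda>f. gl_tensor_map (left_act \<phi>) id (gl_delta f))"
    by (rule linear_compose[OF gl_delta_linear tm(2)])
  show "Vector_Spaces.linear gl_scale gl2_scale (\<lambda>f. gl_delta (left_act \<phi> f))"
    by (rule linear_compose[OF left_act_linear[OF \<phi>] gl_delta_linear])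
  fix ts :: "bool list" and "is" js :: "('b + 'c) list"
  assume l: "length is = length ts" "length js = length ts"
  show "gl_delta (left_act \<phi> (mcoef ts is js)) = gl_tensor_map (left_act \<phi>) id (gl_delta (mcoef ts is js))"
    by (simp add: left_act_mcoef l \<phi> linearD[OF gl_delta_linear] gl_delta_mcoef_sum linearD[OF tm(2)] tm(1)
        gl2.scale_sum_right tens_simps tens_scale, rule sum.swap)
qed

section \<open>Subsupermodules of $K[G]$\<close>

lemma gl2_basis_expansion:
  fixes t :: "('k::field_char_0, 'm::finite, 'n::finite) gl2"
  assumes "gl.independent B" "gl.span B = UNIV"
  shows "\<exists>F g. finite F \<and> F \<subseteq> B \<and> t = (\<Sum>b\<in>F. tens (g b) b)"
proof (induction t rule: gl2_induct)
  case zero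
  show ?case by (rule exI[of _ "{}"], rule exI[of _ "\<lambda>_. 0"]) simp
next
  case (add t u)
  obtain F g where F: "finite F" "F \<subseteq> B" "t = (\<Sum>b\<in>F. tens (g b) b)"
    using add(1) by (elim exE conjE) (rule that)
  obtain F' g' where F': "finite F'" "F' \<subseteq> B" "u = (\<Sum>b\<in>F'. tens (g' b) b)"
    using add(2) by (elim exE conjE) (rule that)
  have 1: "t = (\<Sum>b\<in>F \<union> F'. tens (if b \<in> F then g b else 0) b)"
    unfolding F(3) by (rule sum.mono_neutral_cong_left) (simp_all add: F F' linearD(3)[OF tens_linear(1)])
  have 2: "u = (\<Sum>b\<in>F \<union> F'. tens (if b \<in> F' then g' b else 0) b)"
    unfolding F'(3) by (rule sum.mono_neutral_cong_left) (simp_all add: F F' linearD(3)[OF tens_linear(1)])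
  have "t + u = (\<Sum>b\<in>F \<union> F'. tens ((if b \<in> F then g b else 0) + (if b \<in> F' then g' b else 0)) b)"
    unfolding tens_add sum.distrib by (subst 1, subst 2) (rule refl)
  moreover have "finite (F \<union> F')" "F \<union> F' \<subseteq> B" using F F' by simp_all
  ultimately show ?case
    by (intro exI[of _ "F \<union> F'"] exI[of _ "\<lambda>b. (if b \<in> F then g b else 0) + (if b \<in> F' then g' b else 0)"] conjI)
next
  case (tens a b)
  let ?F = "{c. gl.representation B b c \<noteq> 0}"
  have "b = (\<Sum>c\<in>?F. gl_scale (gl.representation B b c) c)"
    using gl.sum_nonzero_representation_eq[OF assms(1), of b] assms(2) by simp
  then have "tens a b = tens a (\<Sum>c\<in>?F. gl_scale (gl.representation B b c) c)" by simp
  also have "\<dots> = (\<Sum>c\<in>?F. tens (gl_scale (gl.representation B b c) a) c)"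
    by (simp only: linearD(6)[OF tens_linear(2)] tens_scale)
  finally have "tens a b = (\<Sum>c\<in>?F. tens (gl_scale (gl.representation B b c) a) c)" .
  moreover have "finite ?F" "?F \<subseteq> B"
    using gl.finite_representation gl.representation_ne_zero by blast+
  ultimately show ?case
    by (intro exI[of _ ?F] exI[of _ "\<lambda>c. gl_scale (gl.representation B b c) a"] conjI)
qed

text \<open>Subcomodules as submodules for the full dual algebra: unlike the span condition in
  \<open>subsupermodule\<close>, this form passes at once to intersections, sums and
  preimages.\<close>

definition act_closed :: "('k::field_char_0, 'm::finite, 'n::finite) gl set \<Rightarrow> bool" where
  "act_closed N \<longleftrightarrow> gl.subspace N \<and> (\<forall>f\<in>N. \<forall>p. gl_part p f \<in> N) \<and> (\<forall>\<phi>. gl_functional \<phi> \<longrightarrow> (\<forall>f\<in>N. right_act \<phi> f \<in> N))"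

lemma slice_right_in_subspace:
  assumes "gl.subspace N" "gl_functional \<phi>" "t \<in> gl2.span {tens a b | a b. a \<in> N}"
  shows "slice_right \<phi> t \<in> N"
  using assms(3)
proof (induction rule: gl2.span_induct_alt)
  case base
  then show ?case using assms(1) by (simp add: linearD[OF slice_right_linear[OF assms(2)]] gl.subspace_0)
next
  case (step c g h)
  then show ?case using assms(1)
    by (auto simp: linearD[OF slice_right_linear[OF assms(2)]] slice_tens[OF assms(2)] gl.subspace_add gl.subspace_scale)
qed

text \<open>For the converse write \<Delta>(f) as a sum of g(b) \<otimes> b over a basis: convolving
  with the coordinate functional of b returns g(b), which therefore lies in N.\<close>

lemma subsupermodule_iff: "subsupermodule N \<longleftrightarrow> act_closed N"
proof
  assume "subsupermodule N"
  then show "act_closed N"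
    unfolding subsupermodule_def act_closed_def right_act_def
    using slice_right_in_subspace by blast
next
  assume N: "act_closed N"
  obtain B :: "('a, 'b, 'c) gl set" where B: "gl.independent B" "gl.span B = UNIV"
    by (rule gl.maximal_independent_subset[of UNIV]) (simp add: top.extremum_unique)
  have "gl_delta f \<in> gl2.span {tens a b | a b. a \<in> N}" if f: "f \<in> N" for f
  proof -
    obtain F g where F: "finite F" "F \<subseteq> B" "gl_delta f = (\<Sum>b\<in>F. tens (g b) b)"
      using gl2_basis_expansion[OF B, of "gl_delta f"] by blast
    have "g b \<in> N" if b: "b \<in> F" for b
    proof -
      let ?\<phi> = "\<lambda>v. gl.representation B v b"
      have \<phi>: "gl_functional ?\<phi>"
        by (rule functional_intro) (simp_all add: gl.representation_add gl.representation_scale B)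
      have "right_act ?\<phi> f = (\<Sum>c\<in>F. gl_scale (of_bool (b = c)) (g c))"
        unfolding right_act_def F(3) linearD(6)[OF slice_right_linear[OF \<phi>]]
        using F(2) by (intro sum.cong) (auto simp: slice_tens[OF \<phi>] gl.representation_basis[OF B(1)])
      also have "\<dots> = g b"
        using b F(1) by (simp add: of_bool_def if_distrib[of "\<lambda>c. gl_scale c _"] cong: if_cong)
      finally show ?thesis using N f \<phi> by (metis act_closed_def)
    qed
    then have "tens (g b) b \<in> {tens a b | a b. a \<in> N}" if "b \<in> F" for b
      using that by blast
    then show ?thesis
      unfolding F(3) by (intro gl2.span_sum gl2.span_base)
  qed
  then show "subsupermodule N"
    using N unfolding subsupermodule_def act_closed_def by simp
qed

section \<open>Weights\<close>

definition unit_weight :: "'m + 'n \<Rightarrow> ('m, 'n) weight" where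
  "unit_weight i = (\<lambda>j. of_bool (i = j))"

text \<open>K[T] is taken as the group algebra of the weight group, in which the generic matrix
  becomes a diagonal matrix of group-like elements.\<close>

fun torus_gen :: "('m, 'n) gen \<Rightarrow> ('m, 'n) weight \<Rightarrow>\<^sub>0 'k::field_char_0" where
  "torus_gen (Cgen i j) = of_bool (i = j) * Poly_Mapping.single (unit_weight i) 1"
| "torus_gen (Sgen i j) = of_bool (i = j) * Poly_Mapping.single (- unit_weight i) 1"

lemma torus_gen_odd: "gen_par x \<Longrightarrow> torus_gen x = 0"
  by (cases x) auto

global_interpretation torus: gl_point "\<lambda>c::'k::field_char_0. Poly_Mapping.single 0 c"
  "torus_gen :: ('m::finite, 'n::finite) gen \<Rightarrow> ('m, 'n) weight \<Rightarrow>\<^sub>0 'k"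
proof unfold_locales
  show "torus_gen x * torus_gen y = ksign (gen_par x) (gen_par y) * (torus_gen y * torus_gen x :: ('m, 'n) weight \<Rightarrow>\<^sub>0 'k)"
    for x y :: "('m, 'n) gen"
    by (auto simp: ksign_def torus_gen_odd mult.commute)
  have *: "(\<Sum>k\<in>UNIV. (of_bool (i = k) * a i) * (of_bool (k = j) * b k)) = (of_bool (i = j) * (a i * b i) :: ('m, 'n) weight \<Rightarrow>\<^sub>0 'k)"
    for i j :: "'m + 'n" and a b
    using sum_of_bool_mult(1)[of i "\<lambda>k. a i * (of_bool (k = j) * b k)"] by (simp add: mult_ac)
  show "(\<Sum>k\<in>UNIV. torus_gen (Cgen i k) * torus_gen (Sgen k j)) = (of_bool (i = j) :: ('m, 'n) weight \<Rightarrow>\<^sub>0 'k)"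
    "(\<Sum>k\<in>UNIV. torus_gen (Sgen i k) * torus_gen (Cgen k j)) = (of_bool (i = j) :: ('m, 'n) weight \<Rightarrow>\<^sub>0 'k)" for i j :: "'m + 'n"
    using *[of i "\<lambda>k. Poly_Mapping.single (unit_weight k) 1" j "\<lambda>k. Poly_Mapping.single (- unit_weight k) 1"]
      *[of i "\<lambda>k. Poly_Mapping.single (- unit_weight k) 1" j "\<lambda>k. Poly_Mapping.single (unit_weight k) 1"]
    by (simp_all add: mult_single)
qed (simp_all add: single_add mult_single mult.commute)

text \<open>A functional on K[T] is prescribed by its values h on the characters, which form a
  basis. Weight projections, degree projections and the Euler element all have this form.\<close>

definition torus_fun :: "(('m, 'n) weight \<Rightarrow> 'k) \<Rightarrow> ('k::field_char_0, 'm::finite, 'n::finite) gl_fun" where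
  "torus_fun h f = (\<Sum>x\<in>Poly_Mapping.keys (torus.point f). h x * Poly_Mapping.lookup (torus.point f) x)"

definition letter_weight :: "bool \<Rightarrow> 'm + 'n \<Rightarrow> ('m, 'n) weight" where
  "letter_weight t i = (if t then unit_weight i else - unit_weight i)"

fun weight_of :: "bool list \<Rightarrow> ('m + 'n) list \<Rightarrow> ('m, 'n) weight" where
  "weight_of (t # ts) (i # is) = letter_weight t i + weight_of ts is"
| "weight_of _ _ = 0"

lemma single0_mult_pm_scale:
  fixes p :: "'x::monoid_add \<Rightarrow>\<^sub>0 'k::field"
  shows "Poly_Mapping.single 0 c * p = pm_scale c p"
proof (induction p rule: poly_mapping_add_induct)
  case (add p w d)
  have "Poly_Mapping.single w (c * d) = pm_scale c (Poly_Mapping.single w d)"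
    by (rule poly_mapping_eqI) (simp add: lookup_pm_scale lookup_single when_def)
  with add show ?case by (simp add: distrib_left mult_single pm.scale_right_distrib)
qed simp

lemma torus_fun_functional:
  fixes h :: "('m::finite, 'n::finite) weight \<Rightarrow> 'k::field_char_0"
  shows "gl_functional (torus_fun h)"
proof (rule functional_intro)
  show "torus_fun h (f + g) = torus_fun h f + torus_fun h g" for f g
    unfolding torus_fun_def torus.point_simps
    by (rule sum_keys_add) (simp_all add: distrib_left)
  show "torus_fun h (gl_scale c f) = c * torus_fun h f" for c f
  proof -
    have "torus_fun h (gl_scale c f) = (\<Sum>x\<in>Poly_Mapping.keys (pm_scale c (torus.point f)). h x * Poly_Mapping.lookup (pm_scale c (torus.point f)) x)"
      by (simp add: torus_fun_def torus.point_simps single0_mult_pm_scale)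
    also have "\<dots> = (\<Sum>x\<in>Poly_Mapping.keys (torus.point f). h x * Poly_Mapping.lookup (pm_scale c (torus.point f)) x)"
      by (rule sum_superset_keys) (auto simp: in_keys_iff lookup_pm_scale)
    finally show ?thesis by (simp add: torus_fun_def lookup_pm_scale sum_distrib_left mult_ac)
  qed
qed

lemma torus_ent: "torus.point (gl_ent t i j) = of_bool (i = j) * Poly_Mapping.single (letter_weight t i) 1"
  by (cases t) (auto simp: torus.point_simps letter_weight_def ksign_def)

lemma torus_mcoef:
  assumes "length is = length ts" "length js = length ts"
  shows "torus.point (mcoef ts is js) = of_bool (is = js) * Poly_Mapping.single (weight_of ts js) 1"
  using assms
  by (induction ts "is" js rule: mcoef.induct) (auto simp: torus.point_simps torus_ent mult_single)

lemma torus_fun_mcoef: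
  "torus_fun h (mcoef ts is js) = of_bool (is = js \<and> length js = length ts) * h (weight_of ts js)"
  "torus_fun h (mcoef ts is js) = of_bool (is = js \<and> length is = length ts) * h (weight_of ts js)"
proof -
  show "torus_fun h (mcoef ts is js) = of_bool (is = js \<and> length js = length ts) * h (weight_of ts js)"
  proof (cases "length is = length ts \<and> length js = length ts")
    case True
    then show ?thesis by (simp add: torus_fun_def torus_mcoef)
  next
    case False
    then show ?thesis
      by (auto simp: mcoef_mismatch linearD[OF torus_fun_functional])
  qed
  then show "torus_fun h (mcoef ts is js) = of_bool (is = js \<and> length is = length ts) * h (weight_of ts js)"
    by auto
qed

text \<open>Multiplies the component of right weight \<^term>\<open>x\<close> by \<^term>\<open>h x\<close>.\<close>

definition wact :: "(('m, 'n) weight \<Rightarrow> 'k) \<Rightarrow> ('k::field_char_0, 'm::finite, 'n::finite) gl \<Rightarrow> ('k, 'm, 'n) gl" where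
  "wact h = right_act (torus_fun h)"

abbreviation wproj :: "('m, 'n) weight set \<Rightarrow> ('k::field_char_0, 'm::finite, 'n::finite) gl \<Rightarrow> ('k, 'm, 'n) gl" where
  "wproj A \<equiv> wact (\<lambda>x. of_bool (x \<in> A))"

lemma wact_linear: "Vector_Spaces.linear gl_scale gl_scale (wact h)"
  unfolding wact_def by (rule right_act_linear[OF torus_fun_functional])

lemma sum_idx_delta:
  fixes js :: "('m::finite + 'n::finite) list"
  assumes "length js \<noteq> n \<Longrightarrow> F js = 0"
  shows "(\<Sum>ks\<in>idx n. gl_scale (of_bool (ks = js \<and> length js = n) * c ks) (F ks)) = gl_scale (c js) (F js)"
    "(\<Sum>ks\<in>idx n. gl_scale (of_bool (js = ks \<and> length js = n) * c ks) (F ks)) = gl_scale (c js) (F js)"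
proof -
  have *: "gl_scale (of_bool (ks = js \<and> length js = n) * c ks) (F ks)
      = (if ks = js then gl_scale (c js) (F js) else 0)"
    "gl_scale (of_bool (js = ks \<and> length js = n) * c ks) (F ks)
      = (if ks = js then gl_scale (c js) (F js) else 0)" if "ks \<in> idx n" for ks
    using that by (auto simp: idx_def)
  have S: "(\<Sum>ks\<in>idx n. if ks = js then gl_scale (c js) (F js) else 0) = gl_scale (c js) (F js)"
    unfolding sum.delta[OF finite_idx] using assms by (auto simp: idx_def)
  show "(\<Sum>ks\<in>idx n. gl_scale (of_bool (ks = js \<and> length js = n) * c ks) (F ks)) = gl_scale (c js) (F js)"
    by (rule trans[OF sum.cong[OF refl] S]) (rule *(1))
  show "(\<Sum>ks\<in>idx n. gl_scale (of_bool (js = ks \<and> length js = n) * c ks) (F ks)) = gl_scale (c js) (F js)"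
    by (rule trans[OF sum.cong[OF refl] S]) (rule *(2))
qed

text \<open>Restriction to T leaves only the diagonal coefficient in the comultiplication. So the
  column list carries the right weight and, symmetrically, the row list the left weight.\<close>

lemma wact_mcoef: "wact h (mcoef ts is js) = gl_scale (h (weight_of ts js)) (mcoef ts is js)"
  unfolding wact_def right_act_mcoef[OF torus_fun_functional] torus_fun_mcoef(1)
  by (rule sum_idx_delta(1)) (rule mcoef_mismatch, simp)

lemma left_torus_mcoef: "left_act (torus_fun h) (mcoef ts is js) = gl_scale (h (weight_of ts is)) (mcoef ts is js)"
  unfolding left_act_mcoef[OF torus_fun_functional] torus_fun_mcoef(2)
  by (rule sum_idx_delta(2)) (rule mcoef_mismatch, simp)

lemmas wact_simps = linearD[OF wact_linear] wact_mcoef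

lemma wact_wact: "wact h (wact k f) = wact (\<lambda>x. h x * k x) f"
  by (induction f rule: mcoef_induct) (simp_all add: wact_simps mult_ac)

lemma wact_one: "wact (\<lambda>_. 1) f = f"
  by (induction f rule: mcoef_induct) (simp_all add: wact_simps)

lemma wact_zero: "wact (\<lambda>_. 0) f = 0"
  by (induction f rule: mcoef_induct) (simp_all add: wact_simps)

lemma wact_add: "wact (\<lambda>x. h x + k x) f = wact h f + wact k f"
  by (induction f rule: mcoef_induct) (simp_all add: wact_simps gl.scale_left_distrib add_ac gl.scale_right_distrib)

lemma wact_scale: "wact (\<lambda>x. c * h x) f = gl_scale c (wact h f)"
  by (induction f rule: mcoef_induct) (simp_all add: wact_simps gl.scale_right_distrib mult_ac)

lemma wact_part: "wact h (gl_part p f) = gl_part p (wact h f)"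
  by (induction f rule: mcoef_induct) (simp_all add: wact_simps gl_part_add gl_part_scale gl_part_mcoef)

lemma wproj_wproj: "wproj A (wproj B f) = wproj (A \<inter> B) f"
  unfolding wact_wact by (rule arg_cong[of _ _ "\<lambda>h. wact h f"]) auto

lemma wproj_compl:
  fixes f :: "('k::field_char_0, 'm::finite, 'n::finite) gl"
  shows "f = wproj A f + wproj (- A) f"
proof -
  have "wact (\<lambda>_. 1) f = wact (\<lambda>x. of_bool (x \<in> A) + of_bool (x \<in> - A)) f"
    by (rule arg_cong[of _ _ "\<lambda>h. wact h f"]) auto
  then show ?thesis unfolding wact_one wact_add .
qed

lemma wproj_sum:
  fixes f :: "('k::field_char_0, 'm::finite, 'n::finite) gl"
  shows "finite A \<Longrightarrow> wproj A f = (\<Sum>x\<in>A. wproj {x} f)"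
proof (induction A rule: finite_induct)
  case empty
  then show ?case by (simp add: wact_zero)
next
  case (insert x A)
  have "wproj (insert x A) f = wact (\<lambda>y. of_bool (y \<in> {x}) + of_bool (y \<in> A)) f"
    using insert(2) by (intro arg_cong[of _ _ "\<lambda>h. wact h f"]) auto
  then show ?case unfolding wact_add sum.insert[OF insert(1,2)] insert(3) .
qed

text \<open>Since f equals its own projection, only coefficients of column weight \<mu> have to be
  treated.\<close>

lemma wproj_single_induct [consumes 1, case_names add scale mcoef]:
  assumes "wproj {\<mu>} f = f"
    and "\<And>f g. P f \<Longrightarrow> P g \<Longrightarrow> P (f + g)" "\<And>c f. P f \<Longrightarrow> P (gl_scale c f)"
    and mcoef: "\<And>ts is js. length is = length ts \<Longrightarrow> length js = length ts \<Longrightarrow> weight_of ts js = \<mu> \<Longrightarrow> P (mcoef ts is js)"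
    and zero: "P 0"
  shows "P f"
proof -
  have "P (wproj {\<mu>} f)"
    by (induction f rule: mcoef_induct) (auto simp: wact_simps assms(2,3) mcoef zero)
  with assms(1) show ?thesis by simp
qed

section \<open>Local finiteness\<close>

lemma act_closedD:
  assumes "act_closed N"
  shows "gl.subspace N" "f \<in> N \<Longrightarrow> gl_part p f \<in> N" "gl_functional \<phi> \<Longrightarrow> f \<in> N \<Longrightarrow> right_act \<phi> f \<in> N"
    "f \<in> N \<Longrightarrow> wact h f \<in> N" "f \<in> N \<Longrightarrow> g \<in> N \<Longrightarrow> f + g \<in> N" "f \<in> N \<Longrightarrow> g \<in> N \<Longrightarrow> f - g \<in> N"
    "f \<in> N \<Longrightarrow> gl_scale c f \<in> N" "0 \<in> N"
  using assms torus_fun_functional[of h]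
  by (auto simp: act_closed_def wact_def gl.subspace_add gl.subspace_diff gl.subspace_scale gl.subspace_0)

lemma act_closed_Int: "act_closed N \<Longrightarrow> act_closed M \<Longrightarrow> act_closed (N \<inter> M)"
  by (auto simp: act_closed_def gl.subspace_inter)

lemma act_closed_0: "act_closed {0}"
  by (auto simp: act_closed_def gl.subspace_single_0 linearD[OF right_act_linear])

lemma act_closed_sums:
  assumes "act_closed N" "act_closed M"
  shows "act_closed {f + g | f g. f \<in> N \<and> g \<in> M}"
  unfolding act_closed_def
proof (intro conjI allI impI ballI)
  show "gl.subspace {f + g | f g. f \<in> N \<and> g \<in> M}"
    by (intro gl.subspace_sums act_closedD(1) assms)
  fix x assume "x \<in> {f + g | f g. f \<in> N \<and> g \<in> M}"
  then obtain f g where x: "x = f + g" "f \<in> N" "g \<in> M" by (elim CollectE exE conjE) (rule that)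
  show "gl_part p x \<in> {f + g | f g. f \<in> N \<and> g \<in> M}" for p
    unfolding x(1) gl_part_add using act_closedD(2)[OF assms(1) x(2)] act_closedD(2)[OF assms(2) x(3)] by blast
  show "right_act \<phi> x \<in> {f + g | f g. f \<in> N \<and> g \<in> M}" if "gl_functional \<phi>" for \<phi>
    unfolding x(1) linearD(1)[OF right_act_linear[OF that]]
    using act_closedD(3)[OF assms(1) that x(2)] act_closedD(3)[OF assms(2) that x(3)] by blast
qed

text \<open>A finite set whose span is a subsupermodule; every function lies in one of these spans,
  which is local finiteness.\<close>

definition mcoef_upto :: "nat \<Rightarrow> ('k::field_char_0, 'm::finite, 'n::finite) gl set" where
  "mcoef_upto r = (\<lambda>(ts, is, js). mcoef ts is js) ` {(ts, is, js). length ts \<le> r \<and> length is = length ts \<and> length js = length ts}"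

lemma mcoef_uptoI: "length ts \<le> r \<Longrightarrow> length is = length ts \<Longrightarrow> length js = length ts \<Longrightarrow> mcoef ts is js \<in> mcoef_upto r"
  unfolding mcoef_upto_def by (rule image_eqI[of _ _ "(ts, is, js)"]) simp_all

lemma finite_lists: "finite {is :: 'a::finite list. length is \<le> r}"
  using finite_lists_length_le[of "UNIV :: 'a set" r] by simp

lemma finite_mcoef_upto: "finite (mcoef_upto r :: ('k::field_char_0, 'm::finite, 'n::finite) gl set)"
proof -
  have "finite ({ts :: bool list. length ts \<le> r} \<times> {is :: ('m + 'n) list. length is \<le> r} \<times> {js :: ('m + 'n) list. length js \<le> r})"
    by (intro finite_cartesian_product finite_lists)
  then have "finite {(ts :: bool list, is :: ('m + 'n) list, js :: ('m + 'n) list). length ts \<le> r \<and> length is = length ts \<and> length js = length ts}"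
    by (rule rev_finite_subset) auto
  then show ?thesis unfolding mcoef_upto_def by (rule finite_imageI)
qed

lemma act_closed_mcoef_upto: "act_closed (gl.span (mcoef_upto r))"
  unfolding act_closed_def
proof (intro conjI allI impI ballI)
  fix f :: "('a, 'b, 'c) gl" and p assume "f \<in> gl.span (mcoef_upto r)"
  then show "gl_part p f \<in> gl.span (mcoef_upto r)"
  proof (induction rule: gl.span_induct_alt)
    case (step c x y)
    then obtain ts "is" js where "x = mcoef ts is js" by (auto simp: mcoef_upto_def)
    then have "gl_part p x = x \<or> gl_part p x = 0" by (simp add: gl_part_mcoef)
    then have "gl_part p x \<in> gl.span (mcoef_upto r)"
      using step(1) by (auto intro: gl.span_zero gl.span_base)
    with step show ?case by (simp add: gl_part_add gl_part_scale gl.span_add gl.span_scale)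
  qed (simp add: gl.span_zero)
next
  fix \<phi> :: "('a, 'b, 'c) gl_fun" and f :: "('a, 'b, 'c) gl" assume \<phi>: "gl_functional \<phi>" and "f \<in> gl.span (mcoef_upto r)"
  from this(2) show "right_act \<phi> f \<in> gl.span (mcoef_upto r)"
  proof (induction rule: gl.span_induct_alt)
    case (step c x y)
    then obtain ts "is" js where x: "x = mcoef ts is js" "length ts \<le> r" "length is = length ts" by (auto simp: mcoef_upto_def)
    have "mcoef ts is ks \<in> mcoef_upto r" if "ks \<in> idx (length ts)" for ks
      using x that by (intro mcoef_uptoI) (simp_all add: idx_def)
    then have "right_act \<phi> x \<in> gl.span (mcoef_upto r)"
      unfolding x(1) right_act_mcoef[OF \<phi>] by (intro gl.span_sum gl.span_scale gl.span_base)
    with step show ?case by (simp add: linearD[OF right_act_linear[OF \<phi>]] gl.span_add gl.span_scale)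
  qed (simp add: gl.span_zero linearD[OF right_act_linear[OF \<phi>]])
qed simp

lemma in_span_mcoef_upto: "\<exists>r. f \<in> gl.span (mcoef_upto r)"
proof (induction f rule: mcoef_induct)
  case (add f g)
  then obtain r s where rs: "f \<in> gl.span (mcoef_upto r)" "g \<in> gl.span (mcoef_upto s)" by blast
  have "gl.span (mcoef_upto r) \<subseteq> gl.span (mcoef_upto (max r s) :: ('a, 'b, 'c) gl set)"
    unfolding mcoef_upto_def by (intro gl.span_mono image_mono) auto
  moreover have "gl.span (mcoef_upto s) \<subseteq> gl.span (mcoef_upto (max r s) :: ('a, 'b, 'c) gl set)"
    unfolding mcoef_upto_def by (intro gl.span_mono image_mono) auto
  ultimately have "f + g \<in> gl.span (mcoef_upto (max r s))"
    using rs by (intro gl.span_add) auto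
  then show ?case ..
next
  case (mcoef ts "is" js)
  then have "mcoef ts is js \<in> mcoef_upto (length ts)" by (intro mcoef_uptoI) simp_all
  then show ?case by (blast intro: gl.span_base)
qed (auto intro: gl.span_scale)

lemma span_mcoef_upto_weights:
  obtains A where "finite A" "\<And>f :: ('k::field_char_0, 'm::finite, 'n::finite) gl. f \<in> gl.span (mcoef_upto r) \<Longrightarrow> wproj A f = f"
proof
  let ?A = "(\<lambda>(ts, js). weight_of ts js) ` ({ts :: bool list. length ts \<le> r} \<times> {js :: ('m + 'n) list. length js \<le> r})"
  show "finite ?A" by (intro finite_imageI finite_cartesian_product finite_lists)
  show "wproj ?A f = f" if "f \<in> gl.span (mcoef_upto r)" for f :: "('k, 'm, 'n) gl"
    using that
  proof (induction rule: gl.span_induct_alt)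
    case (step c x y)
    then obtain ts "is" js where x: "x = mcoef ts is js" "length ts \<le> r" "length js \<le> r" by (auto simp: mcoef_upto_def)
    then have "weight_of ts js \<in> ?A" by auto
    then show ?case using step by (simp add: x wact_simps)
  qed (simp add: wact_simps)
qed

text \<open>Intersecting with a span of \<open>mcoef_upto\<close> gives a nonzero subsupermodule
  inside a finite-dimensional space. A choice lying in the span of as few vectors as possible is
  simple.\<close>

lemma simple_subsupermodule_exists:
  assumes N: "act_closed N" "f \<in> N" "f \<noteq> 0"
  obtains S where "simple_section {0} S" "S \<subseteq> N"
proof -
  let ?P = "\<lambda>n X B. act_closed X \<and> X \<subseteq> N \<and> X \<noteq> {0} \<and> finite B \<and> card B = n \<and> X \<subseteq> gl.span B"
  obtain r where r: "f \<in> gl.span (mcoef_upto r)" using in_span_mcoef_upto by blast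
  have "?P (card (mcoef_upto r :: ('a, 'b, 'c) gl set)) (N \<inter> gl.span (mcoef_upto r)) (mcoef_upto r)"
    using N r finite_mcoef_upto act_closed_Int[OF N(1) act_closed_mcoef_upto] by auto
  then have ex: "\<exists>n X B. ?P n X B" by blast
  define n where "n = (LEAST n. \<exists>X B. ?P n X B)"
  from LeastI_ex[OF ex] obtain X B where X: "?P n X B" unfolding n_def by blast
  have least: "n \<le> k" if "?P k Y C" for k Y C
    unfolding n_def by (rule Least_le) (use that in blast)
  have "simple_section {0} X"
    unfolding simple_section_def
  proof (intro conjI allI impI)
    show "subsupermodule {0 :: ('a, 'b, 'c) gl}" "subsupermodule X"
      using act_closed_0 X by (auto simp: subsupermodule_iff)
    show "{0} \<subset> X" using X act_closedD(8)[of X] by blast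
    fix Y assume "subsupermodule Y \<and> {0} \<subseteq> Y \<and> Y \<subseteq> X"
    then have Y: "act_closed Y" "Y \<subseteq> X" by (auto simp: subsupermodule_iff)
    show "Y = {0} \<or> Y = X"
    proof (rule ccontr)
      assume *: "\<not> ?thesis"
      then obtain x where x: "x \<in> X" "x \<notin> Y" using Y(2) by blast
      \<comment> \<open>A basis C of Y together with x is still independent in the span of B, so C
        has fewer than n elements, against the minimality of n.\<close>
      obtain C where C: "C \<subseteq> Y" "gl.independent C" "Y \<subseteq> gl.span C"
        by (rule gl.maximal_independent_subset[of Y])
      have "gl.span C \<subseteq> Y" using C(1) act_closedD(1)[OF Y(1)] by (rule gl.span_minimal)
      with x have "x \<notin> gl.span C" by blast
      then have ind: "gl.independent (insert x C)" by (rule gl.independent_insertI[OF _ C(2)])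
      have "insert x C \<subseteq> gl.span B" using x C Y X by blast
      with ind X have fin: "finite (insert x C)" "card (insert x C) \<le> n"
        using gl.independent_span_bound[of B "insert x C"] by auto
      have "x \<notin> C" using x C by blast
      with fin have "card C < n" by simp
      moreover have "?P (card C) Y C" using Y X C * fin by auto
      then have "n \<le> card C" by (rule least)
      ultimately show False by simp
    qed
  qed
  with X that show ?thesis by blast
qed

section \<open>Supercommutativity\<close>

definition twist :: "bool \<Rightarrow> ('k::field_char_0, 'm::finite, 'n::finite) gl \<Rightarrow> ('k, 'm, 'n) gl" where
  "twist p f = gl_part False f + gl_scale (ksign p True) (gl_part True f)"

lemma gl_part_gen_mult: "gl_part p (gl_gen x * f) = gl_gen x * gl_part (p \<noteq> gen_par x) f"
  by (cases "gen_par x"; cases p) (simp_all add: gl_part_mult gl_part_gen)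

lemma twist_linear: "Vector_Spaces.linear gl_scale gl_scale (twist p)"
  by (rule linear_intro) (simp_all add: twist_def gl_part_add gl_part_scale gl.scale_right_distrib mult.commute)

lemma twist_twist: "twist p (twist q f) = twist (p \<noteq> q) f"
  by (cases p; cases q) (simp_all add: twist_def gl_part_add linearD(4)[OF gl_part_linear] gl_part_part)

lemma twist_one: "twist p 1 = 1"
  by (simp add: twist_def gl_part_one)

lemma twist_gen_mult: "twist p (gl_gen x * f) = gl_scale (ksign p (gen_par x)) (gl_gen x * twist p f)"
  by (cases "gen_par x"; cases p)
    (simp_all add: twist_def gl_part_gen_mult distrib_left ksign_def right_diff_distrib)

text \<open>Supercommutativity is imposed on generators only. Absorbing the sign into the linear map
  \<open>twist\<close> permits an induction over inhomogeneous f.\<close>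

lemma gen_mult_commute: "gl_gen x * f = twist (gen_par x) f * gl_gen x"
proof (induction f rule: gl_gen_induct)
  case (gen y f)
  have "gl_gen x * (gl_gen y * f) = gl_scale (ksign (gen_par x) (gen_par y)) (gl_gen y * (gl_gen x * f))"
    unfolding mult.assoc[symmetric] gl_gen_commute[of x y] by (simp add: ksign_scale flip: gl_scale_mult)
  also have "\<dots> = twist (gen_par x) (gl_gen y * f) * gl_gen x"
    unfolding gen twist_gen_mult by (simp add: mult.assoc flip: gl_scale_mult)
  finally show ?case .
qed (simp_all add: distrib_left distrib_right linearD[OF twist_linear] twist_one flip: gl_scale_mult)

lemma part_mult_commute: "gl_part p f * g = twist p g * gl_part p f"
proof (induction f arbitrary: p rule: gl_gen_induct)
  case one
  have "gl_part False g + gl_part True g = g"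
    using gl_part_sum_parts[of g] by (simp add: add.commute)
  then show ?case by (cases p) (simp_all add: gl_part_one twist_def)
next
  case (gen x f)
  show ?case
    unfolding gl_part_gen_mult mult.assoc gen
    unfolding mult.assoc[symmetric] gen_mult_commute[of x "twist _ _"] twist_twist
    by (cases p; cases "gen_par x") (simp_all add: mult.assoc)
qed (simp_all add: gl_part_add gl_part_scale distrib_left distrib_right flip: gl_scale_mult)

lemma hom_commute:
  assumes "gl_part p f = f" "gl_part q g = g"
  shows "f * g = gl_scale (ksign p q) (g * f)"
proof -
  have "f * g = twist p g * f" using part_mult_commute[of p f g] assms(1) by simp
  moreover have "gl_part (\<not> q) g = 0" using assms(2) by (metis gl_part_part)
  then have "twist p g = gl_scale (ksign p q) g"
    using assms(2) by (cases q) (simp_all add: twist_def)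
  ultimately show ?thesis by (simp flip: gl_scale_mult)
qed

lemma hom_mult_part:
  assumes "gl_part p f = f"
  shows "gl_part q (f * g) = f * gl_part (p \<noteq> q) g"
proof -
  have "gl_part (\<not> p) f = 0" using assms by (metis gl_part_part)
  with assms show ?thesis by (cases p; cases q) (simp_all add: gl_part_mult)
qed

section \<open>Supermatrices\<close>

text \<open>A separate type with a ring instance, so that powers, geometric sums and power series
  with matrix coefficients are available over a noncommutative ring.\<close>

typedef ('i, 'r) sqmat = "UNIV :: ('i \<Rightarrow> 'i \<Rightarrow> 'r) set" morphisms entry Sqmat ..

setup_lifting type_definition_sqmat

lemma sqmat_eqI: "(\<And>i j. entry A i j = entry B i j) \<Longrightarrow> A = B"
  by (simp add: entry_inject[symmetric] fun_eq_iff)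

instantiation sqmat :: (finite, ring_1) ring_1
begin
lift_definition zero_sqmat :: "('a, 'b) sqmat" is "\<lambda>i j. 0" .
lift_definition one_sqmat :: "('a, 'b) sqmat" is "\<lambda>i j. of_bool (i = j)" .
lift_definition plus_sqmat :: "('a, 'b) sqmat \<Rightarrow> ('a, 'b) sqmat \<Rightarrow> ('a, 'b) sqmat" is "\<lambda>A B i j. A i j + B i j" .
lift_definition minus_sqmat :: "('a, 'b) sqmat \<Rightarrow> ('a, 'b) sqmat \<Rightarrow> ('a, 'b) sqmat" is "\<lambda>A B i j. A i j - B i j" .
lift_definition uminus_sqmat :: "('a, 'b) sqmat \<Rightarrow> ('a, 'b) sqmat" is "\<lambda>A i j. - A i j" .
lift_definition times_sqmat :: "('a, 'b) sqmat \<Rightarrow> ('a, 'b) sqmat \<Rightarrow> ('a, 'b) sqmat"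
  is "\<lambda>A B i j. \<Sum>k\<in>UNIV. A i k * B k j" .
instance
proof
  fix A B C :: "('a, 'b) sqmat"
  note rep = plus_sqmat.rep_eq minus_sqmat.rep_eq uminus_sqmat.rep_eq times_sqmat.rep_eq zero_sqmat.rep_eq one_sqmat.rep_eq
  have "(\<Sum>k\<in>UNIV. (\<Sum>l\<in>UNIV. entry A i l * entry B l k) * entry C k j)
      = (\<Sum>l\<in>UNIV. entry A i l * (\<Sum>k\<in>UNIV. entry B l k * entry C k j))" for i j
    unfolding sum_distrib_left sum_distrib_right mult.assoc by (rule sum.swap)
  then show "A * B * C = A * (B * C)" by (intro sqmat_eqI) (simp only: rep)
  show "1 * A = A" "A * 1 = A"
    by (rule sqmat_eqI, simp only: rep sum_of_bool_mult)+
  show "(A + B) * C = A * C + B * C" "A * (B + C) = A * B + A * C"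
    by (rule sqmat_eqI, simp only: rep distrib_left distrib_right sum.distrib)+
  show "A + B + C = A + (B + C)" "A + B = B + A" "0 + A = A" "- A + A = 0" "A - B = A + - B"
    by (rule sqmat_eqI, simp add: rep add_ac)+
  have "entry 0 undefined undefined \<noteq> entry (1 :: ('a, 'b) sqmat) undefined undefined" by (simp add: rep)
  then show "(0 :: ('a, 'b) sqmat) \<noteq> 1" by (rule contrapos_nn) simp
qed
end

lemma entry_simps:
  "entry (A + B) i j = entry A i j + entry B i j" "entry (A - B) i j = entry A i j - entry B i j"
  "entry (- A) i j = - entry A i j" "entry (A * B) i j = (\<Sum>k\<in>UNIV. entry A i k * entry B k j)"
  "entry 0 i j = 0" "entry 1 i j = of_bool (i = j)" "entry (Sqmat F) i j = F i j"
  by (simp_all add: plus_sqmat.rep_eq minus_sqmat.rep_eq uminus_sqmat.rep_eq times_sqmat.rep_eq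
      zero_sqmat.rep_eq one_sqmat.rep_eq Sqmat_inverse)

lemma entry_sum: "entry (sum F S) i j = (\<Sum>x\<in>S. entry (F x) i j)"
  by (induction S rule: infinite_finite_induct) (simp_all add: entry_simps)

type_synonym ('k, 'm, 'n) glmat = "('m + 'n, ('k, 'm, 'n) gl) sqmat"

text \<open>Evenness is that of supermatrices: even entries in the diagonal blocks, odd entries in
  the other two.\<close>

definition even_part :: "('k::field_char_0, 'm::finite, 'n::finite) glmat \<Rightarrow> ('k, 'm, 'n) glmat" where
  "even_part A = Sqmat (\<lambda>i j. gl_part (odd_index i \<noteq> odd_index j) (entry A i j))"

abbreviation even_mat :: "('k::field_char_0, 'm::finite, 'n::finite) glmat \<Rightarrow> bool" where
  "even_mat A \<equiv> even_part A = A"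

lemma even_matD: "even_mat A \<Longrightarrow> gl_part (odd_index i \<noteq> odd_index j) (entry A i j) = entry A i j"
  by (drule arg_cong[of _ _ "\<lambda>A. entry A i j"]) (simp only: even_part_def entry_simps)

lemma even_matI: "(\<And>i j. gl_part (odd_index i \<noteq> odd_index j) (entry A i j) = entry A i j) \<Longrightarrow> even_mat A"
  by (rule sqmat_eqI) (simp add: even_part_def entry_simps)

lemma even_part_simps:
  fixes A B :: "('k::field_char_0, 'm::finite, 'n::finite) glmat"
  shows "even_part (A + B) = even_part A + even_part B" "even_part (A - B) = even_part A - even_part B"
  "even_part (0 :: ('k, 'm, 'n) glmat) = 0" "even_part (1 :: ('k, 'm, 'n) glmat) = 1"
proof -
  have d: "gl_part p (f - g) = gl_part p f - gl_part p g" for p and f g :: "('k, 'm, 'n) gl"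
    by (rule linearD(4)[OF gl_part_linear])
  show "even_part (A + B) = even_part A + even_part B"
    by (rule sqmat_eqI) (simp only: even_part_def entry_simps gl_part_add)
  show "even_part (A - B) = even_part A - even_part B"
    by (rule sqmat_eqI) (simp only: even_part_def entry_simps d)
  show "even_part (0 :: ('k, 'm, 'n) glmat) = 0"
    by (rule sqmat_eqI) (simp only: even_part_def entry_simps gl_part_zero)
  show "even_part (1 :: ('k, 'm, 'n) glmat) = 1"
  proof (rule sqmat_eqI)
    fix i j :: "'m + 'n"
    show "entry (even_part (1 :: ('k, 'm, 'n) glmat)) i j = entry 1 i j"
      unfolding even_part_def entry_simps by (cases "i = j") (simp_all add: gl_part_one)
  qed
qed

lemma even_part_sum: "even_part (sum F S) = (\<Sum>x\<in>S. even_part (F x))"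
  by (induction S rule: infinite_finite_induct) (simp_all add: even_part_simps)

lemma even_part_mult:
  assumes "even_mat A"
  shows "even_part (A * B) = A * even_part B"
proof (rule sqmat_eqI)
  fix i j :: "'a + 'b"
  have p: "((odd_index i \<noteq> odd_index k) \<noteq> (odd_index i \<noteq> odd_index j)) = (odd_index k \<noteq> odd_index j)" for k :: "'a + 'b"
    by auto
  have "gl_part (odd_index i \<noteq> odd_index j) (entry A i k * entry B k j)
      = entry A i k * gl_part (odd_index k \<noteq> odd_index j) (entry B k j)" for k
    using hom_mult_part[OF even_matD[OF assms], of "odd_index i \<noteq> odd_index j" i k "entry B k j"]
    unfolding p .
  then show "entry (even_part (A * B)) i j = entry (A * even_part B) i j"
    by (simp only: even_part_def entry_simps linearD(6)[OF gl_part_linear])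
qed

lemma even_mat_mult: "even_mat A \<Longrightarrow> even_mat B \<Longrightarrow> even_mat (A * B)"
  by (simp only: even_part_mult)

lemma fps_unit:
  fixes A :: "'a::ring_1 fps"
  assumes "fps_nth A 0 = 1"
  obtains B where "A * B = 1" "B * A = 1"
proof (rule that)
  show "A * fps_right_inverse A 1 = 1" by (rule fps_right_inverse) (simp add: assms)
  show "fps_right_inverse A 1 * A = 1" by (rule fps_left_inverse'[of 1]) (simp_all add: assms)
qed

text \<open>Taking even parts commutes with left multiplication by the even A, so the
  coefficientwise even part of B is again a right inverse of A and hence equals B.\<close>

lemma fps_even_inverse:
  fixes A :: "('k::field_char_0, 'm::finite, 'n::finite) glmat fps"
  assumes even: "\<And>n. even_mat (fps_nth A n)" and AB: "A * B = 1" "B * A = 1"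
  shows "even_mat (fps_nth B n)"
proof -
  define E where "E = Abs_fps (\<lambda>n. even_part (fps_nth B n))"
  have "A * E = 1"
  proof (rule fps_ext)
    fix n
    have "fps_nth (A * E) n = even_part (fps_nth (A * B) n)"
      by (simp add: fps_mult_nth E_def even_part_sum even_part_mult[OF even])
    then show "fps_nth (A * E) n = fps_nth 1 n" by (simp add: AB even_part_simps)
  qed
  then have "B * (A * E) = B" by simp
  then have "E = B" unfolding mult.assoc[symmetric] AB(2) by simp
  then have "fps_nth E n = fps_nth B n" by simp
  then show ?thesis by (simp add: E_def)
qed

section \<open>Formal neighbourhood of the identity\<close>

text \<open>A supermatrix with entries in $K[G][[t]]$ and constant term the identity is a point of $G$.\<close>

definition fps_entry :: "('k, 'm, 'n) glmat fps \<Rightarrow> 'm + 'n \<Rightarrow> 'm + 'n \<Rightarrow> ('k::field_char_0, 'm::finite, 'n::finite) gl fps" where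
  "fps_entry A i j = Abs_fps (\<lambda>n. entry (fps_nth A n) i j)"

abbreviation fps_iota :: "'k \<Rightarrow> ('k::field_char_0, 'm::finite, 'n::finite) gl fps" where
  "fps_iota c \<equiv> fps_const (gl_scale c 1)"

fun mat_gen :: "('k, 'm, 'n) glmat fps \<Rightarrow> ('k, 'm, 'n) glmat fps \<Rightarrow> ('m, 'n) gen
    \<Rightarrow> ('k::field_char_0, 'm::finite, 'n::finite) gl fps" where
  "mat_gen A B (Cgen i j) = fps_entry A i j"
| "mat_gen A B (Sgen i j) = fps_entry B i j"

lemma fps_entry_mult: "(\<Sum>k\<in>UNIV. fps_entry A i k * fps_entry B k j) = fps_entry (A * B) i j"
proof (rule fps_ext)
  fix n
  show "fps_nth (\<Sum>k\<in>UNIV. fps_entry A i k * fps_entry B k j) n = fps_nth (fps_entry (A * B) i j) n"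
    unfolding fps_sum_nth by (simp add: fps_mult_nth fps_entry_def entry_sum entry_simps) (rule sum.swap)
qed

lemma fps_entry_one: "fps_entry 1 i j = of_bool (i = j)"
  by (rule fps_ext) (auto simp: fps_entry_def entry_simps)

lemma fps_hom_commute:
  assumes "\<And>n. gl_part p (fps_nth x n) = fps_nth x n" "\<And>n. gl_part q (fps_nth y n) = fps_nth y n"
  shows "x * y = ksign p q * (y * x)"
proof -
  have c: "ksign p q * z = fps_const (ksign p q) * z" for z :: "('a, 'b, 'c) gl fps"
    by (simp add: ksign_def flip: fps_const_neg)
  have "fps_nth (x * y) n = ksign p q * fps_nth (y * x) n" for n
  proof -
    have "fps_nth (x * y) n = (\<Sum>i=0..n. ksign p q * (fps_nth y (n - i) * fps_nth x i))"
      unfolding fps_mult_nth ksign_scale by (intro sum.cong refl hom_commute assms)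
    also have "\<dots> = (\<Sum>i=0..n. ksign p q * (fps_nth y i * fps_nth x (n - i)))"
      by (subst sum.atLeastAtMost_rev, intro sum.cong refl) simp
    finally show ?thesis by (simp add: fps_mult_nth sum_distrib_left)
  qed
  then show ?thesis unfolding c by (intro fps_ext) (simp only: fps_mult_left_const_nth)
qed

lemma fps_iota_hom: "free_eval_hom fps_iota"
proof
  show "fps_iota (a + b) = fps_iota a + fps_iota b" for a b :: 'a
    by (simp add: gl.scale_left_distrib)
  show "fps_iota (a * b) = fps_iota a * fps_iota b" for a b :: 'a
    unfolding fps_const_mult gl_scale_one_mult gl.scale_scale mult.commute[of b a] ..
  show "fps_iota 1 = 1" by simp
  show "fps_iota a * x = x * fps_iota a" for a :: 'a and x :: "('a, 'b, 'c) gl fps"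
    by (rule fps_ext) (simp add: gl_scale_one_mult)
qed

lemma mat_point:
  assumes "A * B = 1" "B * A = 1" "\<And>n. even_mat (fps_nth A n)" "\<And>n. even_mat (fps_nth B n)"
  shows "gl_point fps_iota (mat_gen A B)"
proof -
  interpret free_eval_hom fps_iota by (rule fps_iota_hom)
  have even: "gl_part (gen_par x) (fps_nth (mat_gen A B x) n) = fps_nth (mat_gen A B x) n" for x n
    using even_matD[OF assms(3)] even_matD[OF assms(4)] by (cases x) (auto simp: fps_entry_def)
  show ?thesis
    by unfold_locales (rule fps_hom_commute[OF even even], simp_all add: fps_entry_mult fps_entry_one assms)
qed

context
  fixes g :: "('m::finite, 'n::finite) gen \<Rightarrow> ('k::field_char_0, 'm, 'n) gl fps"
  assumes g: "gl_point fps_iota g" and par: "\<And>x n. gl_part (gen_par x) (fps_nth (g x) n) = fps_nth (g x) n"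
begin

interpretation gl_point fps_iota g by (rule g)

text \<open>Homogeneous images of the generators make the point parity preserving in every
  coefficient of t. This provides the signs when values of different points are
  interchanged.\<close>

lemma fps_point_par: "gl_part p (fps_nth (point f) n) = fps_nth (point (gl_part p f)) n"
proof (induction f arbitrary: n p rule: gl_gen_induct)
  case (gen x f)
  have "gl_part p (fps_nth (point (gl_gen x * f)) n) = (\<Sum>i=0..n. fps_nth (g x) i * gl_part (gen_par x \<noteq> p) (fps_nth (point f) (n - i)))"
    by (simp only: point_simps fps_mult_nth linearD(6)[OF gl_part_linear] hom_mult_part[OF par])
  also have "\<dots> = fps_nth (point (gl_part p (gl_gen x * f))) n"
    unfolding gl_part_gen_mult gen by (simp add: point_simps fps_mult_nth eq_commute)
  finally show ?case .
qed (simp_all add: point_simps gl_part_add gl_part_scale gl_scale_one_mult gl_part_one)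

end

section \<open>Triangular decomposition over power series\<close>

definition low_part :: "('i \<Rightarrow> int) \<Rightarrow> ('i, 'r::ring_1) sqmat \<Rightarrow> ('i::finite, 'r) sqmat" where
  "low_part r A = Sqmat (\<lambda>i j. if r i < r j then 0 else entry A i j)"

definition upp_part :: "('i \<Rightarrow> int) \<Rightarrow> ('i, 'r::ring_1) sqmat \<Rightarrow> ('i::finite, 'r) sqmat" where
  "upp_part r A = Sqmat (\<lambda>i j. if r i < r j then entry A i j else 0)"

lemma low_upp_part: "low_part r A + upp_part r A = A"
  by (rule sqmat_eqI) (simp add: low_part_def upp_part_def entry_simps)

lemma even_low_upp: "even_mat A \<Longrightarrow> even_mat (low_part r A)" "even_mat A \<Longrightarrow> even_mat (upp_part r A)"
  by (rule even_matI, simp only: low_part_def upp_part_def entry_simps if_distrib[of "gl_part _"] even_matD gl_part_zero)+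

text \<open>The lower triangular and the strictly upper triangular part of \<open>ldu_rec r X n\<close> are the coefficients of
  $t^n$ of the two factors of the triangular decomposition of $1+\sum_{n>0}X_nt^n$.\<close>

fun ldu_rec :: "('i \<Rightarrow> int) \<Rightarrow> (nat \<Rightarrow> ('i, 'r) sqmat) \<Rightarrow> nat \<Rightarrow> ('i::finite, 'r::ring_1) sqmat" where
  "ldu_rec r X n = X n - (\<Sum>k\<in>{1..<n}. low_part r (ldu_rec r X k) * upp_part r (ldu_rec r X (n - k)))"

declare ldu_rec.simps [simp del]

text \<open>With constant terms 1, the coefficient of t^n in BU is the sum of the n-th coefficients
  of B and U plus products of earlier ones. Splitting the remainder into its lower and strictly
  upper part solves for both factors without any division.\<close>

lemma triangular_decomposition:
  fixes G :: "('k::field_char_0, 'm::finite, 'n::finite) glmat fps" and r :: "'m + 'n \<Rightarrow> int"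
  assumes "fps_nth G 0 = 1" "\<And>n. even_mat (fps_nth G n)"
  obtains B U where "B * U = G" "fps_nth B 0 = 1" "fps_nth U 0 = 1"
    "\<And>n. even_mat (fps_nth B n)" "\<And>n. even_mat (fps_nth U n)"
    "\<And>i j. r i < r j \<Longrightarrow> fps_entry B i j = 0" "\<And>i j. r j < r i \<Longrightarrow> fps_entry U i j = 0"
    "\<And>i. fps_entry U i i = 1"
proof
  let ?W = "ldu_rec r (fps_nth G)"
  define B where "B = Abs_fps (\<lambda>n. if n = 0 then 1 else low_part r (?W n))"
  define U where "U = Abs_fps (\<lambda>n. if n = 0 then 1 else upp_part r (?W n))"
  show "B * U = G"
  proof (rule fps_ext)
    fix n
    show "fps_nth (B * U) n = fps_nth G n"
    proof (cases "n = 0")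
      case False
      have "{0..n} = insert 0 (insert n {1..<n})" using False by auto
      then have "fps_nth (B * U) n = upp_part r (?W n) + (low_part r (?W n)
          + (\<Sum>k\<in>{1..<n}. low_part r (?W k) * upp_part r (?W (n - k))))"
        using False by (simp add: fps_mult_nth B_def U_def)
      also have "\<dots> = (low_part r (?W n) + upp_part r (?W n)) + (\<Sum>k\<in>{1..<n}. low_part r (?W k) * upp_part r (?W (n - k)))"
        by (simp add: add_ac)
      also have "\<dots> = fps_nth G n"
        unfolding low_upp_part by (subst ldu_rec.simps) simp
      finally show ?thesis .
    qed (simp add: B_def U_def assms fps_mult_nth)
  qed
  have W: "even_mat (?W n)" for n
  proof (induction n rule: less_induct)
    case (less n)
    have "even_mat (low_part r (?W k) * upp_part r (?W (n - k)))" if "k \<in> {1..<n}" for k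
      using that by (intro even_mat_mult even_low_upp less) auto
    then have "even_part (\<Sum>k\<in>{1..<n}. low_part r (?W k) * upp_part r (?W (n - k)))
        = (\<Sum>k\<in>{1..<n}. low_part r (?W k) * upp_part r (?W (n - k)))"
      unfolding even_part_sum by (intro sum.cong refl)
    then show ?case
      by (subst (1 2) ldu_rec.simps) (simp add: even_part_simps assms)
  qed
  then show "even_mat (fps_nth B n)" "even_mat (fps_nth U n)" for n
    by (simp_all add: B_def U_def even_part_simps even_low_upp)
  show "fps_nth B 0 = 1" "fps_nth U 0 = 1" by (simp_all add: B_def U_def)
  show "fps_entry B i j = 0" if "r i < r j" for i j
    using that by (intro fps_ext) (auto simp: fps_entry_def B_def entry_simps low_part_def)
  show "fps_entry U i j = 0" if "r j < r i" for i j
    using that by (intro fps_ext) (auto simp: fps_entry_def U_def entry_simps upp_part_def)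
  show "fps_entry U i i = 1" for i
    by (intro fps_ext) (auto simp: fps_entry_def U_def entry_simps upp_part_def)
qed

text \<open>The curve $1 + t(C-1)$ joining the identity to the generic matrix $C$.\<close>

definition generic_curve :: "('k::field_char_0, 'm::finite, 'n::finite) glmat fps" where
  "generic_curve = Abs_fps (\<lambda>n. if n = 0 then 1 else if n = 1 then Sqmat cc - 1 else 0)"

lemma generic_curve_props:
  "fps_nth generic_curve 0 = (1 :: ('k::field_char_0, 'm::finite, 'n::finite) glmat)"
  "even_mat (fps_nth generic_curve n :: ('k, 'm, 'n) glmat)"
proof -
  have "even_mat (Sqmat cc :: ('k, 'm, 'n) glmat)" by (rule even_matI) (simp add: entry_simps gl_part_gen)
  then show "fps_nth generic_curve 0 = (1 :: ('k, 'm, 'n) glmat)" "even_mat (fps_nth generic_curve n :: ('k, 'm, 'n) glmat)"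
    by (simp_all add: generic_curve_def even_part_simps)
qed

lemma mat_gen_par:
  assumes "\<And>n. even_mat (fps_nth A n)" "\<And>n. even_mat (fps_nth B n)"
  shows "gl_part (gen_par x) (fps_nth (mat_gen A B x) n) = fps_nth (mat_gen A B x) n"
  using even_matD[OF assms(1)] even_matD[OF assms(2)] by (cases x) (auto simp: fps_entry_def)

text \<open>The matrix identity G = BU propagates to all coefficients because the values of u and b
  lie in the supercommutative K[G][[t]] and can be interchanged with the Koszul sign. Inverse
  matrices multiply in the opposite order, which explains the form of \<open>s\<close>.\<close>

lemma fps_point_product:
  fixes g b u :: "('m::finite, 'n::finite) gen \<Rightarrow> ('k::field_char_0, 'm, 'n) gl fps"
  assumes g: "gl_point fps_iota g" and b: "gl_point fps_iota b" and u: "gl_point fps_iota u"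
    and bp: "\<And>x n. gl_part (gen_par x) (fps_nth (b x) n) = fps_nth (b x) n"
    and up: "\<And>x n. gl_part (gen_par x) (fps_nth (u x) n) = fps_nth (u x) n"
    and c: "\<And>i j. g (Cgen i j) = (\<Sum>k\<in>UNIV. b (Cgen i k) * u (Cgen k j))"
    and s: "\<And>i j. g (Sgen i j) = (\<Sum>k\<in>UNIV. u (Sgen i k) * b (Sgen k j))"
    and l: "length is = length ts" "length js = length ts"
  shows "gl_point.point fps_iota g (mcoef ts is js)
    = (\<Sum>ks\<in>idx (length ts). gl_point.point fps_iota b (mcoef ts is ks) * gl_point.point fps_iota u (mcoef ts ks js))"
  using l
proof (induction ts arbitrary: "is" js)
  interpret g: gl_point fps_iota g by (rule g)
  interpret b: gl_point fps_iota b by (rule b)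
  interpret u: gl_point fps_iota u by (rule u)
  have sgn: "fps_iota (ksign p q) * x = ksign p q * x" for p q and x :: "('k, 'm, 'n) gl fps"
    by (cases p; cases q) (simp_all flip: fps_const_neg)
  have sgn2: "x * (ksign p q * (y * z)) * w = ksign p q * (x * y * (z * w))"
    "(ksign p q * x) * (ksign p' q' * y) = ksign p q * (ksign p' q' * (x * y))"
    for p q p' q' and x y z w :: "('k, 'm, 'n) gl fps"
    by (simp_all add: ksign_def mult.assoc)
  {
    case Nil
    then show ?case by (simp add: sum_idx_0 g.point_simps b.point_simps u.point_simps)
  next
    case (Cons t ts)
    obtain i is' where i: "is = i # is'" "length is' = length ts" using Cons.prems(1) by (cases "is") auto
    obtain j js' where j: "js = j # js'" "length js' = length ts" using Cons.prems(2) by (cases js) auto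
    note ij = i(1) j(1) i(2) j(2)
    have ent: "g.point (gl_ent t i j) = (\<Sum>k\<in>UNIV. b.point (gl_ent t i k) * u.point (gl_ent t k j))"
    proof (cases t)
      case False
      have "ksign (odd_index i) (\<not> odd_index j) * (u (Sgen j k) * b (Sgen k i))
          = (ksign (odd_index i) (\<not> odd_index k) * b (Sgen k i)) * (ksign (odd_index k) (\<not> odd_index j) * u (Sgen j k))" for k
        unfolding fps_hom_commute[OF up bp, of "Sgen j k" "Sgen k i"]
        by (cases "odd_index i"; cases "odd_index j"; cases "odd_index k") simp_all
      with False show ?thesis
        by (simp add: g.point_simps b.point_simps u.point_simps sgn s sum_distrib_left)
    qed (simp add: g.point_simps b.point_simps u.point_simps c)
    have upar: "gl_part (odd_index k \<noteq> odd_index j) (fps_nth (u.point (gl_ent t k j)) n) = fps_nth (u.point (gl_ent t k j)) n" for k n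
      unfolding fps_point_par[OF u up] by (simp add: gl_part_ent)
    have bpar: "gl_part (list_par is' \<noteq> list_par ks) (fps_nth (b.point (mcoef ts is' ks)) n) = fps_nth (b.point (mcoef ts is' ks)) n" for ks n
      unfolding fps_point_par[OF b bp] by (simp add: gl_part_mcoef)
    have "g.point (mcoef (t # ts) is js) = (\<Sum>k\<in>UNIV. \<Sum>ks\<in>idx (length ts). ksign (odd_index j) (list_par is' \<noteq> list_par js')
        * (b.point (gl_ent t i k) * u.point (gl_ent t k j) * (b.point (mcoef ts is' ks) * u.point (mcoef ts ks js'))))"
      unfolding ij mcoef.simps g.point_simps sgn ent Cons.IH[OF ij(3,4)] sum_product
      by (simp only: sum_distrib_left)
    also have "\<dots> = (\<Sum>k\<in>UNIV. \<Sum>ks\<in>idx (length ts). b.point (mcoef (t # ts) is (k # ks)) * u.point (mcoef (t # ts) (k # ks) js))"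
    proof (intro sum.cong refl)
      fix k :: "'m + 'n" and ks :: "('m + 'n) list"
      have "b.point (gl_ent t i k) * u.point (gl_ent t k j) * (b.point (mcoef ts is' ks) * u.point (mcoef ts ks js'))
        = b.point (gl_ent t i k) * (u.point (gl_ent t k j) * b.point (mcoef ts is' ks)) * u.point (mcoef ts ks js')"
        by (simp add: mult.assoc)
      also have "\<dots> = ksign (odd_index k \<noteq> odd_index j) (list_par is' \<noteq> list_par ks)
         * (b.point (gl_ent t i k) * b.point (mcoef ts is' ks) * (u.point (gl_ent t k j) * u.point (mcoef ts ks js')))"
        unfolding fps_hom_commute[OF upar bpar] by (rule sgn2)
      finally have *: "b.point (gl_ent t i k) * u.point (gl_ent t k j) * (b.point (mcoef ts is' ks) * u.point (mcoef ts ks js'))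
        = ksign (odd_index k \<noteq> odd_index j) (list_par is' \<noteq> list_par ks)
         * (b.point (gl_ent t i k) * b.point (mcoef ts is' ks) * (u.point (gl_ent t k j) * u.point (mcoef ts ks js')))" .
      have sg: "ksign (odd_index j) (list_par is' \<noteq> list_par js') * (ksign (odd_index k \<noteq> odd_index j) (list_par is' \<noteq> list_par ks) * x)
          = ksign (odd_index k) (list_par is' \<noteq> list_par ks) * (ksign (odd_index j) (list_par ks \<noteq> list_par js') * x)"
        for x :: "('k, 'm, 'n) gl fps"
        by (cases "odd_index j"; cases "odd_index k"; cases "list_par is'"; cases "list_par js'"; cases "list_par ks") simp_all
      show "ksign (odd_index j) (list_par is' \<noteq> list_par js')
        * (b.point (gl_ent t i k) * u.point (gl_ent t k j) * (b.point (mcoef ts is' ks) * u.point (mcoef ts ks js')))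
        = b.point (mcoef (t # ts) is (k # ks)) * u.point (mcoef (t # ts) (k # ks) js)"
        unfolding * sg ij mcoef.simps b.point_simps u.point_simps sgn sgn2(2) ..
    qed
    finally show ?case by (simp add: sum_idx_Suc)
  }
qed

text \<open>All three points come from invertible even matrices: the factors B and U are units
  because of their constant term 1, and the inverse of the curve is the product U'B' of their
  inverses.\<close>

lemma big_cell_points:
  fixes r :: "'m::finite + 'n::finite \<Rightarrow> int"
  obtains g b u :: "('m, 'n) gen \<Rightarrow> ('k::field_char_0, 'm, 'n) gl fps" where
    "gl_point fps_iota g" "gl_point fps_iota b" "gl_point fps_iota u"
    "\<And>i j. g (Cgen i j) = fps_entry generic_curve i j"
    "\<And>i j. r i < r j \<Longrightarrow> b (Cgen i j) = 0" "\<And>i j. r j < r i \<Longrightarrow> u (Cgen i j) = 0" "\<And>i. u (Cgen i i) = 1"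
    "\<And>ts is js. length is = length ts \<Longrightarrow> length js = length ts \<Longrightarrow> gl_point.point fps_iota g (mcoef ts is js)
      = (\<Sum>ks\<in>idx (length ts). gl_point.point fps_iota b (mcoef ts is ks) * gl_point.point fps_iota u (mcoef ts ks js))"
proof -
  let ?G = "generic_curve :: ('k, 'm, 'n) glmat fps"
  obtain B U :: "('k, 'm, 'n) glmat fps" where BU: "B * U = ?G" "fps_nth B 0 = 1" "fps_nth U 0 = 1"
    "\<And>n. even_mat (fps_nth B n)" "\<And>n. even_mat (fps_nth U n)"
    "\<And>i j. r i < r j \<Longrightarrow> fps_entry B i j = 0" "\<And>i j. r j < r i \<Longrightarrow> fps_entry U i j = 0"
    "\<And>i. fps_entry U i i = 1"
    by (rule triangular_decomposition[OF generic_curve_props, of r]) (rule that)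
  obtain B' where B': "B * B' = 1" "B' * B = 1" using fps_unit[OF BU(2)] .
  obtain U' where U': "U * U' = 1" "U' * U = 1" using fps_unit[OF BU(3)] .
  note eB' = fps_even_inverse[OF BU(4) B'] and eU' = fps_even_inverse[OF BU(5) U']
  have "B * U * (U' * B') = B * (U * U') * B'" "U' * B' * (B * U) = U' * (B' * B) * U"
    by (simp_all only: mult.assoc)
  then have G': "?G * (U' * B') = 1" "(U' * B') * ?G = 1"
    unfolding BU(1) by (simp_all add: B' U')
  note eG' = fps_even_inverse[OF generic_curve_props(2) G']
  let ?g = "mat_gen ?G (U' * B')" and ?b = "mat_gen B B'" and ?u = "mat_gen U U'"
  have g: "gl_point fps_iota ?g" by (rule mat_point[OF G' generic_curve_props(2) eG'])
  have b: "gl_point fps_iota ?b" by (rule mat_point[OF B' BU(4) eB'])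
  have u: "gl_point fps_iota ?u" by (rule mat_point[OF U' BU(5) eU'])
  show ?thesis
  proof (rule that[OF g b u])
    show "gl_point.point fps_iota ?g (mcoef ts is js)
      = (\<Sum>ks\<in>idx (length ts). gl_point.point fps_iota ?b (mcoef ts is ks) * gl_point.point fps_iota ?u (mcoef ts ks js))"
      if "length is = length ts" "length js = length ts" for ts "is" js
      by (rule fps_point_product[OF g b u mat_gen_par[OF BU(4) eB'] mat_gen_par[OF BU(5) eU'] _ _ that])
        (simp_all add: fps_entry_mult BU(1))
  qed (simp_all add: BU)
qed

section \<open>Clearing denominators\<close>

text \<open>The subalgebra generated by the entries of the generic matrix alone; on it the values
  along the curve are polynomials in t.\<close>

inductive_set cpoly :: "('k::field_char_0, 'm::finite, 'n::finite) gl set" where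
  one: "1 \<in> cpoly"
| add: "f \<in> cpoly \<Longrightarrow> g \<in> cpoly \<Longrightarrow> f + g \<in> cpoly"
| scale: "f \<in> cpoly \<Longrightarrow> gl_scale c f \<in> cpoly"
| gen: "f \<in> cpoly \<Longrightarrow> cc i j * f \<in> cpoly"

lemma cpoly_mult: "f \<in> cpoly \<Longrightarrow> g \<in> cpoly \<Longrightarrow> f * g \<in> cpoly"
proof (induction rule: cpoly.induct)
  case (add f h)
  then show ?case by (simp add: distrib_right cpoly.add)
next
  case (scale f c)
  then show ?case by (simp add: cpoly.scale flip: gl_scale_mult)
next
  case (gen f i j)
  then show ?case by (simp add: mult.assoc cpoly.gen)
qed simp

lemma cpoly_0: "0 \<in> cpoly"
  using cpoly.scale[OF cpoly.one, of 0] by simp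

lemma cpoly_cc: "cc i j \<in> cpoly"
  using cpoly.gen[OF cpoly.one] by simp

lemma cpoly_uminus: "f \<in> cpoly \<Longrightarrow> - f \<in> cpoly"
  using cpoly.scale[of f "-1"] by simp

lemma cpoly_sum: "(\<And>x. x \<in> S \<Longrightarrow> F x \<in> cpoly) \<Longrightarrow> sum F S \<in> cpoly"
  by (induction S rule: infinite_finite_induct) (simp_all add: cpoly_0 cpoly.add)

lemma fps_entry_generic:
  "fps_entry generic_curve i j = fps_const (of_bool (i = j)) + fps_const (cc i j - of_bool (i = j)) * fps_X"
  by (rule fps_ext) (auto simp: fps_entry_def generic_curve_def entry_simps fps_mult_left_const_nth)

text \<open>The curve passes through the generic matrix at $t=1$.\<close>

lemma generic_curve_eval:
  assumes "gl_point fps_iota g" "\<And>i j. g (Cgen i j) = fps_entry generic_curve i j"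
    and "f \<in> cpoly"
  shows "\<exists>n. (\<forall>k>n. fps_nth (gl_point.point fps_iota g f) k = 0) \<and> (\<Sum>k\<le>n. fps_nth (gl_point.point fps_iota g f) k) = f"
proof -
  interpret gl_point fps_iota g by fact
  have ext: "(\<Sum>k\<le>m. x k) = (\<Sum>k\<le>n. x k)" if "\<forall>k>n. x k = 0" "n \<le> m" for m n and x :: "nat \<Rightarrow> ('a, 'b, 'c) gl"
    using that by (intro sum.mono_neutral_right) auto
  show ?thesis
    using assms(3)
  proof induction
    case one
    show ?case by (rule exI[of _ 0]) (simp add: point_simps)
  next
    case (add f h)
    then obtain m n where mn: "\<forall>k>m. fps_nth (point f) k = 0" "(\<Sum>k\<le>m. fps_nth (point f) k) = f"
      "\<forall>k>n. fps_nth (point h) k = 0" "(\<Sum>k\<le>n. fps_nth (point h) k) = h" by blast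
    show ?case
      using mn ext[OF mn(1), of "max m n"] ext[OF mn(3), of "max m n"]
      by (intro exI[of _ "max m n"]) (simp add: point_simps sum.distrib)
  next
    case (scale f c)
    then obtain n where n: "\<forall>k>n. fps_nth (point f) k = 0" "(\<Sum>k\<le>n. fps_nth (point f) k) = f" by blast
    have nth: "fps_nth (point (gl_scale c f)) k = gl_scale c (fps_nth (point f) k)" for k
      by (simp only: point_simps fps_mult_left_const_nth gl_scale_one_mult)
    show ?case
    proof (intro exI[of _ n] conjI)
      show "\<forall>k>n. fps_nth (point (gl_scale c f)) k = 0" using n(1) by (simp only: nth gl.scale_zero_right) simp
      show "(\<Sum>k\<le>n. fps_nth (point (gl_scale c f)) k) = gl_scale c f"
        unfolding nth gl.scale_sum_right[symmetric] n(2) ..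
    qed
  next
    case (gen f i j)
    then obtain n where n: "\<forall>k>n. fps_nth (point f) k = 0" "(\<Sum>k\<le>n. fps_nth (point f) k) = f" by blast
    \<comment> \<open>The entry of the curve is linear in t, so the coefficients of f are combined
      with the same sequence shifted by one. Both sequences sum to f.\<close>
    have nth: "fps_nth (point (cc i j * f)) k = of_bool (i = j) * fps_nth (point f) k
        + (cc i j - of_bool (i = j)) * (if k = 0 then 0 else fps_nth (point f) (k - 1))" for k
      unfolding point_simps assms(2) fps_entry_generic
      by (simp only: distrib_right mult.assoc fps_add_nth fps_mult_left_const_nth fps_X_mult_nth)
    have "(\<Sum>k\<le>Suc n. fps_nth (point f) k) = f"
      by (rule trans[OF ext[OF n(1)] n(2)]) simp
    moreover have "(\<Sum>k\<le>Suc n. if k = 0 then 0 else fps_nth (point f) (k - 1)) = f"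
      unfolding sum.atMost_Suc_shift using n(2) by simp
    ultimately have "(\<Sum>k\<le>Suc n. fps_nth (point (cc i j * f)) k) = of_bool (i = j) * f + (cc i j - of_bool (i = j)) * f"
      unfolding nth sum.distrib sum_distrib_left[symmetric] by (simp only:)
    also have "\<dots> = cc i j * f" unfolding left_diff_distrib by simp
    finally have "(\<Sum>k\<le>Suc n. fps_nth (point (cc i j * f)) k) = cc i j * f" .
    moreover have "\<forall>k>Suc n. fps_nth (point (cc i j * f)) k = 0"
    proof (intro allI impI)
      fix k assume "k > Suc n"
      then have "k > n" "k \<noteq> 0" "k - 1 > n" by auto
      then have "fps_nth (point f) k = 0" "(if k = 0 then 0 else fps_nth (point f) (k - 1)) = 0" using n(1) by auto
      then show "fps_nth (point (cc i j * f)) k = 0" unfolding nth by (simp only: mult_zero_right add_0_left)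
    qed
    ultimately show ?case by (intro exI[of _ "Suc n"] conjI)
  qed
qed

lemma generic_curve_inj_cpoly:
  assumes "gl_point fps_iota g" "\<And>i j. g (Cgen i j) = fps_entry generic_curve i j"
    and "f \<in> cpoly" "gl_point.point fps_iota g f = 0"
  shows "f = 0"
  using generic_curve_eval[OF assms(1,2,3)] by (auto simp: assms(4))

subsection \<open>The odd ideal is nilpotent\<close>

text \<open>The d-th power of the ideal generated by the odd functions, written through words so
  that the number of odd letters is visible.\<close>

definition odd_power :: "nat \<Rightarrow> ('k::field_char_0, 'm::finite, 'n::finite) gl set" where
  "odd_power d = gl.span ((\<lambda>xs. prod_list (map gl_gen xs)) ` {xs. d \<le> length (filter gen_par xs)})"

lemma odd_power_word: "d \<le> length (filter gen_par xs) \<Longrightarrow> prod_list (map gl_gen xs) \<in> odd_power d"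
  unfolding odd_power_def by (intro gl.span_base imageI CollectI)

lemma odd_power_mult:
  assumes "f \<in> odd_power d" "g \<in> odd_power e"
  shows "f * g \<in> odd_power (d + e)"
  using assms(1) unfolding odd_power_def[of d]
proof (induction rule: gl.span_induct_alt)
  case base
  show ?case by (simp add: odd_power_def gl.span_zero)
next
  case (step c x y)
  then obtain xs where x: "x = prod_list (map gl_gen xs)" "d \<le> length (filter gen_par xs)" by blast
  have "x * g \<in> odd_power (d + e)"
    using assms(2) unfolding odd_power_def[of e]
  proof (induction rule: gl.span_induct_alt)
    case base
    show ?case by (simp add: odd_power_def gl.span_zero)
  next
    case (step c' x' y')
    then obtain ys where y: "x' = prod_list (map gl_gen ys)" "e \<le> length (filter gen_par ys)" by blast
    have "x * x' = prod_list (map gl_gen (xs @ ys))" by (simp add: x y)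
    then have "x * x' \<in> odd_power (d + e)"
      using x(2) y(2) by (simp only:) (rule odd_power_word, simp)
    with step(2) show ?case
      by (simp add: distrib_left odd_power_def gl.span_add gl.span_scale flip: gl_scale_mult)
  qed
  with step(2) show ?case
    by (simp add: distrib_right odd_power_def gl.span_add gl.span_scale flip: gl_scale_mult)
qed

lemma odd_power_0: "f \<in> odd_power 0"
proof (induction f rule: gl_gen_induct)
  case one
  show ?case using odd_power_word[of 0 "[]"] by simp
next
  case (gen x f)
  then show ?case using odd_power_mult[OF _ gen, of "gl_gen x" 0] odd_power_word[of 0 "[x]"] by simp
qed (simp_all add: odd_power_def gl.span_add gl.span_scale)

lemma odd_power_sum: "(\<And>x. x \<in> S \<Longrightarrow> F x \<in> odd_power d) \<Longrightarrow> sum F S \<in> odd_power d"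
  unfolding odd_power_def by (rule gl.span_sum)

lemma odd_part_in_odd_power: "gl_part True f \<in> odd_power 1"
proof (induction f rule: gl_gen_induct)
  case one
  show ?case by (simp add: gl_part_one odd_power_def gl.span_zero)
next
  case (gen x f)
  show ?case
  proof (cases "gen_par x")
    case True
    then have "gl_gen x \<in> odd_power 1" using odd_power_word[of 1 "[x]"] by simp
    from odd_power_mult[OF this odd_power_0] True show ?thesis by (simp add: gl_part_gen_mult)
  next
    case False
    from odd_power_mult[OF odd_power_0 gen, of "gl_gen x"] False show ?thesis by (simp add: gl_part_gen_mult)
  qed
qed (simp_all add: gl_part_add gl_part_scale odd_power_def gl.span_add gl.span_scale)

lemma odd_gen_square:
  assumes "gen_par x"
  shows "gl_gen x * gl_gen x = (0 :: ('k::field_char_0, 'm::finite, 'n::finite) gl)"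
proof -
  let ?y = "gl_gen x * gl_gen x :: ('k, 'm, 'n) gl"
  have "?y = - ?y"
    using gl_gen_commute[of x x] assms by simp
  then have "?y + ?y = 0" by (simp only: add_eq_0_iff)
  moreover have "?y + ?y = gl_scale (1 + 1) ?y"
    by (simp only: gl.scale_left_distrib gl.scale_one)
  ultimately show ?thesis by simp
qed

lemma finite_gen: "finite (UNIV :: ('m::finite, 'n::finite) gen set)"
proof -
  have "(UNIV :: ('m, 'n) gen set) \<subseteq> range (\<lambda>(i, j). Cgen i j) \<union> range (\<lambda>(i, j). Sgen i j)"
  proof
    fix x :: "('m, 'n) gen"
    show "x \<in> range (\<lambda>(i, j). Cgen i j) \<union> range (\<lambda>(i, j). Sgen i j)"
      by (cases x) (auto simp: image_iff)
  qed
  then show ?thesis by (rule finite_subset) simp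
qed

text \<open>Pigeonhole: a word with more odd letters than there are generators repeats one, and
  supercommutativity brings both copies together, where their square is 0.\<close>

lemma odd_power_eq_0:
  obtains d where "\<And>f :: ('k::field_char_0, 'm::finite, 'n::finite) gl. f \<in> odd_power d \<Longrightarrow> f = 0"
proof
  let ?d = "Suc (card (UNIV :: ('m, 'n) gen set))"
  fix f :: "('k, 'm, 'n) gl"
  have w: "prod_list (map gl_gen xs) = (0 :: ('k, 'm, 'n) gl)" if "?d \<le> length (filter gen_par xs)" for xs :: "('m, 'n) gen list"
  proof -
    have "\<not> distinct (filter gen_par xs)"
    proof
      assume "distinct (filter gen_par xs)"
      then have "length (filter gen_par xs) = card (set (filter gen_par xs))" by (rule distinct_card[symmetric])
      also have "\<dots> \<le> card (UNIV :: ('m, 'n) gen set)" by (rule card_mono[OF finite_gen]) simp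
      finally show False using that by simp
    qed
    then have "\<exists>x as bs cs. gen_par x \<and> xs = as @ [x] @ bs @ [x] @ cs"
    proof (induction xs)
      case (Cons y ys)
      show ?case
      proof (cases "distinct (filter gen_par ys)")
        case True
        with Cons.prems have y: "gen_par y" "y \<in> set ys" by (auto split: if_splits)
        obtain bs cs where "ys = bs @ y # cs" using split_list[OF y(2)] by blast
        with y(1) show ?thesis by (intro exI[of _ y] exI[of _ "[]"] exI[of _ bs] exI[of _ cs]) simp
      next
        case False
        from Cons.IH[OF this] obtain x as bs cs where "gen_par x" "ys = as @ [x] @ bs @ [x] @ cs" by blast
        then show ?thesis by (intro exI[of _ x] exI[of _ "y # as"] exI[of _ bs] exI[of _ cs]) simp
      qed
    qed simp
    then obtain x as bs cs where odd: "gen_par x" and xs: "xs = as @ [x] @ bs @ [x] @ cs" by blast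
    let ?w = "prod_list (map gl_gen bs) :: ('k, 'm, 'n) gl"
    have "gl_gen x * ?w * gl_gen x = 0"
      unfolding gen_mult_commute[of x ?w] mult.assoc odd_gen_square[OF odd] by simp
    then have "gl_gen x * ?w * gl_gen x * prod_list (map gl_gen cs) = 0" by (simp only: mult_zero_left)
    then show ?thesis
      unfolding xs map_append prod_list.append by (simp add: mult.assoc)
  qed
  show "f = 0" if "f \<in> odd_power ?d"
    using that unfolding odd_power_def by (induction rule: gl.span_induct_alt) (auto simp: w)
qed

text \<open>The entries of T^e lie in the e-th power of the odd ideal, so one exponent serves all
  such matrices.\<close>

lemma odd_matrix_nilpotent:
  obtains d where "\<And>T :: ('k::field_char_0, 'm::finite, 'n::finite) glmat. (\<And>i j. entry T i j \<in> odd_power 1) \<Longrightarrow> T ^ d = 0"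
proof -
  obtain d where d: "\<And>f :: ('k, 'm, 'n) gl. f \<in> odd_power d \<Longrightarrow> f = 0" using odd_power_eq_0 by blast
  show ?thesis
  proof (rule that)
    fix T :: "('k, 'm, 'n) glmat"
    assume T: "\<And>i j. entry T i j \<in> odd_power 1"
    have "entry (T ^ e) i j \<in> odd_power e" for e i j
    proof (induction e arbitrary: i j)
      case (Suc e)
      have "entry T i k * entry (T ^ e) k j \<in> odd_power (Suc e)" for k
        using odd_power_mult[OF T Suc] by simp
      then show ?case by (simp add: entry_simps odd_power_sum)
    qed (simp add: odd_power_0)
    then show "T ^ d = 0" using d by (intro sqmat_eqI) (simp add: entry_simps)
  qed
qed

subsection \<open>The commutative ring of even functions\<close>

text \<open>Even functions commute with each other, so the theory of determinants applies to
  matrices over this type.\<close>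

typedef (overloaded) ('k, 'm, 'n) gl0 = "{f :: ('k::field_char_0, 'm::finite, 'n::finite) gl. gl_part False f = f}"
  morphisms of_gl0 to_gl0
  by (rule exI[of _ 0]) simp

setup_lifting type_definition_gl0

lemma even_mult: "gl_part False f = f \<Longrightarrow> gl_part False (f * g) = f * gl_part False g"
  using hom_mult_part[of False f False g] by simp

instantiation gl0 :: (field_char_0, finite, finite) comm_ring_1
begin
lift_definition zero_gl0 :: "('a, 'b, 'c) gl0" is 0 by simp
lift_definition one_gl0 :: "('a, 'b, 'c) gl0" is 1 by (simp add: gl_part_one)
lift_definition plus_gl0 :: "('a, 'b, 'c) gl0 \<Rightarrow> ('a, 'b, 'c) gl0 \<Rightarrow> ('a, 'b, 'c) gl0" is "(+)"
  by (simp add: gl_part_add)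
lift_definition minus_gl0 :: "('a, 'b, 'c) gl0 \<Rightarrow> ('a, 'b, 'c) gl0 \<Rightarrow> ('a, 'b, 'c) gl0" is "(-)"
  by (simp add: linearD(4)[OF gl_part_linear])
lift_definition uminus_gl0 :: "('a, 'b, 'c) gl0 \<Rightarrow> ('a, 'b, 'c) gl0" is uminus
  by (simp add: linearD(5)[OF gl_part_linear])
lift_definition times_gl0 :: "('a, 'b, 'c) gl0 \<Rightarrow> ('a, 'b, 'c) gl0 \<Rightarrow> ('a, 'b, 'c) gl0" is "(*)"
  by (simp add: even_mult)
instance
proof
  fix x y z :: "('a, 'b, 'c) gl0"
  show "x * y = y * x"
    by transfer (use hom_commute[of False _ False] in simp)
  show "x * y * z = x * (y * z)" by transfer (rule mult.assoc)
  show "1 * x = x" by transfer simp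
  show "(x + y) * z = x * z + y * z" by transfer (rule distrib_right)
  show "x + y + z = x + (y + z)" by transfer (rule add.assoc)
  show "x + y = y + x" by transfer (rule add.commute)
  show "0 + x = x" "- x + x = 0" "x - y = x + - y" by (transfer; simp)+
  show "(0 :: ('a, 'b, 'c) gl0) \<noteq> 1" by transfer simp
qed
end

lemmas of_gl0_simps = zero_gl0.rep_eq one_gl0.rep_eq plus_gl0.rep_eq minus_gl0.rep_eq uminus_gl0.rep_eq times_gl0.rep_eq

lemma of_gl0_sum: "of_gl0 (sum F S) = (\<Sum>x\<in>S. of_gl0 (F x))"
  by (induction S rule: infinite_finite_induct) (simp_all add: of_gl0_simps)

lemma of_gl0_even: "gl_part False (of_gl0 x) = of_gl0 x"
  using of_gl0[of x] by simp

lemma of_gl0_central: "of_gl0 x * f = f * of_gl0 x"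
  using part_mult_commute[of False "of_gl0 x" f] of_gl0_even[of x]
  by (simp add: twist_def gl_part_sum_parts add.commute[of "gl_part False f"])

lemma of_gl0_inverse: "gl_part False f = f \<Longrightarrow> of_gl0 (to_gl0 f) = f"
  by (simp add: to_gl0_inverse)

lemma det_in_cpoly:
  fixes A :: "('k::field_char_0, 'm::finite, 'n::finite) gl0^'i^'i"
  assumes "\<And>i j. of_gl0 (A $ i $ j) \<in> cpoly"
  shows "of_gl0 (det A) \<in> cpoly"
proof -
  have prod: "of_gl0 (prod F S) \<in> cpoly" if "\<And>i. of_gl0 (F i) \<in> cpoly" for F :: "'i \<Rightarrow> ('k, 'm, 'n) gl0" and S
    by (induction S rule: infinite_finite_induct) (simp_all add: of_gl0_simps cpoly.one cpoly_mult that)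
  have "of_gl0 (of_int (sign p) * (\<Prod>i\<in>UNIV. A $ i $ p i)) \<in> cpoly" for p
    using prod[of "\<lambda>i. A $ i $ p i" UNIV] assms by (cases p rule: sign_cases) (simp_all add: of_gl0_simps cpoly_uminus)
  then show ?thesis unfolding det_def of_gl0_sum by (rule cpoly_sum)
qed

text \<open>The (k,j) entry of the adjugate, as the cofactor obtained by putting the k-th unit
  vector into row j.\<close>

definition right_adjugate :: "'a::comm_ring_1^'i^'i \<Rightarrow> 'i::finite \<Rightarrow> 'i \<Rightarrow> 'a" where
  "right_adjugate A k j = det (\<chi> r. if r = j then axis k 1 else A $ r)"

text \<open>Linearity in row j assembles the sum into the determinant with row j replaced by row i,
  which has two equal rows unless i = j.\<close>

lemma right_adjugate:
  fixes A :: "'a::comm_ring_1^'i^'i"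
  shows "(\<Sum>k\<in>UNIV. A $ i $ k * right_adjugate A k j) = (if i = j then det A else 0)"
proof -
  have "(\<Sum>k\<in>UNIV. A $ i $ k * right_adjugate A k j)
      = (\<Sum>k\<in>UNIV. det (\<chi> r. if r = j then A $ i $ k *s axis k 1 else A $ r))"
    unfolding right_adjugate_def det_row_mul ..
  also have "\<dots> = det (\<chi> r. if r = j then (\<Sum>k\<in>UNIV. A $ i $ k *s axis k 1) else A $ r)"
    by (rule det_linear_row_sum[symmetric]) simp
  also have "\<dots> = det (\<chi> r. if r = j then A $ i else A $ r)"
    by (simp only: basis_expansion)
  also have "\<dots> = (if i = j then det A else 0)"
  proof (cases "i = j")
    case True
    then have "(\<chi> r. if r = j then A $ i else A $ r) = A" by (simp add: vec_eq_iff)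
    with True show ?thesis by simp
  next
    case False
    then have "det (\<chi> r. if r = j then A $ i else A $ r) = 0"
      by (intro det_identical_rows[OF False]) (simp add: row_def vec_eq_iff)
    with False show ?thesis by simp
  qed
  finally show ?thesis .
qed

text \<open>With C the generic matrix, S its inverse and Co the matrix of odd parts, the matrix of
  even parts is C(1 - S Co). The entries of S Co lie in the odd ideal, so a finite geometric series
  inverts the second factor. Even parts of the entries of the inverse still give an inverse, as the
  left factor has even entries.\<close>

lemma even_block_right_inverse:
  obtains Y :: "('k::field_char_0, 'm::finite, 'n::finite) glmat"
  where "Sqmat (\<lambda>i j. gl_part False (cc i j)) * Y = 1" "\<And>i j. gl_part False (entry Y i j) = entry Y i j"
proof -
  define C S Ce Co :: "('k, 'm, 'n) glmat" where "C = Sqmat cc" "S = Sqmat ss"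
    "Ce = Sqmat (\<lambda>i j. gl_part False (cc i j))" "Co = Sqmat (\<lambda>i j. gl_part True (cc i j))"
  note defs = this
  have CS: "C * S = 1" "S * C = 1"
    by (rule sqmat_eqI, simp only: defs entry_simps gl_inverse)+
  have "C = Ce + Co"
    by (rule sqmat_eqI) (simp only: defs entry_simps gl_part_sum_parts add.commute[of "gl_part False _"])
  then have Ce: "Ce = C * (1 - S * Co)"
    unfolding right_diff_distrib mult.assoc[symmetric] CS by simp
  obtain d where d: "\<And>T :: ('k, 'm, 'n) glmat. (\<And>i j. entry T i j \<in> odd_power 1) \<Longrightarrow> T ^ d = 0"
    using odd_matrix_nilpotent by blast
  have "entry (S * Co) i j \<in> odd_power 1" for i j
  proof -
    have "ss i k * gl_part True (cc k j) \<in> odd_power (0 + 1)" for k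
      by (intro odd_power_mult odd_power_0 odd_part_in_odd_power)
    then show ?thesis unfolding defs entry_simps add_0 by (rule odd_power_sum)
  qed
  then have T0: "(S * Co) ^ d = 0" by (rule d)
  have geo: "(1 - x) * (\<Sum>k<n. x ^ k) = 1 - x ^ n" for x :: "('k, 'm, 'n) glmat" and n
    by (induction n) (simp_all add: distrib_left left_diff_distrib)
  let ?Y = "(\<Sum>k<d. (S * Co) ^ k) * S"
  have "Ce * ?Y = C * ((1 - S * Co) * (\<Sum>k<d. (S * Co) ^ k)) * S"
    unfolding Ce by (simp only: mult.assoc)
  then have Y: "Ce * ?Y = 1" unfolding geo T0 by (simp add: CS)
  let ?Z = "Sqmat (\<lambda>i j. gl_part False (entry ?Y i j))"
  have "Ce * ?Z = 1"
  proof (rule sqmat_eqI)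
    fix i j
    have "entry (Ce * ?Z) i j = gl_part False (entry (Ce * ?Y) i j)"
      by (simp only: entry_simps linearD(6)[OF gl_part_linear] defs even_mult gl_part_part simp_thms if_True)
    then show "entry (Ce * ?Z) i j = entry 1 i j"
      unfolding Y by (cases "i = j") (simp_all add: entry_simps gl_part_one)
  qed
  then show ?thesis
    unfolding defs by (rule that) (simp add: entry_simps gl_part_part)
qed

lemma central_power:
  fixes P :: "'a::monoid_mult"
  assumes "\<And>f. P * f = f * P"
  shows "P ^ n * f = f * P ^ n"
proof (induction n)
  case (Suc n)
  have "P ^ Suc n * f = P * (f * P ^ n)" unfolding power_Suc mult.assoc Suc ..
  also have "\<dots> = f * P ^ Suc n" unfolding assms[of "f * P ^ n"] power_Suc2 mult.assoc ..
  finally show ?case .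
qed simp

text \<open>P is a power of the determinant p of the matrix Ce of even parts. If N is the adjugate
  of Ce, then C N = p + Od with Od nilpotent, so a suitable polynomial Z gives C N Z = p^d, and S
  p^d = N Z has polynomial entries.\<close>

lemma clear_denominators:
  obtains P Q :: "('k::field_char_0, 'm::finite, 'n::finite) gl"
  where "Q * P = 1" "P \<in> cpoly" "\<And>f. P * f = f * P" "\<And>i j. P * ss i j \<in> cpoly"
proof -
  define C S Ce Co :: "('k, 'm, 'n) glmat" where "C = Sqmat cc" "S = Sqmat ss"
    "Ce = Sqmat (\<lambda>i j. gl_part False (cc i j))" "Co = Sqmat (\<lambda>i j. gl_part True (cc i j))"
  note defs = this
  have CS: "C * S = 1" "S * C = 1"
    by (rule sqmat_eqI, simp only: defs entry_simps gl_inverse)+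
  have C: "C = Ce + Co"
    by (rule sqmat_eqI) (simp only: defs entry_simps gl_part_sum_parts add.commute[of "gl_part False _"])
  obtain Y :: "('k, 'm, 'n) glmat" where Y: "Ce * Y = 1" "\<And>i j. gl_part False (entry Y i j) = entry Y i j"
    using even_block_right_inverse unfolding defs by blast
  define A :: "('k, 'm, 'n) gl0^('m + 'n)^('m + 'n)" where "A = (\<chi> i j. to_gl0 (gl_part False (cc i j)))"
  define A' :: "('k, 'm, 'n) gl0^('m + 'n)^('m + 'n)" where "A' = (\<chi> i j. to_gl0 (entry Y i j))"
  have A: "of_gl0 (A $ i $ j) = entry Ce i j" "of_gl0 (A' $ i $ j) = entry Y i j" for i j
    by (simp_all add: A_def A'_def defs entry_simps of_gl0_inverse gl_part_part Y(2))
  have "A ** A' = mat 1"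
  proof -
    have "of_gl0 ((A ** A') $ i $ j) = of_gl0 (mat 1 $ i $ j)" for i j
    proof -
      have "of_gl0 ((A ** A') $ i $ j) = entry (Ce * Y) i j"
        by (simp add: matrix_matrix_mult_def of_gl0_sum of_gl0_simps A entry_simps)
      then show ?thesis by (simp add: Y(1) entry_simps mat_def of_gl0_simps)
    qed
    then show ?thesis by (simp add: vec_eq_iff of_gl0_inject)
  qed
  then have "det A * det A' = 1" by (metis det_mul det_I)
  then have unit: "of_gl0 (det A') * of_gl0 (det A) = 1"
    by (metis mult.commute of_gl0_simps(2) of_gl0_simps(6))
  define p where "p = of_gl0 (det A)"
  have central: "p * f = f * p" for f unfolding p_def by (rule of_gl0_central)
  have Apoly: "of_gl0 (A $ i $ j) \<in> cpoly" for i j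
    unfolding A by (simp add: defs entry_simps gl_part_gen cpoly_0 cpoly_cc)
  have p: "p \<in> cpoly" unfolding p_def by (rule det_in_cpoly) (rule Apoly)
  define N :: "('k, 'm, 'n) glmat" where "N = Sqmat (\<lambda>k j. of_gl0 (right_adjugate A k j))"
  \<comment> \<open>The scalar matrix p, so that powers of p and of \<open>Od\<close> live in the
    same ring.\<close>
  define pm :: "('k, 'm, 'n) glmat" where "pm = Sqmat (\<lambda>i j. of_bool (i = j) * p)"
  have pm: "entry (pm * X) i j = p * entry X i j" "entry (X * pm) i j = p * entry X i j" for X i j
  proof -
    have "entry (pm * X) i j = (\<Sum>k\<in>UNIV. of_bool (i = k) * (p * entry X k j))"
      by (simp only: pm_def entry_simps mult.assoc)
    then show "entry (pm * X) i j = p * entry X i j" by (simp only: sum_of_bool_mult)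
    have "entry (X * pm) i j = (\<Sum>k\<in>UNIV. (p * entry X i k) * of_bool (k = j))"
      unfolding pm_def entry_simps by (intro sum.cong refl) (auto simp: central)
    then show "entry (X * pm) i j = p * entry X i j" by (simp only: sum_of_bool_mult)
  qed
  have pm_comm: "pm * X = X * pm" for X by (rule sqmat_eqI) (simp only: pm)
  have Npoly: "entry N k j \<in> cpoly" for k j
    unfolding N_def entry_simps right_adjugate_def
    by (rule det_in_cpoly) (auto simp: Apoly axis_def of_gl0_simps cpoly_0 cpoly.one)
  have CeN: "Ce * N = pm"
  proof (rule sqmat_eqI)
    fix i j
    have "entry (Ce * N) i j = of_gl0 (\<Sum>k\<in>UNIV. A $ i $ k * right_adjugate A k j)"
      by (simp add: entry_simps N_def A of_gl0_sum of_gl0_simps)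
    then show "entry (Ce * N) i j = entry pm i j"
      unfolding right_adjugate by (simp add: pm_def entry_simps p_def of_gl0_simps)
  qed
  define Od where "Od = Co * N"
  have "C * N = pm + Od" by (simp only: C distrib_right CeN Od_def)
  have "entry Od i j \<in> odd_power 1" for i j
  proof -
    have "gl_part True (cc i k) * entry N k j \<in> odd_power (1 + 0)" for k
      by (intro odd_power_mult odd_power_0 odd_part_in_odd_power)
    then show ?thesis unfolding Od_def defs entry_simps add_0_right by (rule odd_power_sum)
  qed
  moreover obtain d where d: "\<And>T :: ('k, 'm, 'n) glmat. (\<And>i j. entry T i j \<in> odd_power 1) \<Longrightarrow> T ^ d = 0"
    using odd_matrix_nilpotent by blast
  ultimately have Od0: "(- Od) ^ d = 0"
    by (intro d) (simp add: entry_simps odd_power_def gl.span_neg)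
  have Odpoly: "entry Od i j \<in> cpoly" for i j
    unfolding Od_def entry_simps defs by (intro cpoly_sum cpoly_mult Npoly) (simp add: gl_part_gen cpoly_0 cpoly_cc)
  \<comment> \<open>Z is the cofactor in the factorization of pm^n - (- Od)^n, which exists because
    pm is central; the recursion keeps its entries polynomial.\<close>
  have "\<exists>Z. (pm + Od) * Z = pm ^ n - (- Od) ^ n \<and> (\<forall>i j. entry Z i j \<in> cpoly)" for n
  proof (induction n)
    case 0
    show ?case by (rule exI[of _ 0]) (simp add: entry_simps cpoly_0)
  next
    case (Suc n)
    then obtain Z where Z: "(pm + Od) * Z = pm ^ n - (- Od) ^ n" "\<And>i j. entry Z i j \<in> cpoly" by blast
    have Opow: "entry ((- Od) ^ n) i j \<in> cpoly" for i j
    proof (induction n arbitrary: i j)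
      case (Suc n)
      then show ?case by (simp add: entry_simps cpoly_sum cpoly_mult cpoly_uminus Odpoly)
    qed (auto simp: entry_simps cpoly_0 cpoly.one)
    have "(pm + Od) * (Z * pm + (- Od) ^ n) = ((pm + Od) * Z) * pm + (pm + Od) * (- Od) ^ n"
      by (simp only: distrib_left mult.assoc)
    also have "\<dots> = pm ^ n * pm - (- Od) ^ n * pm + (pm * (- Od) ^ n - (- Od) * (- Od) ^ n)"
      unfolding Z(1) by (simp add: left_diff_distrib distrib_right)
    also have "\<dots> = pm ^ Suc n - (- Od) ^ Suc n"
      unfolding pm_comm[of "(- Od) ^ n"] power_Suc pm_comm[of "pm ^ n"] by simp
    finally have "(pm + Od) * (Z * pm + (- Od) ^ n) = pm ^ Suc n - (- Od) ^ Suc n" .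
    moreover have "entry (Z * pm + (- Od) ^ n) i j \<in> cpoly" for i j
      by (simp only: entry_simps(1) pm) (intro cpoly.add cpoly_mult p Z Opow)
    ultimately show ?case by blast
  qed
  then obtain Z where Z: "(pm + Od) * Z = pm ^ d - (- Od) ^ d" "\<And>i j. entry Z i j \<in> cpoly" by blast
  have "C * (N * Z) = pm ^ d"
    using Z(1) \<open>C * N = pm + Od\<close> Od0 by (simp flip: mult.assoc)
  then have "S * (C * (N * Z)) = S * pm ^ d" by simp
  then have NZ: "N * Z = S * pm ^ d" unfolding mult.assoc[symmetric] CS(2) by (simp add: mult.assoc)
  have pmd: "entry (X * pm ^ n) i j = p ^ n * entry X i j" for X i j n
  proof (induction n arbitrary: X)
    case (Suc n)
    have e: "X * pm ^ Suc n = (X * pm ^ n) * pm" by (simp only: power_Suc2 mult.assoc)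
    show ?case unfolding e pm(2) Suc by (simp only: power_Suc mult.assoc)
  qed simp
  have "p ^ d * ss i j = entry (N * Z) i j" for i j
    unfolding NZ pmd by (simp add: defs entry_simps)
  moreover have "entry (N * Z) i j \<in> cpoly" for i j
    unfolding entry_simps by (intro cpoly_sum cpoly_mult Npoly Z)
  ultimately have 1: "p ^ d * ss i j \<in> cpoly" for i j by simp
  have 2: "p ^ n \<in> cpoly" for n by (induction n) (simp_all add: cpoly.one cpoly_mult p)
  have 3: "p ^ n * f = f * p ^ n" for n f
    by (rule central_power) (rule central)
  have 4: "of_gl0 (det A') ^ n * p ^ n = 1" for n
  proof (induction n)
    case (Suc n)
    have "of_gl0 (det A') ^ Suc n * p ^ Suc n = of_gl0 (det A') ^ n * (of_gl0 (det A') * p) * p ^ n"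
      unfolding power_Suc2[of "of_gl0 (det A')"] power_Suc[of p] mult.assoc ..
    with Suc unit show ?case by (simp only: p_def mult_1_right)
  qed simp
  show ?thesis by (rule that[OF 4[of d] 2[of d] 3[of d] 1])
qed

text \<open>Multiplying by a power of the central unit P turns f into a polynomial function, to
  which evaluation at t = 1 applies; the unit is then cancelled.\<close>

lemma generic_curve_inj:
  assumes g: "gl_point fps_iota g" "\<And>i j. g (Cgen i j) = fps_entry generic_curve i j"
    and f: "gl_point.point fps_iota g f = 0"
  shows "f = 0"
proof -
  interpret gl_point fps_iota g by (rule g)
  obtain P Q :: "('a, 'b, 'c) gl" where P: "Q * P = 1" "P \<in> cpoly" "\<And>f. P * f = f * P" "\<And>i j. P * ss i j \<in> cpoly"
    by (rule clear_denominators) (rule that)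
  have Pn: "P ^ n \<in> cpoly" for n by (induction n) (simp_all add: cpoly.one cpoly_mult P)
  have Pc: "P ^ n * f = f * P ^ n" for n f
    by (rule central_power) (rule P(3))
  have "\<exists>n. P ^ n * f \<in> cpoly"
  proof (induction f rule: gl_gen_induct)
    case (add f h)
    then obtain m n where mn: "P ^ m * f \<in> cpoly" "P ^ n * h \<in> cpoly" by blast
    have "P ^ (m + n) * f = P ^ n * (P ^ m * f)" by (simp only: add.commute[of m n] power_add mult.assoc)
    moreover have "P ^ (m + n) * h = P ^ m * (P ^ n * h)" by (simp only: power_add mult.assoc)
    ultimately have "P ^ (m + n) * (f + h) \<in> cpoly"
      unfolding distrib_left by (simp only:) (intro cpoly.add cpoly_mult Pn mn)
    then show ?case ..
  next
    case (scale c f)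
    then obtain n where "P ^ n * f \<in> cpoly" by blast
    then have "P ^ n * gl_scale c f \<in> cpoly" by (simp add: cpoly.scale flip: gl_scale_mult)
    then show ?case ..
  next
    case one
    show ?case using Pn[of 0] by (intro exI[of _ 0]) simp
  next
    case (gen x f)
    then obtain n where n: "P ^ n * f \<in> cpoly" by blast
    have c: "P ^ n * (gl_gen x * f) = gl_gen x * (P ^ n * f)"
      unfolding mult.assoc[symmetric] Pc[of n "gl_gen x"] ..
    show ?case
    proof (cases x)
      case (Cgen i j)
      have "P ^ n * (gl_gen x * f) \<in> cpoly" unfolding c unfolding Cgen by (rule cpoly.gen) (rule n)
      then show ?thesis ..
    next
      case (Sgen i j)
      have "P ^ Suc n * (gl_gen x * f) = (P * gl_gen x) * (P ^ n * f)" unfolding power_Suc mult.assoc c ..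
      moreover have "(P * gl_gen x) * (P ^ n * f) \<in> cpoly" unfolding Sgen by (intro cpoly_mult P n)
      ultimately have "P ^ Suc n * (gl_gen x * f) \<in> cpoly" by (simp only:)
      then show ?thesis ..
    qed
  qed
  then obtain n where n: "P ^ n * f \<in> cpoly" by blast
  have "point (P ^ n * f) = 0" by (simp add: point_simps f)
  from generic_curve_inj_cpoly[OF g n this] have "P ^ n * f = 0" .
  then show "f = 0"
  proof (induction n)
    case (Suc n)
    then have "Q * (P * (P ^ n * f)) = 0" by (simp add: mult.assoc)
    then have "P ^ n * f = 0" unfolding mult.assoc[symmetric] P(1) by simp
    then show ?case by (rule Suc)
  qed simp
qed

section \<open>Triangular matrices modulo an ideal\<close>

locale gl_ideal =
  fixes I :: "('k::field_char_0, 'm::finite, 'n::finite) gl set"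
  assumes add: "f \<in> I \<Longrightarrow> g \<in> I \<Longrightarrow> f + g \<in> I"
    and mult: "f \<in> I \<Longrightarrow> a * f * b \<in> I"
    and zero: "0 \<in> I"
begin

lemma lmult: "f \<in> I \<Longrightarrow> a * f \<in> I" using mult[of f a 1] by simp

lemma rmult: "f \<in> I \<Longrightarrow> f * a \<in> I" using mult[of f 1 a] by simp

lemma uminus: "f \<in> I \<Longrightarrow> - f \<in> I" using lmult[of f "-1"] by simp

lemma diff: "f \<in> I \<Longrightarrow> g \<in> I \<Longrightarrow> f - g \<in> I" using add[of f "- g"] uminus[of g] by simp

lemma scale: "f \<in> I \<Longrightarrow> gl_scale c f \<in> I" using lmult[of f "gl_scale c 1"] by (simp add: gl_scale_one_mult)

lemma sum: "(\<And>x. x \<in> S \<Longrightarrow> F x \<in> I) \<Longrightarrow> sum F S \<in> I"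
  by (induction S rule: infinite_finite_induct) (simp_all add: zero add)

lemma subspace: "gl.subspace I"
  by (intro gl.subspaceI zero add scale)

lemma cong_trans: "f - g \<in> I \<Longrightarrow> g - h \<in> I \<Longrightarrow> f - h \<in> I"
  using add[of "f - g" "g - h"] by simp

lemma cong_lmult: "f - g \<in> I \<Longrightarrow> a * f - a * g \<in> I"
  using lmult[of "f - g" a] by (simp add: right_diff_distrib)

lemma cong_rmult: "f - g \<in> I \<Longrightarrow> f * a - g * a \<in> I"
  using rmult[of "f - g" a] by (simp add: left_diff_distrib)

end

lemma diag_commute:
  fixes f :: "('k::field_char_0, 'm::finite, 'n::finite) gl"
  shows "gl_gen (Cgen i i) * f = f * gl_gen (Cgen i i)" "gl_gen (Sgen i i) * f = f * gl_gen (Sgen i i)"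
proof -
  have "twist False f = f"
    using gl_part_sum_parts[of f] by (simp add: twist_def add.commute)
  then show "gl_gen (Cgen i i) * f = f * gl_gen (Cgen i i)" "gl_gen (Sgen i i) * f = f * gl_gen (Sgen i i)"
    using gen_mult_commute[of "Cgen i i" f] gen_mult_commute[of "Sgen i i" f] by simp_all
qed

text \<open>The sign makes \<epsilon>_i - \<epsilon>_j positive when r i < r j. A linear form that
  is positive on the positive roots replaces the partial order of weights.\<close>

definition height :: "('m + 'n \<Rightarrow> int) \<Rightarrow> ('m::finite, 'n::finite) weight \<Rightarrow> int" where
  "height r \<mu> = - (\<Sum>i\<in>UNIV. r i * \<mu> i)"

lemma height_add: "height r (\<mu> + \<nu>) = height r \<mu> + height r \<nu>"
  by (simp add: height_def distrib_left sum.distrib)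

lemma height_letter: "height r (letter_weight t i) = (if t then - r i else r i)"
proof -
  have "(\<Sum>j\<in>UNIV. r j * of_bool (i = j)) = r i"
    using sum_of_bool_mult(1)[of i r] by (simp add: mult.commute)
  then show ?thesis by (simp add: height_def letter_weight_def unit_weight_def sum_negf del: sum_mult_of_bool_eq)
qed

lemma height_uminus: "height (\<lambda>i. - r i) \<mu> = - height r \<mu>"
  by (simp add: height_def sum_negf)

text \<open>Ideals modulo which the generic matrix is lower triangular for the order given by r. The
  interpretations are \<open>borel_ideal\<close> with \<open>index_rank\<close> and, with the order
  reversed, the kernel of an upper unipotent point.\<close>

locale triangular_ideal = gl_ideal I for I :: "('k::field_char_0, 'm::finite, 'n::finite) gl set" +
  fixes r :: "'m + 'n \<Rightarrow> int"
  assumes inj: "inj r" and tri: "r i < r j \<Longrightarrow> cc i j \<in> I"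
begin

text \<open>Induction from the highest rank downwards. In the sum of all s_ik c_kj, which is
  \<delta>_ij, the terms with k ranked below j vanish by triangularity and those with k above j by
  induction. This leaves s_ij c_jj = \<delta>_ij modulo I for i not ranked above j.\<close>

lemma inverse_triangular:
  "(\<forall>i. r i < r j \<longrightarrow> ss i j \<in> I) \<and> ss j j * cc j j - 1 \<in> I"
proof (induction "card {k. r j < r k}" arbitrary: j rule: less_induct)
  case less
  have IH: "ss i k \<in> I" if "r i < r k" "r j < r k" for i k
  proof -
    have "{l. r k < r l} \<subset> {l. r j < r l}" using that(2) by auto
    then have "card {l. r k < r l} < card {l. r j < r l}" by (intro psubset_card_mono) auto
    from less[OF this] that(1) show ?thesis by blast
  qed
  have key: "ss i j * cc j j - of_bool (i = j) \<in> I" if "r i \<le> r j" for i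
  proof -
    have "of_bool (i = j) = (\<Sum>k\<in>UNIV. ss i k * cc k j :: ('k, 'm, 'n) gl)" by (simp only: gl_inverse)
    also have "\<dots> = ss i j * cc j j + (\<Sum>k\<in>UNIV - {j}. ss i k * cc k j)"
      by (rule sum.remove) simp_all
    finally have "ss i j * cc j j - of_bool (i = j) = - (\<Sum>k\<in>UNIV - {j}. ss i k * cc k j :: ('k, 'm, 'n) gl)"
      by (simp only:) simp
    moreover have "ss i k * cc k j \<in> I" if "k \<in> UNIV - {j}" for k
    proof -
      have "r k \<noteq> r j" using that inj by (auto dest: injD)
      then consider "r k < r j" | "r j < r k" by linarith
      then show ?thesis
      proof cases
        case 1
        then show ?thesis by (intro lmult tri)
      next
        case 2
        then show ?thesis using \<open>r i \<le> r j\<close> by (intro rmult IH) auto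
      qed
    qed
    then have "- (\<Sum>k\<in>UNIV - {j}. ss i k * cc k j) \<in> I" by (intro uminus sum)
    ultimately show ?thesis by (simp only:)
  qed
  have jj: "ss j j * cc j j - 1 \<in> I" using key[of j] by simp
  moreover have "ss i j \<in> I" if "r i < r j" for i
  proof -
    have "i \<noteq> j" using that by auto
    then have 1: "ss i j * cc j j \<in> I" using key[of i] that by simp
    \<comment> \<open>s_jj inverts c_jj modulo I, so the factor c_jj can be cancelled from s_ij
      c_jj.\<close>
    have "ss i j = ss i j * cc j j * ss j j - ss i j * (ss j j * cc j j - 1)"
      unfolding right_diff_distrib diag_commute(1)[of j "ss j j", symmetric] mult.assoc by simp
    moreover have "ss i j * cc j j * ss j j - ss i j * (ss j j * cc j j - 1) \<in> I"
      by (intro diff rmult[OF 1] lmult jj)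
    ultimately show ?thesis by (rule ssubst)
  qed
  ultimately show ?case by blast
qed

lemma ent_triangular:
  "gl_ent t i j \<in> I \<or> height r (letter_weight t i) < height r (letter_weight t j) \<or> i = j"
proof (cases "i = j")
  case False
  then have "r i \<noteq> r j" using inj by (auto dest: injD)
  then consider "r i < r j" | "r j < r i" by linarith
  then show ?thesis
  proof cases
    case 1
    then show ?thesis by (cases t) (simp_all add: height_letter tri)
  next
    case 2
    then have "ss j i \<in> I" using inverse_triangular[of i] by blast
    with 2 show ?thesis by (cases t) (simp_all add: height_letter scale)
  qed
qed simp

text \<open>A factor outside I is diagonal or strictly raises the height from the row letter to the
  column letter, and the heights of letters add up.\<close>

lemma mcoef_triangular:
  assumes "length is = length ts" "length js = length ts"
  shows "mcoef ts is js \<in> I \<or> height r (weight_of ts is) < height r (weight_of ts js) \<or> is = js"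
  using assms
proof (induction ts "is" js rule: mcoef.induct)
  case (2 t ts i "is" j js)
  consider "gl_ent t i j \<in> I" | "mcoef ts is js \<in> I"
    | "height r (letter_weight t i) < height r (letter_weight t j) \<or> i = j"
      "height r (weight_of ts is) < height r (weight_of ts js) \<or> is = js"
    using 2 ent_triangular[of t i j] by auto
  then show ?case
  proof cases
    case 1
    then have "mcoef (t # ts) (i # is) (j # js) \<in> I" unfolding mcoef.simps by (intro scale rmult)
    then show ?thesis ..
  next
    case 2
    then have "mcoef (t # ts) (i # is) (j # js) \<in> I" unfolding mcoef.simps by (intro scale lmult)
    then show ?thesis ..
  next
    case 3
    then show ?thesis unfolding weight_of.simps height_add by auto
  qed
qed simp_all

lemma diag_unit: "cc j j * ss j j - 1 \<in> I"
  using inverse_triangular[of j] by (simp add: diag_commute(1)[of j "ss j j"])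

end

lemma mcoef_diag_Cons: "mcoef (t # ts) (i # is) (i # is) = gl_ent t i i * mcoef ts is is"
  by simp

lemma gl_ent_diag: "gl_ent False i i = ss i i"
  by (simp add: ksign_def)

section \<open>The lower Borel subgroup\<close>

definition index_rank :: "'m::{finite, linorder} + 'n::{finite, linorder} \<Rightarrow> int" where
  "index_rank i = int (card {j. index_less j i})"

lemma index_less_order:
  "\<not> index_less i i" "index_less i j \<Longrightarrow> index_less j k \<Longrightarrow> index_less i k" "i \<noteq> j \<Longrightarrow> index_less i j \<or> index_less j i"
  by (cases i; cases j; cases k; auto)+

lemma index_rank_mono: "index_less i j \<Longrightarrow> index_rank i < index_rank j"
proof -
  assume ij: "index_less i j"
  then have "{k. index_less k i} \<subset> {k. index_less k j}"
    using index_less_order(1)[of i] index_less_order(2)[of _ i j] by blast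
  then show ?thesis unfolding index_rank_def by (simp add: psubset_card_mono)
qed

lemma index_rank_less: "index_rank i < index_rank j \<longleftrightarrow> index_less i j"
  using index_rank_mono[of i j] index_rank_mono[of j i] index_less_order(3)[of i j] by force

lemma inj_index_rank: "inj index_rank"
proof (rule injI, rule ccontr)
  fix i j :: "'a + 'b"
  assume "index_rank i = index_rank j" "i \<noteq> j"
  then show False using index_less_order(3)[of i j] index_rank_mono[of i j] index_rank_mono[of j i] by auto
qed

global_interpretation borel: triangular_ideal "borel_ideal :: ('k::field_char_0, 'm::{finite, linorder}, 'n::{finite, linorder}) gl set" index_rank
proof
  show "f + g \<in> borel_ideal" if "f \<in> borel_ideal" "g \<in> borel_ideal" for f g :: "('k, 'm, 'n) gl"
    using that unfolding borel_ideal_def by (rule ideal_gen_plus)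
  show "a * f * b \<in> borel_ideal" if "f \<in> borel_ideal" for a f b :: "('k, 'm, 'n) gl"
    using that unfolding borel_ideal_def by (rule ideal_gen_mult)
  show "(0 :: ('k, 'm, 'n) gl) \<in> borel_ideal" unfolding borel_ideal_def by (rule ideal_gen.zero)
  show "inj (index_rank :: 'm + 'n \<Rightarrow> int)" by (rule inj_index_rank)
  show "cc i j \<in> (borel_ideal :: ('k, 'm, 'n) gl set)" if "index_rank i < index_rank j" for i j
    using that unfolding borel_ideal_def by (intro ideal_gen_superset) (auto simp: index_rank_less)
qed

definition char_factor :: "int \<Rightarrow> 'm + 'n \<Rightarrow> ('k::field_char_0, 'm::finite, 'n::finite) gl" where
  "char_factor a i = cc i i ^ nat a * ss i i ^ nat (- a)"

lemma char_factor_commute: "char_factor a i * f = f * char_factor a i"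
proof -
  have c: "cc i i ^ n * f = f * cc i i ^ n" "ss i i ^ n * f = f * ss i i ^ n" for n f
    by (rule central_power, rule diag_commute)+
  show ?thesis unfolding char_factor_def mult.assoc c(2)[of _ f] unfolding mult.assoc[symmetric] c(1)[of _ f] ..
qed

text \<open>On B^- the functions c_ii and s_ii are inverse to each other. The four cases arise
  because \<open>char_factor\<close> uses one or the other according to the sign of the
  exponent.\<close>

lemma char_factor_step:
  "gl_ent t i i * char_factor a i - char_factor (a + (if t then 1 else -1)) i
    \<in> (borel_ideal :: ('k::field_char_0, 'm::{finite, linorder}, 'n::{finite, linorder}) gl set)"
proof -
  have unit: "cc i i * (ss i i * f) - f \<in> (borel_ideal :: ('k, 'm, 'n) gl set)" "ss i i * (cc i i * f) - f \<in> (borel_ideal :: ('k, 'm, 'n) gl set)" for f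
    using borel.cong_rmult[OF borel.diag_unit[of i], of f] diag_commute(1)[of i "ss i i :: ('k, 'm, 'n) gl"]
    by (simp_all flip: mult.assoc)
  consider (up) "t" "a \<ge> 0" | (updown) "t" "a < 0" | (down) "\<not> t" "a \<le> 0" | (downup) "\<not> t" "a > 0" by linarith
  then show ?thesis
  proof cases
    case up
    then have "nat (a + 1) = Suc (nat a)" "nat (- a) = 0" "nat (- (a + 1)) = 0" by auto
    with up show ?thesis by (simp add: char_factor_def borel.zero)
  next
    case updown
    define n where "n = nat (- a - 1)"
    from updown have "nat (- a) = Suc n" "nat (- (a + 1)) = n" "nat a = 0" "nat (a + 1) = 0" by (auto simp: n_def)
    with updown show ?thesis using unit(1)[of "ss i i ^ n"] by (simp add: char_factor_def)
  next
    case down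
    then have "nat (- (a - 1)) = Suc (nat (- a))" "nat a = 0" "nat (a - 1) = 0" by auto
    with down show ?thesis by (simp add: char_factor_def borel.zero gl_ent_diag del: gl_ent.simps)
  next
    case downup
    define n where "n = nat (a - 1)"
    from downup have "nat a = Suc n" "nat (- a) = 0" "nat (- (a - 1)) = 0" by (auto simp: n_def)
    with downup show ?thesis using unit(2)[of "cc i i ^ n"] by (simp add: char_factor_def gl_ent_diag n_def del: gl_ent.simps)
  qed
qed

lemma prod_list_char_step:
  assumes "distinct xs" "i \<in> set xs"
  shows "gl_ent t i i * prod_list (map (\<lambda>k. char_factor (\<mu> k) k) xs)
      - prod_list (map (\<lambda>k. char_factor ((\<mu> + letter_weight t i) k) k) xs)
    \<in> (borel_ideal :: ('k::field_char_0, 'm::{finite, linorder}, 'n::{finite, linorder}) gl set)"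
  using assms
proof (induction xs)
  case (Cons k xs)
  let ?\<mu>' = "\<mu> + letter_weight t i"
  let ?R = "\<lambda>\<mu>. prod_list (map (\<lambda>k. char_factor (\<mu> k) k) xs) :: ('k, 'm, 'n) gl"
  have other: "?\<mu>' l = \<mu> l" if "l \<noteq> i" for l using that by (simp add: letter_weight_def unit_weight_def)
  show ?case
  proof (cases "k = i")
    case True
    with Cons.prems have "?R ?\<mu>' = ?R \<mu>"
      by (intro arg_cong[of _ _ prod_list] map_cong refl arg_cong2[of _ _ _ _ char_factor] other) auto
    moreover have "?\<mu>' i = \<mu> i + (if t then 1 else -1)" by (simp add: letter_weight_def unit_weight_def)
    ultimately show ?thesis
      using True borel.cong_rmult[OF char_factor_step[of t i "\<mu> i"], of "?R \<mu>"]
      by (simp add: mult.assoc del: gl_ent.simps plus_fun_apply)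
  next
    case False
    with Cons have IH: "gl_ent t i i * ?R \<mu> - ?R ?\<mu>' \<in> borel_ideal" by auto
    have "gl_ent t i i * (char_factor (\<mu> k) k * ?R \<mu>) = char_factor (\<mu> k) k * (gl_ent t i i * ?R \<mu>)"
      unfolding mult.assoc[symmetric] char_factor_commute[of "\<mu> k" k "gl_ent t i i"] ..
    then show ?thesis
      using borel.cong_lmult[OF IH, of "char_factor (\<mu> k) k"] other[OF False]
      by (simp del: gl_ent.simps plus_fun_apply)
  qed
qed simp

lemma index_list_props: "distinct (index_list :: ('m::{finite, linorder} + 'n::{finite, linorder}) list)"
  "i \<in> set (index_list :: ('m + 'n) list)"
  by (auto simp: index_list_def distinct_map inj_on_def) (cases i; simp)

lemma weight_character_step:
  "gl_ent t i i * weight_character \<mu> - weight_character (\<mu> + letter_weight t i)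
    \<in> (borel_ideal :: ('k::field_char_0, 'm::{finite, linorder}, 'n::{finite, linorder}) gl set)"
  using prod_list_char_step[OF index_list_props, of t i \<mu>]
  unfolding weight_character_def char_factor_def .

lemma mcoef_diag_character:
  assumes "length is = length ts"
  shows "mcoef ts is is - weight_character (weight_of ts is)
    \<in> (borel_ideal :: ('k::field_char_0, 'm::{finite, linorder}, 'n::{finite, linorder}) gl set)"
  using assms
proof (induction ts arbitrary: "is")
  case Nil
  have "prod_list (map (\<lambda>_. 1) xs) = (1 :: ('k, 'm, 'n) gl)" for xs :: "('m + 'n) list" by (induction xs) auto
  with Nil show ?case by (simp add: weight_character_def borel.zero)
next
  case (Cons t ts)
  then obtain i is' where i: "is = i # is'" "length is' = length ts" by (cases "is") auto
  have "gl_ent t i i * mcoef ts is' is' - gl_ent t i i * weight_character (weight_of ts is') \<in> (borel_ideal :: ('k, 'm, 'n) gl set)"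
    by (rule borel.cong_lmult[OF Cons.IH[OF i(2)]])
  from borel.cong_trans[OF this weight_character_step] show ?case
    unfolding i(1) mcoef_diag_Cons weight_of.simps by (simp only: add.commute)
qed

section \<open>Highest weights and the socle of $H^0_-(\lambda)$\<close>

lemma subsupermodule_section:
  assumes "simple_section N1 N2"
  shows "act_closed N1" "act_closed N2" "N1 \<subseteq> N2" "N1 \<noteq> N2"
    "act_closed N \<Longrightarrow> N1 \<subseteq> N \<Longrightarrow> N \<subseteq> N2 \<Longrightarrow> N = N1 \<or> N = N2"
  using assms unfolding simple_section_def subsupermodule_iff by auto

text \<open>Only finitely many weights occur in \<open>N2\<close> modulo \<open>N1\<close>, so one of them has maximal height.\<close>

lemma top_weight:
  fixes hgt :: "('m::finite, 'n::finite) weight \<Rightarrow> int" and N1 N2 :: "('k::field_char_0, 'm, 'n) gl set"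
  assumes "simple_section N1 N2"
  obtains \<mu> f where "f \<in> N2" "wproj {\<mu>} f \<notin> N1" "\<And>g. g \<in> N2 \<Longrightarrow> wproj {\<nu>. hgt \<mu> < hgt \<nu>} g \<in> N1"
proof -
  note N = subsupermodule_section[OF assms]
  obtain f where f: "f \<in> N2" "f \<notin> N1" using N(3,4) by blast
  obtain r where r: "f \<in> gl.span (mcoef_upto r)" using in_span_mcoef_upto by blast
  let ?F = "N2 \<inter> gl.span (mcoef_upto r)"
  \<comment> \<open>A subsupermodule between N1 and N2 and larger than N1, hence all of N2. So every
    class of N2/N1 has a representative in a fixed finite-dimensional space.\<close>
  let ?N = "{n + h | n h. n \<in> N1 \<and> h \<in> ?F}"
  have cl: "act_closed ?N"
    by (intro act_closed_sums act_closed_Int act_closed_mcoef_upto N)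
  have sub1: "N1 \<subseteq> ?N"
  proof
    fix n assume "n \<in> N1"
    moreover have "0 \<in> ?F" using act_closedD(8)[OF N(2)] gl.span_zero by blast
    ultimately have "n + 0 \<in> ?N" by blast
    then show "n \<in> ?N" by simp
  qed
  have sub2: "?N \<subseteq> N2"
  proof
    fix x assume "x \<in> ?N"
    then obtain n h where "x = n + h" "n \<in> N1" "h \<in> ?F" by (elim CollectE exE conjE) (rule that)
    then show "x \<in> N2" using act_closedD(5)[OF N(2)] N(3) by auto
  qed
  have "0 + f \<in> ?N" using act_closedD(8)[OF N(1)] f r by blast
  then have fN: "f \<in> ?N" by simp
  have "?N = N1 \<or> ?N = N2" by (rule N(5)[OF cl sub1 sub2])
  moreover have "?N \<noteq> N1"
  proof
    assume "?N = N1"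
    then show False using fN f(2) by (simp only:)
  qed
  ultimately have NN: "?N = N2" by (simp only: simp_thms)
  obtain A where A: "finite A" "\<And>h :: ('k, 'm, 'n) gl. h \<in> gl.span (mcoef_upto r) \<Longrightarrow> wproj A h = h"
    using span_mcoef_upto_weights[of r] by blast
  have decomp: "\<exists>n h. g = n + h \<and> n \<in> N1 \<and> h \<in> N2 \<and> wproj A h = h" if "g \<in> N2" for g
  proof -
    from that have "g \<in> ?N" unfolding NN .
    then obtain n h where "g = n + h" "n \<in> N1" "h \<in> ?F" by (elim CollectE exE conjE) (rule that)
    then show ?thesis using A(2)[of h] by blast
  qed
  \<comment> \<open>The weights of the quotient N2/N1.\<close>
  define Wt where "Wt = {\<nu>. \<exists>g\<in>N2. wproj {\<nu>} g \<notin> N1}"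
  have proj: "wproj B g \<in> N1" if gN: "g \<in> N2" "B \<inter> Wt = {}" for B g
  proof -
    obtain n h where n: "g = n + h" "n \<in> N1" "h \<in> N2" "wproj A h = h" using decomp[OF gN(1)] by blast
    have "wproj B h = wproj (B \<inter> A) h" using wproj_wproj[of B A h] unfolding n(4) .
    also have "\<dots> = (\<Sum>x\<in>B \<inter> A. wproj {x} h)" by (rule wproj_sum) (use A(1) in simp)
    also have "\<dots> \<in> N1"
      using gN(2) n(3) by (intro gl.subspace_sum act_closedD(1) N) (auto simp: Wt_def)
    finally have h: "wproj B h \<in> N1" .
    show ?thesis
      unfolding n(1) linearD(1)[OF wact_linear]
      by (rule act_closedD(5)[OF N(1) act_closedD(4)[OF N(1) n(2)] h])
  qed
  have "Wt \<subseteq> A"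
  proof
    fix \<nu> assume "\<nu> \<in> Wt"
    then obtain g where g: "g \<in> N2" "wproj {\<nu>} g \<notin> N1" unfolding Wt_def by blast
    obtain n h where n: "g = n + h" "n \<in> N1" "h \<in> N2" "wproj A h = h" using decomp[OF g(1)] by blast
    show "\<nu> \<in> A"
    proof (rule ccontr)
      assume "\<nu> \<notin> A"
      then have "{\<nu>} \<inter> A = {}" by simp
      then have "wproj {\<nu>} h = 0" using wproj_wproj[of "{\<nu>}" A h] unfolding n(4) by (simp add: wact_zero)
      then have "wproj {\<nu>} g = wproj {\<nu>} n" unfolding n(1) linearD(1)[OF wact_linear] by simp
      then show False using g(2) act_closedD(4)[OF N(1) n(2)] by simp
    qed
  qed
  then have fin: "finite Wt" using A(1) by (rule finite_subset)
  have "Wt \<noteq> {}"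
  proof
    assume "Wt = {}"
    then have "wproj UNIV f \<in> N1" by (intro proj f(1)) simp
    then show False using f(2) by (simp add: wact_one)
  qed
  then have "Max (hgt ` Wt) \<in> hgt ` Wt" using fin by (intro Max_in) auto
  then obtain \<mu> where \<mu>: "\<mu> \<in> Wt" "hgt \<mu> = Max (hgt ` Wt)" by auto
  then obtain g where g: "g \<in> N2" "wproj {\<mu>} g \<notin> N1" unfolding Wt_def by blast
  have "wproj {\<nu>. hgt \<mu> < hgt \<nu>} h \<in> N1" if "h \<in> N2" for h
  proof (rule proj[OF that])
    have "hgt \<nu> \<le> hgt \<mu>" if "\<nu> \<in> Wt" for \<nu> unfolding \<mu>(2) using that fin by (intro Max_ge) auto
    then show "{\<nu>. hgt \<mu> < hgt \<nu>} \<inter> Wt = {}" by force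
  qed
  with g show ?thesis using that by blast
qed

section \<open>Convolution along the big cell\<close>

lemma fps_iota_vector_space: "vector_space (\<lambda>c x. fps_iota c * x)"
proof -
  interpret free_eval_hom fps_iota by (rule fps_iota_hom)
  show ?thesis by standard (simp_all only: iota_add iota_mult iota_one distrib_left distrib_right mult.assoc mult_1_left)
qed

text \<open>Convolution is formed for arbitrary linear maps rather than points, since points will be
  composed with weight projections, which are not multiplicative.\<close>

definition fps_conv :: "(('k, 'm, 'n) gl \<Rightarrow> ('k, 'm, 'n) gl fps) \<Rightarrow> (('k, 'm, 'n) gl \<Rightarrow> ('k, 'm, 'n) gl fps)
    \<Rightarrow> ('k::field_char_0, 'm::finite, 'n::finite) gl \<Rightarrow> ('k, 'm, 'n) gl fps" where
  "fps_conv \<beta> \<upsilon> f = tensor_lift (\<lambda>c x. fps_iota c * x) (\<lambda>a b. \<beta> a * \<upsilon> b) (gl_delta f)"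

context
  fixes \<beta> \<upsilon> :: "('k::field_char_0, 'm::finite, 'n::finite) gl \<Rightarrow> ('k, 'm, 'n) gl fps"
  assumes lin: "Vector_Spaces.linear gl_scale (\<lambda>c x. fps_iota c * x) \<beta>" "Vector_Spaces.linear gl_scale (\<lambda>c x. fps_iota c * x) \<upsilon>"
begin

lemma fps_conv_bilinear: "gl_bilinear (\<lambda>c x. fps_iota c * x) (\<lambda>a b. \<beta> a * \<upsilon> b)"
proof -
  interpret free_eval_hom fps_iota by (rule fps_iota_hom)
  have "\<beta> a * (fps_iota c * \<upsilon> b) = fps_iota c * (\<beta> a * \<upsilon> b)" for a b c
    unfolding mult.assoc[symmetric] iota_central[of c "\<beta> a"] ..
  then show ?thesis
    unfolding gl_bilinear_def
    by (intro conjI allI linearI gl.vector_space_axioms fps_iota_vector_space)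
      (simp_all only: linearD[OF lin(1)] linearD[OF lin(2)] distrib_left distrib_right mult.assoc)
qed

lemmas fps_conv_lift = tensor_lift_tens[OF fps_iota_vector_space fps_conv_bilinear]
  tensor_lift_linear[OF fps_iota_vector_space fps_conv_bilinear]

lemma fps_conv_linear: "Vector_Spaces.linear gl_scale (\<lambda>c x. fps_iota c * x) (fps_conv \<beta> \<upsilon>)"
  unfolding fps_conv_def by (rule linear_compose[OF gl_delta_linear fps_conv_lift(2)])

lemma fps_conv_mcoef:
  "fps_conv \<beta> \<upsilon> (mcoef ts is js) = (\<Sum>ks\<in>idx (length ts). \<beta> (mcoef ts is ks) * \<upsilon> (mcoef ts ks js))"
  unfolding fps_conv_def gl_delta_mcoef_sum linearD(6)[OF fps_conv_lift(2)] fps_conv_lift(1) ..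

lemma fps_conv_eq_0:
  assumes "subsupermodule S" "\<And>a. a \<in> S \<Longrightarrow> \<beta> a = 0" "v \<in> S"
  shows "fps_conv \<beta> \<upsilon> v = 0"
proof -
  have "gl_delta v \<in> gl2.span {tens a b | a b. a \<in> S}"
    using assms(1,3) unfolding subsupermodule_def by blast
  then show ?thesis
    unfolding fps_conv_def
  proof (induction rule: gl2.span_induct_alt)
    case base
    show ?case by (rule linearD(3)[OF fps_conv_lift(2)])
  next
    case (step c x y)
    then obtain a b where "x = tens a b" "a \<in> S" by (elim CollectE exE conjE) (rule that)
    then show ?case by (simp only: linearD[OF fps_conv_lift(2)] fps_conv_lift(1) assms(2) step) simp
  qed
qed

end

lemma fps_conv_add:
  assumes "Vector_Spaces.linear gl_scale (\<lambda>c x. fps_iota c * x) \<beta>1" "Vector_Spaces.linear gl_scale (\<lambda>c x. fps_iota c * x) \<beta>2"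
    "Vector_Spaces.linear gl_scale (\<lambda>c x. fps_iota c * x) \<upsilon>" "\<And>a. \<beta> a = \<beta>1 a + \<beta>2 a"
  shows "fps_conv \<beta> \<upsilon> f = fps_conv \<beta>1 \<upsilon> f + fps_conv \<beta>2 \<upsilon> f"
proof -
  have "(\<lambda>a b. \<beta> a * \<upsilon> b) = (\<lambda>a b. \<beta>1 a * \<upsilon> b + \<beta>2 a * \<upsilon> b)" by (simp add: assms(4) distrib_right)
  then show ?thesis unfolding fps_conv_def by (simp only: tensor_lift_param(1)[OF fps_iota_vector_space])
qed

text \<open>On a vector \<^term>\<open>v\<close> of maximal weight the unipotent factor of the big cell acts trivially.\<close>

lemma top_vector_point:
  fixes r :: "'m::finite + 'n::finite \<Rightarrow> int" and v :: "('k::field_char_0, 'm, 'n) gl"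
    and g b u :: "('m, 'n) gen \<Rightarrow> ('k, 'm, 'n) gl fps"
  assumes g: "gl_point fps_iota g" and b: "gl_point fps_iota b" and u: "gl_point fps_iota u"
    and tri: "\<And>i j. r j < r i \<Longrightarrow> u (Cgen i j) = 0" "\<And>i. u (Cgen i i) = 1" and r: "inj r"
    and gbu: "\<And>ts is js. length is = length ts \<Longrightarrow> length js = length ts \<Longrightarrow> gl_point.point fps_iota g (mcoef ts is js)
      = (\<Sum>ks\<in>idx (length ts). gl_point.point fps_iota b (mcoef ts is ks) * gl_point.point fps_iota u (mcoef ts ks js))"
    and S: "subsupermodule S" "v \<in> S" "wproj {\<mu>} v = v" "\<And>x. x \<in> S \<Longrightarrow> wproj {\<nu>. height r \<mu> < height r \<nu>} x = 0"
  shows "gl_point.point fps_iota g v = gl_point.point fps_iota b v"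
proof -
  interpret g: gl_point fps_iota g by (rule g)
  interpret b: gl_point fps_iota b by (rule b)
  interpret u: gl_point fps_iota u by (rule u)
  \<comment> \<open>u is upper unipotent, so its kernel is triangular for the reversed order, and
    height comparisons reverse too.\<close>
  let ?K = "{f. u.point f = 0}"
  interpret K: triangular_ideal ?K "\<lambda>i. - r i"
  proof
    show "inj (\<lambda>i. - r i)" using r by (simp add: inj_def)
    show "cc i j \<in> ?K" if "- r i < - r j" for i j using tri(1)[of j i] that by (simp add: u.point_simps)
  qed (simp_all add: u.point_simps)
  have uss: "u (Sgen i i) = 1" for i
    using K.diag_unit[of i] tri(2) by (simp add: u.point_simps)
  have udiag: "u.point (mcoef ts js js) = 1" if "length js = length ts" for ts js
    using that
  proof (induction ts arbitrary: js)
    case (Cons t ts)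
    then obtain j js' where "js = j # js'" "length js' = length ts" by (cases js) auto
    with Cons show ?case
      by (cases t) (simp_all add: u.point_simps tri(2) uss gl_ent_diag del: gl_ent.simps(2) mcoef.simps(2) add: mcoef_diag_Cons)
  qed (simp add: u.point_simps)
  let ?A = "{\<nu>. height r \<mu> < height r \<nu>}"
  have lin: "Vector_Spaces.linear gl_scale (\<lambda>c x. fps_iota c * x) (\<lambda>f. b.point (wproj B f))" for B
    by (rule linear_compose[OF wact_linear b.point_linear])
  have "g.point v = fps_conv b.point u.point v"
    by (rule linear_eq_on_mcoef[OF g.point_linear fps_conv_linear[OF b.point_linear u.point_linear]])
      (simp only: gbu fps_conv_mcoef[OF b.point_linear u.point_linear])
  \<comment> \<open>The convolution is split by the height of the intermediate weight. Above \<mu>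
    the first factor vanishes on S. At or below \<mu> the value of u vanishes unless the
    intermediate index is the column index, where it is 1.\<close>
  also have "\<dots> = fps_conv (\<lambda>f. b.point (wproj ?A f)) u.point v + fps_conv (\<lambda>f. b.point (wproj (- ?A) f)) u.point v"
  proof (rule fps_conv_add[OF lin lin u.point_linear])
    show "b.point a = b.point (wproj ?A a) + b.point (wproj (- ?A) a)" for a
      unfolding b.point_simps(1)[symmetric] wproj_compl[of a ?A, symmetric] ..
  qed
  also have "fps_conv (\<lambda>f. b.point (wproj ?A f)) u.point v = 0"
    by (rule fps_conv_eq_0[OF lin u.point_linear S(1) _ S(2)]) (simp only: S(4) b.point_simps)
  also have "fps_conv (\<lambda>f. b.point (wproj (- ?A) f)) u.point v = b.point v"
    using S(3)
  proof (induction rule: wproj_single_induct)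
    case (mcoef ts "is" js)
    have "b.point (wproj (- ?A) (mcoef ts is ks)) * u.point (mcoef ts ks js)
        = (if ks = js then b.point (mcoef ts is js) else 0)" if ks: "ks \<in> idx (length ts)" for ks
    proof (cases "ks = js")
      case True
      have "weight_of ts js \<in> - ?A" unfolding mcoef(3) by simp
      with True show ?thesis by (simp add: wact_mcoef udiag mcoef(2))
    next
      case False
      have l: "length ks = length ts" using ks by (simp add: idx_def)
      from K.mcoef_triangular[OF l mcoef(2)] False
      consider "u.point (mcoef ts ks js) = 0" | "height r (weight_of ts js) < height r (weight_of ts ks)"
        by (auto simp: height_uminus)
      then show ?thesis
      proof cases
        case 2
        then have "weight_of ts ks \<notin> - ?A" unfolding mcoef(3) by simp
        with False show ?thesis by (simp add: wact_mcoef b.point_simps)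
      qed (simp add: False)
    qed
    then have "fps_conv (\<lambda>f. b.point (wproj (- ?A) f)) u.point (mcoef ts is js)
        = (\<Sum>ks\<in>idx (length ts). if ks = js then b.point (mcoef ts is js) else 0)"
      unfolding fps_conv_mcoef[OF lin u.point_linear] by (intro sum.cong refl)
    then show ?case using mcoef(2) unfolding sum.delta[OF finite_idx] by (simp add: idx_def)
  qed (simp_all only: linearD[OF fps_conv_linear[OF lin u.point_linear]] b.point_simps)
  finally show ?thesis by simp
qed

text \<open>Apply id \<otimes> \<epsilon> to the defining congruence: on B^- an element of the
  induced supermodule is a multiple of the character.\<close>

lemma H0_minus_borel:
  assumes "f \<in> H0_minus \<mu>"
  shows "f - gl_scale (gl_eps f) (weight_character \<mu>) \<in> borel_ideal"
proof -
  note lin = linearD[OF slice_right_linear[OF gl_eps_functional]]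
  have "slice_right gl_eps t \<in> borel_ideal" if "t \<in> gl2.span {tens a b | a b. a \<in> borel_ideal}" for t
    by (rule slice_right_in_subspace[OF borel.subspace gl_eps_functional that])
  then have "slice_right gl_eps (gl_delta f - tens (weight_character \<mu>) f) \<in> borel_ideal"
    using assms unfolding H0_minus_def by blast
  then show ?thesis
    unfolding lin slice_tens[OF gl_eps_functional] right_act_def[symmetric] act_eps .
qed

lemma borel_ideal_point:
  assumes "gl_point fps_iota b" "\<And>i j. index_less i j \<Longrightarrow> b (Cgen i j) = 0" "f \<in> borel_ideal"
  shows "gl_point.point fps_iota b f = 0"
proof -
  interpret gl_point fps_iota b by fact
  show ?thesis
    using assms(3) unfolding borel_ideal_def
    by induction (auto simp: point_simps assms(2))
qed

text \<open>A top vector v satisfies g(v) = b(v), and b kills the ideal of B^-. As g is injective, v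
  is determined by its restriction to B^-, which is \<epsilon>(v) times the character. Top vectors
  of S1 and S2 are therefore proportional.\<close>

lemma simple_sub_H0_unique:
  fixes S1 S2 :: "('k::field_char_0, 'm::{finite, linorder}, 'n::{finite, linorder}) gl set"
  assumes S1: "simple_section {0} S1" "S1 \<subseteq> H0_minus \<mu>" and S2: "simple_section {0} S2" "S2 \<subseteq> H0_minus \<mu>"
  shows "S1 = S2"
proof -
  obtain g b u :: "('m, 'n) gen \<Rightarrow> ('k, 'm, 'n) gl fps" where
    p: "gl_point fps_iota g" "gl_point fps_iota b" "gl_point fps_iota u"
    and gc: "\<And>i j. g (Cgen i j) = fps_entry generic_curve i j"
    and bt: "\<And>i j. index_rank i < index_rank j \<Longrightarrow> b (Cgen i j) = 0"
    and ut: "\<And>i j. index_rank j < index_rank i \<Longrightarrow> u (Cgen i j) = 0" "\<And>i. u (Cgen i i) = 1"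
    and gbu: "\<And>ts is js. length is = length ts \<Longrightarrow> length js = length ts \<Longrightarrow> gl_point.point fps_iota g (mcoef ts is js)
      = (\<Sum>ks\<in>idx (length ts). gl_point.point fps_iota b (mcoef ts is ks) * gl_point.point fps_iota u (mcoef ts ks js))"
    by (rule big_cell_points[of index_rank]) (rule that)
  interpret g: gl_point fps_iota g by (rule p)
  interpret b: gl_point fps_iota b by (rule p)
  have b0: "b.point f = 0" if "f \<in> borel_ideal" for f
    by (rule borel_ideal_point[OF p(2) _ that]) (rule bt, simp add: index_rank_less)
  have top: "\<exists>v\<in>S. v \<noteq> 0 \<and> g.point v = b.point v" if S: "simple_section {0} S" for S
  proof -
    obtain \<nu> f where f: "f \<in> S" "wproj {\<nu>} f \<notin> {0}" "\<And>x. x \<in> S \<Longrightarrow> wproj {\<kappa>. height index_rank \<nu> < height index_rank \<kappa>} x \<in> {0}"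
      by (rule top_weight[OF S, of "height index_rank"]) (rule that)
    have wS: "wproj {\<nu>} f \<in> S" by (rule act_closedD(4)[OF subsupermodule_section(2)[OF S] f(1)])
    have "subsupermodule S" using S unfolding simple_section_def by blast
    moreover have "wproj {\<nu>} (wproj {\<nu>} f) = wproj {\<nu>} f" unfolding wproj_wproj Int_absorb ..
    moreover have "wproj {\<kappa>. height index_rank \<nu> < height index_rank \<kappa>} x = 0" if "x \<in> S" for x
      using f(3)[OF that] unfolding singleton_iff .
    ultimately have "g.point (wproj {\<nu>} f) = b.point (wproj {\<nu>} f)"
      by (intro top_vector_point[OF p ut inj_index_rank gbu, of S _ \<nu>] wS)
    then show ?thesis using wS f(2) by blast
  qed
  have inj0: "f = 0" if "g.point f = b.point f" "f \<in> borel_ideal" for f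
    by (rule generic_curve_inj[OF p(1) gc]) (simp add: that b0)
  obtain v1 where v1: "v1 \<in> S1" "v1 \<noteq> 0" "g.point v1 = b.point v1" using top[OF S1(1)] by blast
  obtain v2 where v2: "v2 \<in> S2" "v2 \<noteq> 0" "g.point v2 = b.point v2" using top[OF S2(1)] by blast
  let ?\<chi> = "weight_character \<mu> :: ('k, 'm, 'n) gl"
  have h1: "v1 - gl_scale (gl_eps v1) ?\<chi> \<in> borel_ideal" using v1(1) S1(2) by (intro H0_minus_borel) blast
  have h2: "v2 - gl_scale (gl_eps v2) ?\<chi> \<in> borel_ideal" using v2(1) S2(2) by (intro H0_minus_borel) blast
  \<comment> \<open>If \<epsilon>(v2) were 0, then v2 itself would lie in the ideal of B^- and
    vanish.\<close>
  have e2: "gl_eps v2 \<noteq> 0" using inj0[OF v2(3)] h2 v2(2) by auto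
  define c where "c = gl_eps v1 / gl_eps v2"
  have "v1 - gl_scale c v2 = (v1 - gl_scale (gl_eps v1) ?\<chi>) - gl_scale c (v2 - gl_scale (gl_eps v2) ?\<chi>)"
    using e2 by (simp add: gl.scale_right_diff_distrib c_def)
  then have "v1 - gl_scale c v2 \<in> borel_ideal"
    using borel.diff[OF h1 borel.scale[OF h2]] by (rule ssubst)
  moreover have "g.point (v1 - gl_scale c v2) = b.point (v1 - gl_scale c v2)"
    by (simp add: g.point_simps b.point_simps v1 v2)
  ultimately have "v1 - gl_scale c v2 = 0" by (intro inj0)
  then have v12: "v1 = gl_scale c v2" by simp
  note N1 = subsupermodule_section[OF S1(1)] and N2 = subsupermodule_section[OF S2(1)]
  have "v1 \<in> S1 \<inter> S2" using v1(1) act_closedD(7)[OF N2(2) v2(1), of c] v12 by simp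
  then have ne: "S1 \<inter> S2 \<noteq> {0}" using v1(2) by blast
  have cl: "act_closed (S1 \<inter> S2)" by (intro act_closed_Int N1(2) N2(2))
  have "{0} \<subseteq> S1 \<inter> S2" using act_closedD(8)[OF cl] by simp
  then have "S1 \<inter> S2 = S1" "S1 \<inter> S2 = S2" using N1(5)[OF cl] N2(5)[OF cl] ne by auto
  then show ?thesis by simp
qed

text \<open>The socle is spanned by the simple subsupermodules, and uniqueness leaves only one;
  exhibiting any simple subsupermodule of the induced supermodule thus identifies L_-.\<close>

lemma L_minus_eqI:
  assumes "simple_section {0} S" "S \<subseteq> H0_minus \<mu>"
  shows "L_minus \<mu> = S"
proof -
  have "{N. simple_section {0} N \<and> N \<subseteq> H0_minus \<mu>} = {S}"
    using assms simple_sub_H0_unique[OF _ _ assms] by blast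
  then show ?thesis
    unfolding L_minus_def gl_socle_def
    using act_closedD(1)[OF subsupermodule_section(2)[OF assms(1)]] by (simp add: gl.span_eq_iff)
qed

section \<open>Classification of the simple sections\<close>

fun perm_gen :: "('m + 'n \<Rightarrow> 'm + 'n) \<Rightarrow> ('m, 'n) gen \<Rightarrow> 'k::field_char_0" where
  "perm_gen \<sigma> (Cgen i j) = of_bool (i = \<sigma> j)"
| "perm_gen \<sigma> (Sgen i j) = of_bool (i = \<sigma> j)"

text \<open>\<sigma> preserves parity, so its permutation matrix is a K-point; as an involution it
  is its own inverse, whence the equal formulas for both kinds of generators. Right translation by
  it permutes the weights.\<close>

locale even_involution =
  fixes \<sigma> :: "'m::finite + 'n::finite \<Rightarrow> 'm + 'n" and K :: "'k::field_char_0 itself"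
  assumes invol: "\<sigma> (\<sigma> i) = i" and even: "odd_index (\<sigma> i) = odd_index i"
begin

lemma eq_iff: "i = \<sigma> j \<longleftrightarrow> j = \<sigma> i"
  using invol by metis

sublocale gl_point "\<lambda>c::'k. c" "perm_gen \<sigma>"
proof -
  interpret free_eval_hom "\<lambda>c::'k. c" by (rule eps_hom)
  have odd: "perm_gen \<sigma> x = (0 :: 'k)" if "gen_par x" for x
    using that even by (cases x) auto
  have inv: "(\<Sum>k\<in>UNIV. of_bool (i = \<sigma> k) * of_bool (k = \<sigma> j)) = (of_bool (i = j) :: 'k)" for i j
    using sum_of_bool_mult(2)[of "\<lambda>k. of_bool (i = \<sigma> k) :: 'k" "\<sigma> j"] by (simp add: invol)
  show "gl_point (\<lambda>c::'k. c) (perm_gen \<sigma>)"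
    by unfold_locales (auto simp: odd inv ksign_def mult.commute simp del: sum_mult_of_bool_eq sum_of_bool_mult_eq)
qed

lemma point_ent: "point (gl_ent t i j) = of_bool (i = \<sigma> j)"
  using eq_iff[of i j] even by (cases t) (auto simp: point_simps ksign_def)

lemma point_mcoef:
  "point (mcoef ts is js) = of_bool (is = map \<sigma> js \<and> length (map \<sigma> js) = length ts)"
proof (cases "length is = length ts \<and> length js = length ts")
  case False
  have "mcoef ts is js = (0 :: ('k, 'm, 'n) gl)" by (rule mcoef_mismatch[OF False])
  with False show ?thesis by (auto simp: point_simps)
next
  case True
  have par: "list_par (map \<sigma> js) = list_par js" for js by (induction js) (simp_all add: even)
  from True show ?thesis
    by (induction ts "is" js rule: mcoef.induct) (auto simp: point_simps point_ent par)
qed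

lemma point_functional: "gl_functional point"
  by (rule functional_intro) (simp_all add: point_simps)

definition flip :: "('k, 'm, 'n) gl \<Rightarrow> ('k, 'm, 'n) gl" where "flip = right_act point"

lemma flip_linear: "Vector_Spaces.linear gl_scale gl_scale flip"
  unfolding flip_def by (rule right_act_linear[OF point_functional])

lemma flip_mcoef: "flip (mcoef ts is js) = mcoef ts is (map \<sigma> js)"
proof -
  have "(\<Sum>ks\<in>idx (length ts). gl_scale (of_bool (ks = map \<sigma> js \<and> length (map \<sigma> js) = length ts) * 1) (mcoef ts is ks))
      = gl_scale 1 (mcoef ts is (map \<sigma> js) :: ('k, 'm, 'n) gl)"
    by (rule sum_idx_delta(1)) (rule mcoef_mismatch, simp)
  then show ?thesis
    unfolding flip_def right_act_mcoef[OF point_functional] point_mcoef mult_1_right gl.scale_one .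
qed

lemma weight_of_map: "weight_of ts (map \<sigma> js) = weight_of ts js \<circ> \<sigma>"
proof (induction ts js rule: weight_of.induct)
  case (1 t ts i "is")
  have "\<sigma> i = k \<longleftrightarrow> i = \<sigma> k" for k using invol by metis
  then have "letter_weight t (\<sigma> i) = letter_weight t i \<circ> \<sigma>"
    by (simp add: fun_eq_iff letter_weight_def unit_weight_def)
  with 1 show ?case by (auto simp: fun_eq_iff)
qed (auto simp: fun_eq_iff)

lemma flip_flip: "flip (flip f) = f"
proof (induction f rule: mcoef_induct)
  case (mcoef ts "is" js)
  have "map \<sigma> (map \<sigma> js) = js" by (simp add: invol o_def)
  then show ?case by (simp only: flip_mcoef)
qed (simp_all add: linearD[OF flip_linear])

lemma flip_wproj: "flip (wproj {\<mu>} f) = wproj {\<mu> \<circ> \<sigma>} (flip f)"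
proof (induction f rule: mcoef_induct)
  case (mcoef ts "is" js)
  have "weight_of ts js \<circ> \<sigma> = \<mu> \<circ> \<sigma> \<longleftrightarrow> weight_of ts js = \<mu>"
    using invol by (auto simp: fun_eq_iff) metis
  then show ?case
    by (simp only: wact_mcoef flip_mcoef linearD(2)[OF flip_linear] weight_of_map singleton_iff)
qed (simp_all only: linearD[OF flip_linear] linearD[OF wact_linear])

end

lemma height_swap:
  fixes r :: "'m::finite + 'n::finite \<Rightarrow> int"
  assumes "a \<noteq> b" "\<sigma> a = b" "\<sigma> b = a" "\<And>k. k \<noteq> a \<Longrightarrow> k \<noteq> b \<Longrightarrow> \<sigma> k = k"
  shows "height r (\<mu> \<circ> \<sigma>) - height r \<mu> = (r b - r a) * (\<mu> b - \<mu> a)"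
proof -
  have "height r \<mu> - height r (\<mu> \<circ> \<sigma>) = (\<Sum>k\<in>UNIV. r k * (\<mu> (\<sigma> k) - \<mu> k))"
    by (simp add: height_def right_diff_distrib sum_subtractf)
  also have "\<dots> = (\<Sum>k\<in>{a, b}. r k * (\<mu> (\<sigma> k) - \<mu> k))"
    using assms(4) by (intro sum.mono_neutral_right) auto
  also have "\<dots> = - (r b - r a) * (\<mu> b - \<mu> a)"
    using assms(1-3) by (simp add: algebra_simps)
  finally show ?thesis by (simp add: algebra_simps)
qed

text \<open>The weights of a section are permuted by transpositions of indices of equal parity, so a weight of maximal
  height is dominant.\<close>

lemma top_weight_swap:
  fixes N1 N2 :: "('k::field_char_0, 'm::{finite, linorder}, 'n::{finite, linorder}) gl set"
  assumes N: "act_closed N1" "act_closed N2" and f: "f \<in> N2" "wproj {\<mu>} f \<notin> N1"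
    and top: "\<And>g. g \<in> N2 \<Longrightarrow> wproj {\<nu>. height index_rank \<mu> < height index_rank \<nu>} g \<in> N1"
    and ab: "index_less a b" "odd_index a = odd_index b"
  shows "\<mu> b \<le> \<mu> a"
proof (rule ccontr)
  assume neg: "\<not> ?thesis"
  define \<sigma> where "\<sigma> k = (if k = a then b else if k = b then a else k)" for k
  interpret even_involution \<sigma> "TYPE('k)"
    by standard (auto simp: \<sigma>_def ab)
  have anb: "a \<noteq> b" using ab(1) index_less_order(1) by auto
  \<comment> \<open>If dominance fails at a and b, the swapped weight is strictly higher than \<mu>,
    so its component must lie in N1.\<close>
  have "height index_rank (\<mu> \<circ> \<sigma>) - height index_rank \<mu> = (index_rank b - index_rank a) * (\<mu> b - \<mu> a)"
    by (rule height_swap[OF anb]) (auto simp: \<sigma>_def)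
  also have "\<dots> > 0" using neg index_rank_mono[OF ab(1)] by simp
  finally have h: "\<mu> \<circ> \<sigma> \<in> {\<nu>. height index_rank \<mu> < height index_rank \<nu>}" by simp
  have fl: "flip g \<in> M" if "act_closed M" "g \<in> M" for g M
    unfolding flip_def by (rule act_closedD(3)[OF that(1) point_functional that(2)])
  have "wproj {\<mu> \<circ> \<sigma>} (wproj {\<nu>. height index_rank \<mu> < height index_rank \<nu>} (flip f)) \<in> N1"
    by (intro act_closedD(4)[OF N(1)] top fl N f)
  moreover have "{\<mu> \<circ> \<sigma>} \<inter> {\<nu>. height index_rank \<mu> < height index_rank \<nu>} = {\<mu> \<circ> \<sigma>}" using h by blast
  ultimately have "flip (wproj {\<mu>} f) \<in> N1" unfolding wproj_wproj flip_wproj by (simp only:)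
  from fl[OF N(1) this] show False using f(2) unfolding flip_flip by blast
qed

lemma top_weight_dominant:
  fixes N1 N2 :: "('k::field_char_0, 'm::{finite, linorder}, 'n::{finite, linorder}) gl set"
  assumes "act_closed N1" "act_closed N2" "f \<in> N2" "wproj {\<mu>} f \<notin> N1"
    "\<And>g. g \<in> N2 \<Longrightarrow> wproj {\<nu>. height index_rank \<mu> < height index_rank \<nu>} g \<in> N1"
  shows "\<mu> \<in> dominant_weights"
  unfolding dominant_weights_def
  using top_weight_swap[OF assms, of "Inl _" "Inl _"] top_weight_swap[OF assms, of "Inr _" "Inr _"] by auto

section \<open>Embedding sections into induced supermodules\<close>

lemma functional_exists:
  fixes w :: "('k::field_char_0, 'm::finite, 'n::finite) gl"
  assumes "gl.subspace N" "w \<notin> N"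
  obtains \<phi> where "gl_functional \<phi>" "\<And>f. f \<in> N \<Longrightarrow> \<phi> f = 0" "\<phi> w = 1"
proof -
  obtain B1 where B1: "B1 \<subseteq> N" "gl.independent B1" "N \<subseteq> gl.span B1"
    by (rule gl.maximal_independent_subset[of N])
  have "gl.span B1 \<subseteq> N" using B1(1) assms(1) by (rule gl.span_minimal)
  then have "w \<notin> gl.span B1" "w \<notin> B1" using assms(2) gl.span_base by auto
  then have ind: "gl.independent (insert w B1)" by (intro gl.independent_insertI B1)
  define B where "B = gl.extend_basis (insert w B1)"
  have B: "gl.independent B" "gl.span B = UNIV" "insert w B1 \<subseteq> B"
    unfolding B_def using gl.independent_extend_basis[OF ind] gl.span_extend_basis[OF ind] gl.extend_basis_superset[OF ind] by auto
  show ?thesis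
  proof
    let ?\<phi> = "\<lambda>v. gl.representation B v w"
    show lin: "gl_functional ?\<phi>"
      by (rule functional_intro) (simp_all add: gl.representation_add gl.representation_scale B)
    show "?\<phi> w = 1" using B by (simp add: gl.representation_basis)
    show "?\<phi> f = 0" if "f \<in> N" for f
    proof -
      have "f \<in> gl.span B1" using that B1(3) by blast
      then show ?thesis
      proof (induction rule: gl.span_induct_alt)
        case (step c x y)
        then have "x \<in> B" "x \<noteq> w" using B(3) \<open>w \<notin> B1\<close> by auto
        with step show ?case by (simp add: linearD[OF lin] gl.representation_basis[OF B(1)])
      qed (rule linearD(3)[OF lin])
    qed
  qed
qed

lemma slice_left_eq_0:
  assumes \<phi>: "gl_functional \<phi>" "\<And>a. a \<in> N \<Longrightarrow> \<phi> a = 0" and t: "t \<in> gl2.span {tens a b | a b. a \<in> N}"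
  shows "slice_left \<phi> t = 0"
  using t
proof (induction rule: gl2.span_induct_alt)
  case base
  show ?case by (rule linearD(3)[OF slice_left_linear[OF \<phi>(1)]])
next
  case (step c x y)
  then obtain a b where "x = tens a b" "a \<in> N" by (elim CollectE exE conjE) (rule that)
  then show ?case by (simp only: linearD[OF slice_left_linear[OF \<phi>(1)]] slice_tens[OF \<phi>(1)] \<phi>(2) step) simp
qed

text \<open>The left torus action transposes to the right weight action inside \<phi>. A functional
  supported in one right weight therefore produces functions of that left weight.\<close>

lemma left_torus_left_act:
  assumes \<phi>: "gl_functional \<phi>"
  shows "left_act (torus_fun h) (left_act \<phi> f) = left_act (\<lambda>f. \<phi> (wact h f)) f"
proof -
  have \<phi>h: "gl_functional (\<lambda>f. \<phi> (wact h f))" by (rule linear_compose[OF wact_linear \<phi>])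
  note l = linearD[OF left_act_linear[OF \<phi>]] linearD[OF left_act_linear[OF \<phi>h]] linearD[OF left_act_linear[OF torus_fun_functional]]
  show ?thesis
  proof (induction f rule: mcoef_induct)
    case (mcoef ts "is" js)
    show ?case
      unfolding left_act_mcoef[OF \<phi>] left_act_mcoef[OF \<phi>h] l left_torus_mcoef wact_mcoef linearD[OF \<phi>] gl.scale_scale
      by (intro sum.cong refl) (simp add: mult.commute)
  qed (simp_all only: l)
qed

text \<open>Functions of left weight \<^term>\<open>\<mu>\<close> and right weights of height at most that of \<^term>\<open>\<mu>\<close>
  restrict to multiples of a character on $B^-$.\<close>

lemma weight_restrict_borel:
  fixes f :: "('k::field_char_0, 'm::{finite, linorder}, 'n::{finite, linorder}) gl"
  assumes "left_act (torus_fun (\<lambda>x. of_bool (x \<in> {\<mu>}))) f = f" "wproj (- {\<nu>. height index_rank \<mu> < height index_rank \<nu>}) f = f"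
  shows "f - gl_scale (gl_eps f) (weight_character \<mu>) \<in> borel_ideal"
proof -
  let ?E = "- {\<nu>. height index_rank \<mu> < height index_rank \<nu>}"
  let ?L = "left_act (torus_fun (\<lambda>x. of_bool (x \<in> {\<mu>}))) :: ('k, 'm, 'n) gl \<Rightarrow> ('k, 'm, 'n) gl"
  have lin: "Vector_Spaces.linear gl_scale gl_scale (\<lambda>f. ?L (wproj ?E f))"
    by (rule linear_compose[OF wact_linear left_act_linear[OF torus_fun_functional]])
  have "?L (wproj ?E f) - gl_scale (gl_eps (?L (wproj ?E f))) (weight_character \<mu>) \<in> borel_ideal" for f
  proof (induction f rule: mcoef_induct)
    case (add f g)
    from borel.add[OF add] show ?case
      unfolding linearD(1)[OF lin] gl_eps_simps(1) gl.scale_left_distrib add_diff_add .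
  next
    case (scale c f)
    from borel.scale[OF scale, of c] show ?case
      unfolding linearD(2)[OF lin] gl_eps_simps(4) gl.scale_right_diff_distrib gl.scale_scale .
  next
    case (mcoef ts "is" js)
    let ?m = "mcoef ts is js :: ('k, 'm, 'n) gl"
    have "?L (wproj ?E ?m) = gl_scale (of_bool (weight_of ts is = \<mu> \<and> weight_of ts js \<in> ?E)) ?m"
      unfolding wact_mcoef linearD(2)[OF left_act_linear[OF torus_fun_functional]] left_torus_mcoef gl.scale_scale
      by (intro arg_cong2[of _ _ _ _ gl_scale]) auto
    moreover have "?m - gl_scale (gl_eps ?m) (weight_character \<mu>) \<in> borel_ideal"
      if "weight_of ts is = \<mu>" "weight_of ts js \<in> ?E"
    proof (cases "is = js")
      case True
      then show ?thesis using mcoef_diag_character[OF mcoef(1)] that(1) by (simp add: gl_eps_mcoef mcoef)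
    next
      case False
      with borel.mcoef_triangular[OF mcoef] that have "?m \<in> borel_ideal" by auto
      with False show ?thesis by (simp add: gl_eps_mcoef mcoef)
    qed
    ultimately show ?case
      by (cases "weight_of ts is = \<mu> \<and> weight_of ts js \<in> ?E") (auto simp: borel.zero gl_eps_simps linearD(3)[OF gl_eps_functional])
  qed
  from this[of f] show ?thesis unfolding assms .
qed

lemma subsupermodule_delta:
  "subsupermodule N \<Longrightarrow> a \<in> N \<Longrightarrow> gl_delta a \<in> gl2.span {tens x y | x y. x \<in> N}"
  unfolding subsupermodule_def by (elim conjE) (rule bspec)

text \<open>Frobenius reciprocity made explicit. \<phi> is a functional on N2/N1 supported in the
  highest weight \<mu> and in one parity, and \<theta> = (\<phi> \<otimes> id)\<Delta>. On B^- the
  function \<theta>(a) is \<phi>(a) times the character, which puts the image into H^0_-(\<mu>);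
  simplicity of the section controls kernel and image.\<close>

lemma simple_section_iso:
  fixes N1 N2 :: "('k::field_char_0, 'm::{finite, linorder}, 'n::{finite, linorder}) gl set"
  assumes sec: "simple_section N1 N2" and f: "f \<in> N2" "wproj {\<mu>} f \<notin> N1"
    and top: "\<And>g. g \<in> N2 \<Longrightarrow> wproj {\<nu>. height index_rank \<mu> < height index_rank \<nu>} g \<in> N1"
  shows "\<exists>p. section_iso p N1 N2 (L_minus \<mu>)"
proof -
  note N = subsupermodule_section[OF sec]
  note \<Delta>1 = subsupermodule_delta[OF N(1)[folded subsupermodule_iff]]
    and \<Delta>2 = subsupermodule_delta[OF N(2)[folded subsupermodule_iff]]
  \<comment> \<open>A homogeneous component survives modulo N1. Its parity p makes \<phi>
    homogeneous and decides between L_- and its parity shift.\<close>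
  have "\<exists>p. gl_part p (wproj {\<mu>} f) \<notin> N1"
  proof (rule ccontr)
    assume "\<not> ?thesis"
    then have "gl_part True (wproj {\<mu>} f) + gl_part False (wproj {\<mu>} f) \<in> N1" by (intro act_closedD(5)[OF N(1)]) auto
    then show False using f(2) by (simp add: gl_part_sum_parts)
  qed
  then obtain p where p: "gl_part p (wproj {\<mu>} f) \<notin> N1" ..
  define w where "w = gl_part p (wproj {\<mu>} f)"
  have w: "w \<in> N2" "w \<notin> N1" using p f(1) by (auto simp: w_def intro: act_closedD(2,4)[OF N(2)])
  obtain \<phi>0 where \<phi>0: "gl_functional \<phi>0" "\<And>a. a \<in> N1 \<Longrightarrow> \<phi>0 a = 0" "\<phi>0 w = 1"
    using functional_exists[OF act_closedD(1)[OF N(1)] w(2)] by blast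
  define \<phi> where "\<phi> a = \<phi>0 (gl_part p (wproj {\<mu>} a))" for a
  have \<phi>: "gl_functional \<phi>"
    unfolding \<phi>_def by (rule linear_compose[OF linear_compose[OF wact_linear gl_part_linear] \<phi>0(1)])
  have \<phi>_par: "\<phi> (gl_part (\<not> p) a) = 0" for a
    by (simp add: \<phi>_def wact_part gl_part_part linearD(3)[OF \<phi>0(1)])
  have \<phi>_wproj: "\<phi> (wproj B a) = (if \<mu> \<in> B then \<phi> a else 0)" for B a
  proof (cases "\<mu> \<in> B")
    case True
    then have "{\<mu>} \<inter> B = {\<mu>}" by auto
    with True show ?thesis unfolding \<phi>_def wproj_wproj by (simp only: if_True)
  next
    case False
    then have "{\<mu>} \<inter> B = {}" by auto
    with False show ?thesis unfolding \<phi>_def wproj_wproj by (simp add: wact_zero linearD(3)[OF \<phi>0(1)])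
  qed
  have \<phi>_N1: "\<phi> a = 0" if "a \<in> N1" for a
    unfolding \<phi>_def using that by (intro \<phi>0(2) act_closedD(2,4)[OF N(1)])
  have "\<phi> w = 1"
    unfolding \<phi>_def w_def wact_part wproj_wproj Int_absorb using \<phi>0(3) by (simp add: gl_part_part w_def)
  define \<theta> where "\<theta> = left_act \<phi>"
  have \<theta>: "Vector_Spaces.linear gl_scale gl_scale \<theta>" unfolding \<theta>_def by (rule left_act_linear[OF \<phi>])
  have \<theta>_N1: "\<theta> a = 0" if "a \<in> N1" for a
  proof -
    from slice_left_eq_0[OF \<phi> \<phi>_N1 \<Delta>1[OF that]] show ?thesis by (simp only: \<theta>_def left_act_def)
  qed
  have \<theta>_eps: "gl_eps (\<theta> a) = \<phi> a" for a unfolding \<theta>_def by (rule eps_act(2)[OF \<phi>])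
  have \<theta>_part: "\<theta> (gl_part q a) = gl_part (p \<noteq> q) (\<theta> a)" for q a
    unfolding \<theta>_def by (rule left_act_part[OF \<phi> \<phi>_par])
  have \<theta>_act: "right_act \<psi> (\<theta> a) = \<theta> (right_act \<psi> a)" if "gl_functional \<psi>" for \<psi> a
    unfolding \<theta>_def by (rule right_left_act_commute[OF that \<phi>])
  have \<theta>_borel: "\<theta> a - gl_scale (\<phi> a) (weight_character \<mu>) \<in> borel_ideal" if "a \<in> N2" for a
  proof -
    let ?H = "{\<nu>. height index_rank \<mu> < height index_rank \<nu>}"
    let ?a = "wproj (- ?H) a"
    \<comment> \<open>The components above \<mu> lie in N1 and are killed by \<theta>, so a may be
      replaced by its part of height at most that of \<mu>.\<close>
    have "\<theta> a = \<theta> (wproj ?H a) + \<theta> ?a" unfolding linearD(1)[OF \<theta>, symmetric] wproj_compl[of a ?H, symmetric] ..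
    then have a: "\<theta> a = \<theta> ?a" using \<theta>_N1[OF top[OF that]] by simp
    have "\<mu> \<in> - ?H" by simp
    then have \<phi>a: "\<phi> a = \<phi> ?a" by (simp only: \<phi>_wproj if_True)
    have "\<theta> ?a - gl_scale (gl_eps (\<theta> ?a)) (weight_character \<mu>) \<in> borel_ideal"
    proof (rule weight_restrict_borel)
      have "(\<lambda>f. \<phi> (wproj {\<mu>} f)) = \<phi>" by (rule ext) (simp only: \<phi>_wproj singletonI if_True)
      then show "left_act (torus_fun (\<lambda>x. of_bool (x \<in> {\<mu>}))) (\<theta> ?a) = \<theta> ?a"
        unfolding \<theta>_def left_torus_left_act[OF \<phi>] by (simp only:)
      show "wproj (- ?H) (\<theta> ?a) = \<theta> ?a"
        unfolding wact_def \<theta>_act[OF torus_fun_functional] unfolding wact_def[symmetric] wproj_wproj Int_absorb ..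
    qed
    then show ?thesis unfolding \<theta>_eps a \<phi>a .
  qed
  have \<theta>_H0: "\<theta> a \<in> H0_minus \<mu>" if "a \<in> N2" for a
  proof -
    note tm = gl_tensor_map_tens[OF \<theta> id_linear]
    note sl = linearD[OF slice_left_linear[OF \<phi>]]
    let ?J = "{tens x y | x y. x \<in> (borel_ideal :: ('k, 'm, 'n) gl set)}"
    \<comment> \<open>The congruence for \<theta> on N2 is applied to the left tensor factors of
      \<Delta>(a), which lie in N2.\<close>
    have "gl_tensor_map \<theta> id t - tens (weight_character \<mu>) (slice_left \<phi> t) \<in> gl2.span ?J"
      if "t \<in> gl2.span {tens x y | x y. x \<in> N2}" for t
      using that
    proof (induction rule: gl2.span_induct_alt)
      case base
      show ?case
        unfolding linearD(3)[OF tm(2)] sl(3) linearD(3)[OF tens_linear(2)] by (simp add: gl2.span_zero)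
    next
      case (step c x y)
      then obtain a b where x: "x = tens a b" "a \<in> N2" by (elim CollectE exE conjE) (rule that)
      have "gl_tensor_map \<theta> id x - tens (weight_character \<mu>) (slice_left \<phi> x) = tens (\<theta> a - gl_scale (\<phi> a) (weight_character \<mu>)) b"
        unfolding x(1) tm(1) slice_tens[OF \<phi>] linearD(4)[OF tens_linear(1)] tens_scale by simp
      moreover have "tens (\<theta> a - gl_scale (\<phi> a) (weight_character \<mu>)) b \<in> gl2.span ?J"
        by (rule gl2.span_base, rule CollectI, rule exI, rule exI, rule conjI, rule refl, rule \<theta>_borel[OF x(2)])
      ultimately have "gl_tensor_map \<theta> id x - tens (weight_character \<mu>) (slice_left \<phi> x) \<in> gl2.span ?J" by (simp only:)
      from gl2.span_add[OF gl2.span_scale[OF this, of c] step(2)] show ?case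
        unfolding linearD(1,2)[OF tm(2)] sl(1,2) tens_add(2) tens_scale(2) gl2.scale_right_diff_distrib add_diff_add .
    qed
    from this[OF \<Delta>2[OF that]] show ?thesis
      unfolding H0_minus_def \<theta>_def mem_Collect_eq delta_left_act[OF \<phi>] unfolding left_act_def .
  qed
  \<comment> \<open>Preimages of subsupermodules are subsupermodules. Those containing N1 are N1 or
    N2: M = 0 gives the kernel, and general M the simplicity of the image.\<close>
  have pre: "act_closed {a \<in> N2. \<theta> a \<in> M}" if M: "act_closed M" for M
    unfolding act_closed_def
  proof (intro conjI gl.subspaceI allI impI ballI CollectI)
    note clN = act_closedD[OF N(2)] and clM = act_closedD[OF M]
    show "0 \<in> N2" "\<theta> 0 \<in> M" using clN(8) clM(8) by (simp_all only: linearD(3)[OF \<theta>])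
    fix x assume x: "x \<in> {a \<in> N2. \<theta> a \<in> M}"
    show "gl_scale c x \<in> N2" "\<theta> (gl_scale c x) \<in> M" for c
      using x clN(7) clM(7) by (simp_all add: linearD(2)[OF \<theta>])
    show "gl_part q x \<in> N2" "\<theta> (gl_part q x) \<in> M" for q
      using x clN(2) clM(2) by (simp_all add: \<theta>_part)
    show "right_act \<psi> x \<in> N2" "\<theta> (right_act \<psi> x) \<in> M" if "gl_functional \<psi>" for \<psi>
      using x clN(3)[OF that] clM(3)[OF that] by (simp_all add: \<theta>_act[OF that, symmetric])
    fix y assume y: "y \<in> {a \<in> N2. \<theta> a \<in> M}"
    show "x + y \<in> N2" "\<theta> (x + y) \<in> M"
      using x y clN(5) clM(5) by (simp_all add: linearD(1)[OF \<theta>])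
  qed
  have pre_cases: "{a \<in> N2. \<theta> a \<in> M} = N1 \<or> {a \<in> N2. \<theta> a \<in> M} = N2" if "act_closed M" for M
  proof (rule N(5)[OF pre[OF that]])
    show "N1 \<subseteq> {a \<in> N2. \<theta> a \<in> M}"
    proof (intro subsetI CollectI conjI)
      show "a \<in> N2" if "a \<in> N1" for a using that N(3) by blast
      show "\<theta> a \<in> M" if "a \<in> N1" for a unfolding \<theta>_N1[OF that] by (rule act_closedD(8)[OF \<open>act_closed M\<close>])
    qed
  qed simp
  have "gl_eps (0 :: ('k, 'm, 'n) gl) = 0" by (rule linearD(3)[OF gl_eps_functional])
  then have "\<theta> w \<noteq> 0" using \<theta>_eps[of w] \<open>\<phi> w = 1\<close> by auto
  then have ker: "{a \<in> N2. \<theta> a = 0} = N1"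
    using pre_cases[OF act_closed_0] w(1) by auto
  have "simple_section {0} (\<theta> ` N2)"
    unfolding simple_section_def subsupermodule_iff
  proof (intro conjI allI impI)
    show "act_closed {0 :: ('k, 'm, 'n) gl}" by (rule act_closed_0)
    show "act_closed (\<theta> ` N2)"
      unfolding act_closed_def
    proof (intro conjI gl.subspaceI allI impI ballI)
      show "0 \<in> \<theta> ` N2" by (rule image_eqI[of _ \<theta> 0]) (simp_all add: linearD(3)[OF \<theta>] act_closedD(8)[OF N(2)])
      show "x + y \<in> \<theta> ` N2" if "x \<in> \<theta> ` N2" "y \<in> \<theta> ` N2" for x y
      proof -
        from that obtain a c where "x = \<theta> a" "a \<in> N2" "y = \<theta> c" "c \<in> N2" by (elim imageE) (rule that)
        then show ?thesis by (intro image_eqI[of _ \<theta> "a + c"]) (simp_all add: linearD(1)[OF \<theta>] act_closedD(5)[OF N(2)])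
      qed
      show "gl_scale c x \<in> \<theta> ` N2" if "x \<in> \<theta> ` N2" for c x
      proof -
        from that obtain a where "x = \<theta> a" "a \<in> N2" by (elim imageE) (rule that)
        then show ?thesis by (intro image_eqI[of _ \<theta> "gl_scale c a"]) (simp_all add: linearD(2)[OF \<theta>] act_closedD(7)[OF N(2)])
      qed
      show "gl_part q x \<in> \<theta> ` N2" if "x \<in> \<theta> ` N2" for q x
      proof -
        from that obtain a where a: "x = \<theta> a" "a \<in> N2" by (elim imageE) (rule that)
        have "(p \<noteq> (p \<noteq> q)) = q" by auto
        then have "gl_part q x = \<theta> (gl_part (p \<noteq> q) a)" unfolding \<theta>_part a(1) by (simp only:)
        then show ?thesis by (rule image_eqI) (rule act_closedD(2)[OF N(2) a(2)])
      qed
      show "right_act \<psi> x \<in> \<theta> ` N2" if "gl_functional \<psi>" "x \<in> \<theta> ` N2" for \<psi> x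
      proof -
        from that(2) obtain a where a: "x = \<theta> a" "a \<in> N2" by (elim imageE) (rule that)
        have "right_act \<psi> x = \<theta> (right_act \<psi> a)" unfolding a(1) by (rule \<theta>_act[OF \<open>gl_functional \<psi>\<close>])
        then show ?thesis by (rule image_eqI) (rule act_closedD(3)[OF N(2) \<open>gl_functional \<psi>\<close> a(2)])
      qed
    qed
    then show "{0} \<subset> \<theta> ` N2" using \<open>\<theta> w \<noteq> 0\<close> w(1) act_closedD(8) by blast
    fix M assume M: "act_closed M \<and> {0} \<subseteq> M \<and> M \<subseteq> \<theta> ` N2"
    then show "M = {0} \<or> M = \<theta> ` N2"
      using pre_cases[of M] \<theta>_N1 by auto
  qed
  moreover have "\<theta> ` N2 \<subseteq> H0_minus \<mu>" using \<theta>_H0 by blast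
  ultimately have "L_minus \<mu> = \<theta> ` N2" by (rule L_minus_eqI)
  then have "section_iso p N1 N2 (L_minus \<mu>)"
    unfolding section_iso_def using \<theta> ker \<theta>_part delta_left_act[OF \<phi>]
    by (intro exI[of _ \<theta>]) (simp add: \<theta>_def)
  then show ?thesis ..
qed

section \<open>The degree decomposition\<close>

abbreviation degree_proj :: "int \<Rightarrow> ('k::field_char_0, 'm::finite, 'n::finite) gl \<Rightarrow> ('k, 'm, 'n) gl" where
  "degree_proj l \<equiv> wact (\<lambda>x. of_bool (weight_degree x = l))"

definition degree_part :: "int \<Rightarrow> ('k::field_char_0, 'm::finite, 'n::finite) gl set" where
  "degree_part l = {f. degree_proj l f = f}"

lemma weight_degree_add: "weight_degree (\<mu> + \<nu>) = weight_degree \<mu> + weight_degree \<nu>"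
  by (simp add: weight_degree_def sum.distrib)

lemma weight_degree_zero: "weight_degree 0 = 0"
  by (simp add: weight_degree_def)

lemma weight_degree_letter: "weight_degree (letter_weight t i) = (if t then 1 else -1)"
  by (simp add: weight_degree_def letter_weight_def unit_weight_def sum_negf)

lemma weight_degree_of:
  "length is = length ts \<Longrightarrow> weight_degree (weight_of ts is) = (\<Sum>t\<leftarrow>ts. if t then 1 else -1)"
proof (induction ts "is" rule: weight_of.induct)
  case (1 t ts i "is")
  then show ?case unfolding weight_of.simps weight_degree_add weight_degree_letter by simp
qed (auto simp: weight_degree_zero)

text \<open>Scalar matrices are central: in a matrix coefficient the degrees of the row list and of
  the column list are the same signed count of \<open>ts\<close>. Hence degree projections commute
  with right convolution.\<close>

lemma left_degree_act: "left_act (torus_fun (\<lambda>x. h (weight_degree x))) f = wact (\<lambda>x. h (weight_degree x)) f"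
proof (induction f rule: mcoef_induct)
  case (mcoef ts "is" js)
  show ?case unfolding left_torus_mcoef wact_mcoef weight_degree_of[OF mcoef(1)] weight_degree_of[OF mcoef(2)] ..
qed (simp_all only: linearD[OF left_act_linear[OF torus_fun_functional]] linearD[OF wact_linear])

lemma right_act_degree:
  assumes "gl_functional \<phi>"
  shows "right_act \<phi> (wact (\<lambda>x. h (weight_degree x)) f) = wact (\<lambda>x. h (weight_degree x)) (right_act \<phi> f)"
  unfolding left_degree_act[symmetric] by (rule right_left_act_commute[OF assms torus_fun_functional])

lemma act_closed_degree_part: "act_closed (degree_part l)"
  unfolding act_closed_def degree_part_def
  by (intro conjI gl.subspaceI allI impI ballI)
    (simp_all add: linearD[OF wact_linear] wact_part right_act_degree[where h = "\<lambda>d. of_bool (d = l)", symmetric])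

lemma degree_proj_in:
  fixes f :: "('k::field_char_0, 'm::finite, 'n::finite) gl"
  shows "degree_proj l f \<in> degree_part l"
proof -
  have "(\<lambda>x :: ('m, 'n) weight. of_bool (weight_degree x = l) * of_bool (weight_degree x = l)) = (\<lambda>x. of_bool (weight_degree x = l) :: 'k)" by auto
  then show ?thesis unfolding degree_part_def mem_Collect_eq wact_wact by (simp only:)
qed

lemma mcoef_degree:
  assumes "length js = length ts"
  shows "mcoef ts is js \<in> degree_part (\<Sum>t\<leftarrow>ts. if t then 1 else -1)"
  unfolding degree_part_def mem_Collect_eq wact_mcoef weight_degree_of[OF assms] by simp

lemma wproj_degree_part:
  assumes "f \<in> degree_part l" "weight_degree \<mu> \<noteq> l"
  shows "wproj {\<mu>} f = 0"
proof -
  have "wproj {\<mu>} f = wproj {\<mu>} (degree_proj l f)" using assms(1) by (simp add: degree_part_def)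
  also have "\<dots> = wact (\<lambda>_. 0) f"
    unfolding wact_wact using assms(2) by (intro arg_cong[of _ _ "\<lambda>h. wact h f"]) auto
  finally show ?thesis by (simp only: wact_zero)
qed

lemma degree_part_belongs:
  fixes N :: "('k::field_char_0, 'm::{finite, linorder}, 'n::{finite, linorder}) gl set"
  assumes "N \<subseteq> degree_part l"
  shows "belongs_to N (dominant_weights_of_degree l)"
  unfolding belongs_to_def
proof (intro allI impI, elim conjE)
  fix N1 N2 :: "('k, 'm, 'n) gl set"
  assume sec: "simple_section N1 N2" and sub: "N2 \<subseteq> N"
  note N = subsupermodule_section[OF sec]
  obtain \<mu> f where f: "f \<in> N2" "wproj {\<mu>} f \<notin> N1"
    and top: "\<And>g. g \<in> N2 \<Longrightarrow> wproj {\<nu>. height index_rank \<mu> < height index_rank \<nu>} g \<in> N1"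
    by (rule top_weight[OF sec, of "height index_rank"]) (rule that)
  have "\<mu> \<in> dominant_weights" by (rule top_weight_dominant[OF N(1,2) f top])
  moreover have "weight_degree \<mu> = l"
  proof (rule ccontr)
    assume "weight_degree \<mu> \<noteq> l"
    then have "wproj {\<mu>} f = 0" using f(1) sub assms by (intro wproj_degree_part) auto
    then show False using f(2) act_closedD(8)[OF N(1)] by simp
  qed
  ultimately have "\<mu> \<in> dominant_weights_of_degree l" by (simp add: dominant_weights_of_degree_def)
  moreover have "\<exists>p. section_iso p N1 N2 (L_minus \<mu>)" by (rule simple_section_iso[OF sec f top])
  ultimately show "\<exists>\<mu>\<in>dominant_weights_of_degree l. \<exists>p. section_iso p N1 N2 (L_minus \<mu>)" by (intro bexI[of _ \<mu>])
qed

lemma torus_character: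
  "torus.point (weight_character \<mu> :: ('k::field_char_0, 'm::{finite, linorder}, 'n::{finite, linorder}) gl) = Poly_Mapping.single \<mu> 1"
proof -
  let ?c = "\<lambda>a i. (\<lambda>k. a * of_bool (i = k)) :: ('m, 'n) weight"
  have c: "torus.point (cc i i ^ n :: ('k, 'm, 'n) gl) = Poly_Mapping.single (?c (int n) i) 1" for i n
  proof (induction n)
    case 0
    have "?c (int 0) i = 0" by (simp add: fun_eq_iff)
    then show ?case by (simp only: power_0 torus.point_simps single_one)
  next
    case (Suc n)
    have "unit_weight i + ?c (int n) i = ?c (int (Suc n)) i" by (simp add: fun_eq_iff unit_weight_def algebra_simps)
    with Suc show ?case by (simp only: power_Suc torus.point_simps torus_gen.simps simp_thms of_bool_eq mult_1_left mult_single)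
  qed
  have s: "torus.point (ss i i ^ n :: ('k, 'm, 'n) gl) = Poly_Mapping.single (?c (- int n) i) 1" for i n
  proof (induction n)
    case 0
    have "?c (- int 0) i = 0" by (simp add: fun_eq_iff)
    then show ?case by (simp only: power_0 torus.point_simps single_one)
  next
    case (Suc n)
    have "- unit_weight i + ?c (- int n) i = ?c (- int (Suc n)) i" by (simp add: fun_eq_iff unit_weight_def algebra_simps)
    with Suc show ?case by (simp only: power_Suc torus.point_simps torus_gen.simps simp_thms of_bool_eq mult_1_left mult_single)
  qed
  have f: "torus.point (char_factor a i :: ('k, 'm, 'n) gl) = Poly_Mapping.single (?c a i) 1" for a i
  proof -
    have "?c (int (nat a)) i + ?c (- int (nat (- a))) i = ?c a i" by (auto simp: fun_eq_iff)
    then show ?thesis by (simp only: char_factor_def torus.point_simps c s mult_single mult_1_left)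
  qed
  have "torus.point (prod_list (map (\<lambda>k. char_factor (\<mu> k) k) xs) :: ('k, 'm, 'n) gl)
      = Poly_Mapping.single (\<lambda>k. if k \<in> set xs then \<mu> k else 0) 1" if "distinct xs" for xs :: "('m + 'n) list"
    using that
  proof (induction xs)
    case Nil
    have "(\<lambda>k. if k \<in> set [] then \<mu> k else 0) = (0 :: ('m, 'n) weight)" by (simp add: fun_eq_iff)
    then show ?case by (simp only: list.map prod_list.Nil torus.point_simps single_one)
  next
    case (Cons i xs)
    have "?c (\<mu> i) i + (\<lambda>k. if k \<in> set xs then \<mu> k else 0) = (\<lambda>k. if k \<in> set (i # xs) then \<mu> k else 0)"
      using Cons.prems by (auto simp: fun_eq_iff)
    with Cons show ?case
      by (simp only: list.map prod_list.Cons torus.point_simps f mult_single mult_1_left distinct.simps)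
  qed
  from this[OF index_list_props(1)] show ?thesis
    unfolding weight_character_def char_factor_def by (simp add: index_list_props)
qed

text \<open>Apply to the defining congruence the functional that restricts to T and projects to
  degree |\<mu>|. It kills the ideal of B^-, since T lies in B^-, and is 1 on the character.
  Centrality of scalars turns the left degree into the right one.\<close>

lemma H0_minus_degree:
  fixes f :: "('k::field_char_0, 'm::{finite, linorder}, 'n::{finite, linorder}) gl"
  assumes "f \<in> H0_minus \<mu>"
  shows "f \<in> degree_part (weight_degree \<mu>)"
proof -
  let ?h = "\<lambda>x. of_bool (weight_degree x = weight_degree \<mu>) :: 'k"
  have "torus.point a = 0" if "a \<in> borel_ideal" for a :: "('k, 'm, 'n) gl"
    using that unfolding borel_ideal_def
  proof induction
    case (add x r a b)
    then obtain i j where "r = cc i j" "index_less i j" by blast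
    then have "torus.point r = 0" using index_less_order(1) by (auto simp: torus.point_simps)
    with add(3) show ?case by (simp only: torus.point_simps mult_zero_left mult_zero_right add_0_left)
  qed (simp only: torus.point_simps)
  then have 0: "torus_fun ?h a = 0" if "a \<in> borel_ideal" for a :: "('k, 'm, 'n) gl"
    using that by (simp add: torus_fun_def)
  have "gl_delta f - tens (weight_character \<mu>) f \<in> gl2.span {tens a b | a b. a \<in> borel_ideal}"
    using assms unfolding H0_minus_def mem_Collect_eq .
  then have "slice_left (torus_fun ?h) (gl_delta f - tens (weight_character \<mu>) f) = 0"
    by (rule slice_left_eq_0[OF torus_fun_functional 0, rotated])
  then have "left_act (torus_fun ?h) f = gl_scale (torus_fun ?h (weight_character \<mu>)) f"
    unfolding linearD(4)[OF slice_left_linear[OF torus_fun_functional]] slice_tens[OF torus_fun_functional] left_act_def by simp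
  moreover have "torus_fun ?h (weight_character \<mu>) = (1 :: 'k)"
    unfolding torus_fun_def torus_character by simp
  ultimately show ?thesis
    unfolding left_degree_act[where h = "\<lambda>d. of_bool (d = weight_degree \<mu>)"] by (simp add: degree_part_def)
qed

lemma section_iso_act:
  assumes \<theta>: "Vector_Spaces.linear gl_scale gl_scale \<theta>" "gl_delta (\<theta> f) = gl_tensor_map \<theta> id (gl_delta f)"
    and \<psi>: "gl_functional \<psi>"
  shows "right_act \<psi> (\<theta> f) = \<theta> (right_act \<psi> f)"
proof -
  note tm = gl_tensor_map_tens[OF \<theta>(1) id_linear]
  note sl = linearD[OF slice_right_linear[OF \<psi>]]
  have "slice_right \<psi> (gl_tensor_map \<theta> id t) = \<theta> (slice_right \<psi> t)" for t
  proof (induction t rule: gl2_induct)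
    case zero
    show ?case by (simp only: linearD(3)[OF tm(2)] sl(3) linearD(3)[OF \<theta>(1)])
  next
    case (add t u)
    then show ?case by (simp only: linearD(1)[OF tm(2)] sl(1) linearD(1)[OF \<theta>(1)])
  next
    case (tens a b p q)
    show ?case unfolding tm(1) slice_tens[OF \<psi>] linearD(2)[OF \<theta>(1)] by simp
  qed
  then show ?thesis unfolding right_act_def \<theta>(2) .
qed

lemma L_minus_degree: "L_minus \<mu> \<subseteq> degree_part (weight_degree \<mu>)"
  unfolding L_minus_def gl_socle_def
  by (rule gl.span_minimal) (use H0_minus_degree act_closedD(1)[OF act_closed_degree_part] in blast)+

text \<open>The elements of N without component of degree l form a subsupermodule. If it were
  nonzero, it would contain a simple one, isomorphic up to parity to L_-(\<mu>) with |\<mu>| = l and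
  hence of degree l, although its projection to degree l is 0.\<close>

lemma belongs_degree_part:
  fixes N :: "('k::field_char_0, 'm::{finite, linorder}, 'n::{finite, linorder}) gl set"
  assumes N: "act_closed N" and bel: "belongs_to N (dominant_weights_of_degree l)"
  shows "N \<subseteq> degree_part l"
proof
  fix f assume f: "f \<in> N"
  let ?D = "degree_proj l :: ('k, 'm, 'n) gl \<Rightarrow> ('k, 'm, 'n) gl"
  let ?N = "{x \<in> N. ?D x = 0}"
  have cl: "act_closed ?N"
    unfolding act_closed_def
  proof (intro conjI gl.subspaceI allI impI ballI CollectI)
    show "0 \<in> N" "?D 0 = 0" by (simp_all add: act_closedD(8)[OF N] linearD(3)[OF wact_linear])
    fix x assume x: "x \<in> ?N"
    show "gl_scale c x \<in> N" "?D (gl_scale c x) = 0" for c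
      using x act_closedD(7)[OF N] by (simp_all add: linearD(2)[OF wact_linear])
    show "gl_part q x \<in> N" "?D (gl_part q x) = 0" for q
      using x act_closedD(2)[OF N] by (simp_all add: wact_part)
    show "right_act \<psi> x \<in> N" if "gl_functional \<psi>" for \<psi> using x act_closedD(3)[OF N that] by simp
    show "?D (right_act \<psi> x) = 0" if "gl_functional \<psi>" for \<psi>
      unfolding right_act_degree[OF that, of "\<lambda>d. of_bool (d = l)", symmetric]
      using x by (simp add: linearD(3)[OF right_act_linear[OF that]])
    fix y assume "y \<in> ?N"
    with x show "x + y \<in> N" "?D (x + y) = 0"
      using act_closedD(5)[OF N] by (simp_all add: linearD(1)[OF wact_linear])
  qed
  have "f - ?D f \<in> N" by (intro act_closedD(6)[OF N f] act_closedD(4)[OF N f])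
  moreover have "?D (f - ?D f) = 0"
    using degree_proj_in[of l f] by (simp add: linearD(4)[OF wact_linear] degree_part_def)
  ultimately have fN: "f - ?D f \<in> ?N" by simp
  have "f - ?D f = 0"
  proof (rule ccontr)
    assume "f - ?D f \<noteq> 0"
    then obtain S where S: "simple_section {0} S" "S \<subseteq> ?N"
      by (rule simple_subsupermodule_exists[OF cl fN]) (rule that)
    then have "S \<subseteq> N" by blast
    with bel S(1) obtain \<mu> p where \<mu>: "\<mu> \<in> dominant_weights_of_degree l" "section_iso p {0} S (L_minus \<mu>)"
      unfolding belongs_to_def by blast
    from \<mu>(2) obtain \<theta> where \<theta>: "Vector_Spaces.linear gl_scale gl_scale \<theta>" "\<theta> ` S = L_minus \<mu>" "{f \<in> S. \<theta> f = 0} = {0}"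
      "\<And>x. x \<in> S \<Longrightarrow> gl_delta (\<theta> x) = gl_tensor_map \<theta> id (gl_delta x)"
      unfolding section_iso_def by (elim exE conjE) (rule that, auto)
    have deg: "weight_degree \<mu> = l" using \<mu>(1) by (simp add: dominant_weights_of_degree_def)
    note cS = subsupermodule_section[OF S(1)]
    obtain x where x: "x \<in> S" "x \<noteq> 0" using cS(3,4) by auto
    have "\<theta> x \<in> degree_part l" using L_minus_degree[of \<mu>] x(1) \<theta>(2) deg by blast
    then have "\<theta> x = ?D (\<theta> x)" by (simp add: degree_part_def)
    also have "\<dots> = \<theta> (?D x)"
      unfolding wact_def by (rule section_iso_act[OF \<theta>(1) \<theta>(4)[OF x(1)] torus_fun_functional])
    also have "?D x = 0" using x(1) S(2) by blast
    finally have "\<theta> x = 0" by (simp add: linearD(3)[OF \<theta>(1)])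
    then have "x \<in> {f \<in> S. \<theta> f = 0}" using x(1) by simp
    then show False unfolding \<theta>(3) using x(2) by simp
  qed
  then show "f \<in> degree_part l" by (simp add: degree_part_def)
qed

lemma C_sub_degree:
  "C_sub (dominant_weights_of_degree l) = (degree_part l :: ('k::field_char_0, 'm::{finite, linorder}, 'n::{finite, linorder}) gl set)"
proof
  have "N \<subseteq> degree_part l" if "subsupermodule N \<and> belongs_to N (dominant_weights_of_degree l)" for N :: "('k, 'm, 'n) gl set"
    using that by (intro belongs_degree_part) (simp_all add: subsupermodule_iff)
  then show "C_sub (dominant_weights_of_degree l) \<subseteq> (degree_part l :: ('k, 'm, 'n) gl set)"
    unfolding C_sub_def by (intro gl.span_minimal Union_least act_closedD(1) act_closed_degree_part) simp
  show "(degree_part l :: ('k, 'm, 'n) gl set) \<subseteq> C_sub (dominant_weights_of_degree l)"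
  proof
    fix f :: "('k, 'm, 'n) gl" assume f: "f \<in> degree_part l"
    have "degree_part l \<in> {N :: ('k, 'm, 'n) gl set. subsupermodule N \<and> belongs_to N (dominant_weights_of_degree l)}"
      by (simp add: subsupermodule_iff act_closed_degree_part degree_part_belongs)
    then show "f \<in> C_sub (dominant_weights_of_degree l)"
      unfolding C_sub_def by (rule gl.span_base[OF UnionI]) (rule f)
  qed
qed

section \<open>Powers of the augmentation ideal\<close>

text \<open>Unlike \<^term>\<open>aug_power\<close>, whose power with exponent 0 consists of the constants only, this takes the whole algebra
  as the zeroth power.\<close>

definition aug_ideal :: "nat \<Rightarrow> ('k::field_char_0, 'm::finite, 'n::finite) gl set" where
  "aug_ideal t = (if t = 0 then UNIV else aug_power t)"

lemma aug_power_prod: "length fs = t \<Longrightarrow> \<forall>f\<in>set fs. gl_eps f = 0 \<Longrightarrow> prod_list fs \<in> aug_power t"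
  unfolding aug_power_def by (intro gl.span_base CollectI exI[of _ fs] conjI) simp_all

lemma subspace_aug_power: "gl.subspace (aug_power t)"
  unfolding aug_power_def by simp

lemma aug_power_induct [consumes 1, case_names zero step]:
  assumes "f \<in> aug_power t" "P 0"
    "\<And>c fs g. length fs = t \<Longrightarrow> \<forall>f\<in>set fs. gl_eps f = 0 \<Longrightarrow> P g \<Longrightarrow> P (gl_scale c (prod_list fs) + g)"
  shows "P f"
  using assms(1) unfolding aug_power_def
proof (induction rule: gl.span_induct_alt)
  case (step c x y)
  then obtain fs where "x = prod_list fs" "length fs = t" "\<forall>f\<in>set fs. gl_eps f = 0" by blast
  then show ?case using assms(3) step by simp
qed (rule assms(2))

lemma aug_power_mult:
  assumes "f \<in> aug_power s" "g \<in> aug_power t"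
  shows "f * g \<in> aug_power (s + t)"
  using assms(1)
proof (induction rule: aug_power_induct)
  case zero
  show ?case using gl.subspace_0[OF subspace_aug_power] by simp
next
  case (step c fs f)
  have "prod_list fs * g \<in> aug_power (s + t)"
    using assms(2)
  proof (induction rule: aug_power_induct)
    case zero
    show ?case using gl.subspace_0[OF subspace_aug_power] by simp
  next
    case (step d gs g)
    have "prod_list (fs @ gs) \<in> aug_power (s + t)"
      using \<open>length fs = s\<close> \<open>\<forall>f\<in>set fs. gl_eps f = 0\<close> step(1,2) by (intro aug_power_prod) auto
    then have "prod_list fs * prod_list gs \<in> aug_power (s + t)" by simp
    with step(3) show ?case
      unfolding distrib_left gl_scale_mult(2)[symmetric]
      by (intro gl.subspace_add gl.subspace_scale subspace_aug_power)
  qed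
  with step(3) show ?case
    unfolding distrib_right gl_scale_mult(1)[symmetric]
    by (intro gl.subspace_add gl.subspace_scale subspace_aug_power)
qed

lemma aug_power_1: "gl_eps f = 0 \<Longrightarrow> f \<in> aug_power 1"
  using aug_power_prod[of "[f]" 1] by simp

lemma aug_power_Suc_subset: "aug_power (Suc (Suc t)) \<subseteq> aug_power (Suc t)"
proof
  fix f :: "('a, 'b, 'c) gl" assume "f \<in> aug_power (Suc (Suc t))"
  then show "f \<in> aug_power (Suc t)"
  proof (induction rule: aug_power_induct)
    case (step c fs g)
    from step(1) obtain f1 f2 fs' where fs: "fs = f1 # f2 # fs'" "length fs' = t" by (auto simp: length_Suc_conv)
    have "prod_list ((f1 * f2) # fs') \<in> aug_power (Suc t)"
      using step(2) fs by (intro aug_power_prod) (auto simp: gl_eps_simps)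
    then have "prod_list fs \<in> aug_power (Suc t)" by (simp add: fs mult.assoc)
    with step(3) show ?case by (intro gl.subspace_add gl.subspace_scale subspace_aug_power)
  qed (rule gl.subspace_0[OF subspace_aug_power])
qed

lemma eps_split: "f = (f - gl_scale (gl_eps f) 1) + gl_scale (gl_eps f) 1" "gl_eps (f - gl_scale (gl_eps f) 1) = 0"
  by (simp_all add: linearD(4)[OF gl_eps_functional] gl_eps_simps)

text \<open>Write a as a - \<epsilon>(a) plus a scalar: the first part gains an order of vanishing,
  the scalar keeps it.\<close>

lemma aug_power_ideal:
  assumes "f \<in> aug_power (Suc t)"
  shows "a * f \<in> aug_power (Suc t)" "f * a \<in> aug_power (Suc t)"
proof -
  let ?a = "a - gl_scale (gl_eps a) 1"
  have 1: "?a \<in> aug_power 1" by (intro aug_power_1 eps_split)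
  have "?a * f \<in> aug_power (Suc (Suc t))" "f * ?a \<in> aug_power (Suc (Suc t))"
    using aug_power_mult[OF 1 assms] aug_power_mult[OF assms 1] by simp_all
  then have "?a * f \<in> aug_power (Suc t)" "f * ?a \<in> aug_power (Suc t)" using aug_power_Suc_subset by blast+
  then have "?a * f + gl_scale (gl_eps a) f \<in> aug_power (Suc t)" "f * ?a + gl_scale (gl_eps a) f \<in> aug_power (Suc t)"
    using assms by (auto intro: gl.subspace_add gl.subspace_scale subspace_aug_power)
  moreover have "?a * f + gl_scale (gl_eps a) f = a * f" "f * ?a + gl_scale (gl_eps a) f = f * a"
    by (simp_all add: left_diff_distrib right_diff_distrib gl_scale_one_mult)
  ultimately show "a * f \<in> aug_power (Suc t)" "f * a \<in> aug_power (Suc t)" by simp_all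
qed

lemma subspace_aug_ideal: "gl.subspace (aug_ideal t)"
  by (simp add: aug_ideal_def subspace_aug_power)

lemmas aug_ideal_closed = gl.subspace_0[OF subspace_aug_ideal] gl.subspace_add[OF subspace_aug_ideal]
  gl.subspace_scale[OF subspace_aug_ideal] gl.subspace_diff[OF subspace_aug_ideal] gl.subspace_sum[OF subspace_aug_ideal]

lemma aug_ideal_ideal: "f \<in> aug_ideal t \<Longrightarrow> a * f \<in> aug_ideal t" "f \<in> aug_ideal t \<Longrightarrow> f * a \<in> aug_ideal t"
  by (cases t; simp add: aug_ideal_def aug_power_ideal)+

lemma aug_ideal_mult: "f \<in> aug_ideal s \<Longrightarrow> g \<in> aug_ideal t \<Longrightarrow> f * g \<in> aug_ideal (s + t)"
  by (cases s; cases t) (auto simp: aug_ideal_def aug_power_ideal dest: aug_power_mult)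

lemma aug_ideal_mono: "s \<le> t \<Longrightarrow> aug_ideal t \<subseteq> aug_ideal s"
proof (induction rule: dec_induct)
  case (step n)
  have "aug_ideal (Suc n) \<subseteq> aug_ideal n"
    using aug_power_Suc_subset by (cases n) (auto simp: aug_ideal_def)
  with step show ?case by blast
qed simp

lemma aug_ideal_1: "gl_eps f = 0 \<Longrightarrow> f \<in> aug_ideal 1"
  by (simp add: aug_ideal_def aug_power_1 del: One_nat_def)

lemma gl_eps_part: "gl_eps (gl_part p f) = (if p then 0 else gl_eps f)"
proof (induction f rule: mcoef_induct)
  case (mcoef ts "is" js)
  have "gl_eps (0 :: ('a, 'b, 'c) gl) = 0" by (rule linearD(3)[OF gl_eps_functional])
  with mcoef show ?case by (auto simp: gl_part_mcoef gl_eps_mcoef)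
qed (auto simp: gl_part_add gl_part_scale gl_eps_simps)

lemma aug_ideal_part: "f \<in> aug_ideal t \<Longrightarrow> gl_part p f \<in> aug_ideal t"
proof (cases t)
  case (Suc s)
  have *: "gl_part p (prod_list fs) \<in> aug_ideal (length fs)" if "\<forall>f\<in>set fs. gl_eps f = 0"
    for fs :: "('a, 'b, 'c) gl list" and p
    using that
  proof (induction fs arbitrary: p)
    case (Cons f fs)
    have "gl_part q f \<in> aug_ideal 1" for q using Cons.prems by (intro aug_ideal_1) (simp add: gl_eps_part)
    from aug_ideal_mult[OF this Cons.IH] Cons.prems
    have "gl_part q f * gl_part q' (prod_list fs) \<in> aug_ideal (length (f # fs))" for q q' by simp
    then show ?case by (simp only: prod_list.Cons gl_part_mult aug_ideal_closed)
  qed (simp add: aug_ideal_def)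
  assume "f \<in> aug_ideal t"
  then have "f \<in> aug_power (Suc s)" by (simp add: aug_ideal_def Suc)
  then have "gl_part p f \<in> aug_ideal (Suc s)"
  proof (induction rule: aug_power_induct)
    case (step c fs g)
    then show ?case using *[of fs p] by (simp only: gl_part_add gl_part_scale aug_ideal_closed)
  qed (simp only: gl_part_zero aug_ideal_closed)
  then show ?thesis by (simp only: Suc)
qed (simp add: aug_ideal_def)

lemma Dist_iff: "\<phi> \<in> Dist \<longleftrightarrow> gl_functional \<phi> \<and> (\<exists>t. \<forall>f\<in>aug_ideal (Suc t). \<phi> f = 0)"
  by (simp add: Dist_def aug_ideal_def)

lemma Dist_vanish:
  fixes \<phi> :: "('k::field_char_0, 'm::finite, 'n::finite) gl_fun"
  assumes "\<phi> \<in> Dist"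
  obtains t where "\<And>s f. t < s \<Longrightarrow> f \<in> aug_ideal s \<Longrightarrow> \<phi> f = 0"
proof -
  obtain t where t: "\<forall>f\<in>aug_ideal (Suc t). \<phi> f = 0" using assms by (auto simp: Dist_iff)
  show ?thesis
  proof (rule that)
    fix s and f :: "('k, 'm, 'n) gl" assume "t < s" "f \<in> aug_ideal s"
    then have "f \<in> aug_ideal (Suc t)" using aug_ideal_mono[of "Suc t" s] by auto
    then show "\<phi> f = 0" using t by blast
  qed
qed

lemma DistI:
  assumes "gl_functional \<phi>" "\<And>f. f \<in> aug_ideal (Suc t) \<Longrightarrow> \<phi> f = 0"
  shows "\<phi> \<in> Dist"
  using assms by (auto simp: Dist_iff)

section \<open>Comultiplication and the augmentation ideal\<close>

text \<open>The t-th power of the augmentation ideal of the tensor square, in the form of a sum of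
  m^i \<otimes> m^(t-i).\<close>

definition aug_tensor :: "nat \<Rightarrow> ('k::field_char_0, 'm::finite, 'n::finite) gl2 set" where
  "aug_tensor t = gl2.span (\<Union>i\<in>{..t}. (\<lambda>(a, b). tens a b) ` (aug_ideal i \<times> aug_ideal (t - i)))"

lemma aug_tensorI: "a \<in> aug_ideal i \<Longrightarrow> b \<in> aug_ideal j \<Longrightarrow> i + j = t \<Longrightarrow> tens a b \<in> aug_tensor t"
  unfolding aug_tensor_def by (intro gl2.span_base UN_I[of i] image_eqI[of _ _ "(a, b)"]) auto

lemma aug_tensor_induct [consumes 1, case_names zero step]:
  assumes "u \<in> aug_tensor t" "P 0"
    "\<And>c a b i j v. a \<in> aug_ideal i \<Longrightarrow> b \<in> aug_ideal j \<Longrightarrow> i + j = t \<Longrightarrow> P v \<Longrightarrow> P (gl2_scale c (tens a b) + v)"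
  shows "P u"
  using assms(1) unfolding aug_tensor_def
proof (induction rule: gl2.span_induct_alt)
  case (step c x y)
  then obtain i a b where "i \<le> t" "x = tens a b" "a \<in> aug_ideal i" "b \<in> aug_ideal (t - i)" by (elim UN_E imageE SigmaE) auto
  then show ?case using assms(3)[of a i b "t - i"] step by simp
qed (rule assms(2))

lemma subspace_aug_tensor: "gl2.subspace (aug_tensor t)"
  unfolding aug_tensor_def by simp

lemmas aug_tensor_closed = gl2.subspace_0[OF subspace_aug_tensor] gl2.subspace_add[OF subspace_aug_tensor]
  gl2.subspace_scale[OF subspace_aug_tensor] gl2.subspace_sum[OF subspace_aug_tensor]

lemma aug_tensor_mult:
  assumes "u \<in> aug_tensor s" "v \<in> aug_tensor t"
  shows "u * v \<in> aug_tensor (s + t)"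
  using assms(1)
proof (induction rule: aug_tensor_induct)
  case zero
  show ?case by (simp only: mult_zero_left aug_tensor_closed)
next
  case (step c a b i j w)
  have "tens a b * v \<in> aug_tensor (s + t)"
    using assms(2)
  proof (induction rule: aug_tensor_induct)
    case zero
    show ?case by (simp only: mult_zero_right aug_tensor_closed)
  next
    case (step d a' b' i' j' w')
    have "tens (a * gl_part q a') (gl_part p b * b') \<in> aug_tensor (s + t)" for p q
      using \<open>a \<in> aug_ideal i\<close> \<open>b \<in> aug_ideal j\<close> \<open>i + j = s\<close> step(1-3)
      by (intro aug_tensorI[of _ "i + i'" _ "j + j'"] aug_ideal_mult aug_ideal_part) auto
    then have "tens a b * tens a' b' \<in> aug_tensor (s + t)"
      unfolding times_gl2_tens tens_mult_aux_def by (intro aug_tensor_closed)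
    then show ?case
      unfolding times_gl2_linear by (intro aug_tensor_closed step(4))
  qed
  then show ?case
    unfolding times_gl2_linear by (intro aug_tensor_closed step(4))
qed

lemma tensor_eps_split:
  "u - gl2_scale (gl_eps (slice_right gl_eps u)) 1 \<in> (aug_tensor 1 :: ('k::field_char_0, 'm::finite, 'n::finite) gl2 set)"
proof (induction u rule: gl2_induct)
  note sl = linearD[OF slice_right_linear[OF gl_eps_functional]]
  {
    case zero
    show ?case by (simp add: sl linearD(3)[OF gl_eps_functional] aug_tensor_closed)
  next
    case (add t u)
    have "t + u - gl2_scale (gl_eps (slice_right gl_eps (t + u))) 1
        = (t - gl2_scale (gl_eps (slice_right gl_eps t)) 1) + (u - gl2_scale (gl_eps (slice_right gl_eps u)) 1)"
      unfolding sl(1) gl_eps_simps(1) gl2.scale_left_distrib by simp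
    then show ?case using add by (simp only: aug_tensor_closed)
  next
    case (tens a b p q)
    let ?a = "a - gl_scale (gl_eps a) 1" and ?b = "b - gl_scale (gl_eps b) 1"
    have "tens a b - gl2_scale (gl_eps (slice_right gl_eps (tens a b))) 1 = tens ?a b + gl2_scale (gl_eps a) (tens 1 ?b)"
      unfolding slice_tens[OF gl_eps_functional] gl_eps_simps linearD(4)[OF tens_linear(1)] linearD(4)[OF tens_linear(2)]
        tens_scale gl2.scale_right_diff_distrib one_gl2_def gl2.scale_scale mult.commute[of "gl_eps b"]
      by simp
    moreover have "tens ?a b \<in> aug_tensor 1" "tens 1 ?b \<in> aug_tensor 1"
      by (rule aug_tensorI[OF aug_ideal_1[OF eps_split(2)], of b 0]; simp add: aug_ideal_def)
        (rule aug_tensorI[OF _ aug_ideal_1[OF eps_split(2)], of 1 0]; simp add: aug_ideal_def)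
    ultimately show ?case by (simp only: aug_tensor_closed)
  }
qed

text \<open>\<Delta> is multiplicative and sends the augmentation ideal into that of the tensor
  square, so a product of factors lands in the corresponding power.\<close>

lemma gl_delta_aug_ideal:
  assumes "f \<in> aug_ideal (Suc t)"
  shows "gl_delta f \<in> aug_tensor (Suc t)"
proof -
  have 1: "gl_delta f \<in> aug_tensor 1" if "gl_eps f = 0" for f :: "('a, 'b, 'c) gl"
    using tensor_eps_split[of "gl_delta f"] that by (simp add: right_act_def[symmetric] act_eps)
  have P: "gl_delta (prod_list fs) \<in> aug_tensor (length fs)" if "\<forall>f\<in>set fs. gl_eps f = 0" for fs :: "('a, 'b, 'c) gl list"
    using that
  proof (induction fs)
    case Nil
    show ?case using aug_tensorI[of 1 0 1 0 0] by (simp add: gl_delta_simps one_gl2_def aug_ideal_def)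
  next
    case (Cons f fs)
    then show ?case using aug_tensor_mult[OF 1, of f] by (simp add: gl_delta_simps)
  qed
  have "f \<in> aug_power (Suc t)" using assms by (simp add: aug_ideal_def)
  then show ?thesis
  proof (induction rule: aug_power_induct)
    case zero
    show ?case by (simp only: linearD(3)[OF gl_delta_linear] aug_tensor_closed)
  next
    case (step c fs g)
    have "gl_delta (prod_list fs) \<in> aug_tensor (Suc t)" using P[OF step(2)] step(1) by simp
    then show ?case using step(3) by (simp only: linearD(1,2)[OF gl_delta_linear] aug_tensor_closed)
  qed
qed

section \<open>Multiplication of distributions\<close>

definition dist_pairing :: "('k, 'm, 'n) gl_fun \<Rightarrow> ('k, 'm, 'n) gl_fun \<Rightarrow> ('k::field_char_0, 'm::finite, 'n::finite) gl
    \<Rightarrow> ('k, 'm, 'n) gl \<Rightarrow> 'k" where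
  "dist_pairing \<phi> \<psi> f1 f2 = (\<Sum>p\<in>UNIV. \<Sum>q\<in>UNIV. ksign q p * \<phi> (gl_part p f1) * \<psi> (gl_part q f2))"

lemma dist_mult_pairing: "dist_mult \<phi> \<psi> f = tensor_lift (*) (dist_pairing \<phi> \<psi>) (gl_delta f)"
  unfolding dist_mult_def dist_pairing_def ..

lemma dist_pairing_bilinear:
  assumes "gl_functional \<phi>" "gl_functional \<psi>"
  shows "gl_bilinear (*) (dist_pairing \<phi> \<psi>)"
  unfolding gl_bilinear_def dist_pairing_def
  by (auto intro!: functional_intro simp: gl_part_add gl_part_scale linearD[OF assms(1)] linearD[OF assms(2)]
      algebra_simps sum.distrib sum_distrib_left)

context
  fixes \<phi> \<psi> :: "('k::field_char_0, 'm::finite, 'n::finite) gl_fun"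
  assumes lin: "gl_functional \<phi>" "gl_functional \<psi>"
begin

lemmas dist_lift = tensor_lift_tens[OF field_vector_space dist_pairing_bilinear[OF lin]]
  tensor_lift_linear[OF field_vector_space dist_pairing_bilinear[OF lin]]

lemma dist_mult_functional: "gl_functional (dist_mult \<phi> \<psi>)"
proof -
  have "dist_mult \<phi> \<psi> = (\<lambda>f. tensor_lift (*) (dist_pairing \<phi> \<psi>) (gl_delta f))"
    by (rule ext) (rule dist_mult_pairing)
  then show ?thesis using linear_compose[OF gl_delta_linear dist_lift(2)] by simp
qed

end

text \<open>If \<phi> kills order s+1 and \<psi> order t+1, the product kills order s+t+1: of two
  exponents with that sum, the first exceeds s or the second exceeds t.\<close>

lemma dist_mult_Dist:
  assumes "\<phi> \<in> Dist" "\<psi> \<in> Dist"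
  shows "dist_mult \<phi> \<psi> \<in> Dist"
proof -
  have lin: "gl_functional \<phi>" "gl_functional \<psi>" using assms by (auto simp: Dist_iff)
  obtain s where s: "\<And>r f. s < r \<Longrightarrow> f \<in> aug_ideal r \<Longrightarrow> \<phi> f = 0" using Dist_vanish[OF assms(1)] by blast
  obtain t where t: "\<And>r f. t < r \<Longrightarrow> f \<in> aug_ideal r \<Longrightarrow> \<psi> f = 0" using Dist_vanish[OF assms(2)] by blast
  have "tensor_lift (*) (dist_pairing \<phi> \<psi>) u = 0" if "u \<in> aug_tensor (Suc (s + t))" for u
    using that
  proof (induction rule: aug_tensor_induct)
    case (step c a b i j v)
    from step(3) consider "s < i" | "t < j" by linarith
    then have "dist_pairing \<phi> \<psi> a b = 0"
    proof cases
      case 1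
      then have "\<phi> (gl_part p a) = 0" for p using s aug_ideal_part step(1) by blast
      then show ?thesis by (simp add: dist_pairing_def)
    next
      case 2
      then have "\<psi> (gl_part p b) = 0" for p using t aug_ideal_part step(2) by blast
      then show ?thesis by (simp add: dist_pairing_def)
    qed
    with step(4) show ?case by (simp add: linearD[OF dist_lift(2)[OF lin]] dist_lift(1)[OF lin])
  qed (rule linearD(3)[OF dist_lift(2)[OF lin]])
  then show ?thesis
    by (intro DistI[of _ "s + t"] dist_mult_functional lin) (simp add: dist_mult_pairing gl_delta_aug_ideal)
qed

text \<open>K[G]_l is a subsupercoalgebra: the comultiplication of a matrix coefficient involves
  only coefficients with the same \<open>ts\<close>, hence of the same degree in both
  factors.\<close>

lemma dist_mult_vanish:
  assumes lin: "gl_functional \<phi>" "gl_functional \<psi>" and f: "f \<in> degree_part l"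
    and "(\<forall>a\<in>degree_part l. \<phi> a = 0) \<or> (\<forall>a\<in>degree_part l. \<psi> a = 0)"
  shows "dist_mult \<phi> \<psi> f = 0"
proof -
  have part: "gl_part p a \<in> degree_part l" if "a \<in> degree_part l" for a p
    by (rule act_closedD(2)[OF act_closed_degree_part that])
  have 0: "dist_pairing \<phi> \<psi> a b = 0" if "a \<in> degree_part l" "b \<in> degree_part l" for a b
    using assms(4)
  proof
    assume "\<forall>a\<in>degree_part l. \<phi> a = 0"
    then have "\<phi> (gl_part p a) = 0" for p using part[OF that(1)] by blast
    then show ?thesis by (simp add: dist_pairing_def)
  next
    assume "\<forall>a\<in>degree_part l. \<psi> a = 0"
    then have "\<psi> (gl_part p b) = 0" for p using part[OF that(2)] by blast
    then show ?thesis by (simp add: dist_pairing_def)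
  qed
  have "dist_mult \<phi> \<psi> (degree_proj l f) = 0" for f
  proof (induction f rule: mcoef_induct)
    case (mcoef ts "is" js)
    have "dist_mult \<phi> \<psi> (mcoef ts is js) = 0" if "(\<Sum>t\<leftarrow>ts. if t then 1 else -1) = l"
      unfolding dist_mult_pairing gl_delta_mcoef_sum linearD(6)[OF dist_lift(2)[OF lin]] dist_lift(1)[OF lin]
    proof (intro sum.neutral ballI 0)
      fix ks :: "('b + 'c) list" assume "ks \<in> idx (length ts)"
      then have "length ks = length ts" by (simp add: idx_def)
      then show "mcoef ts is ks \<in> degree_part l" unfolding that[symmetric] by (rule mcoef_degree)
      show "mcoef ts ks js \<in> degree_part l" unfolding that[symmetric] by (rule mcoef_degree[OF mcoef(2)])
    qed
    then show ?case
      unfolding wact_mcoef weight_degree_of[OF mcoef(2)] linearD(2)[OF dist_mult_functional[OF lin]] by auto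
  qed (simp_all add: linearD[OF wact_linear] linearD[OF dist_mult_functional[OF lin]])
  from this[of f] show ?thesis using f by (simp add: degree_part_def)
qed

lemma pi_kernel_iff:
  "\<xi> \<in> pi_kernel (dominant_weights_of_degree l) \<longleftrightarrow> \<xi> \<in> Dist \<and> (\<forall>f\<in>degree_part l. \<xi> f = 0)"
  unfolding pi_kernel_def pi_map_def C_sub_degree mem_Collect_eq
  by (auto simp: restrict_def fun_eq_iff)

lemma dist_superideal_pi_kernel:
  "dist_superideal (pi_kernel (dominant_weights_of_degree l) :: ('k::field_char_0, 'm::{finite, linorder}, 'n::{finite, linorder}) gl_fun set)"
  unfolding dist_superideal_def
proof (intro conjI ballI allI)
  let ?K = "pi_kernel (dominant_weights_of_degree l) :: ('k, 'm, 'n) gl_fun set"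
  show "?K \<subseteq> Dist" by (auto simp: pi_kernel_iff)
  show "(\<lambda>f. 0) \<in> ?K"
    unfolding pi_kernel_iff by (intro conjI DistI[of _ 0] functional_intro) simp_all
  fix \<phi> assume \<phi>: "\<phi> \<in> ?K"
  then have \<phi>D: "\<phi> \<in> Dist" and lin: "gl_functional \<phi>" and \<phi>0: "\<forall>f\<in>degree_part l. \<phi> f = 0"
    by (auto simp: pi_kernel_iff Dist_iff)
  obtain t where t: "\<And>r f. t < r \<Longrightarrow> f \<in> aug_ideal r \<Longrightarrow> \<phi> f = 0" using Dist_vanish[OF \<phi>D] by blast
  show "(\<lambda>f. c * \<phi> f) \<in> ?K" for c
    unfolding pi_kernel_iff
    by (intro conjI DistI[of _ t] functional_intro) (simp_all add: linearD[OF lin] distrib_left \<phi>0 t[of "Suc t"])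
  show "(\<lambda>f. \<phi> (gl_part p f)) \<in> ?K" for p
    unfolding pi_kernel_iff
    by (intro conjI DistI[of _ t] linear_compose[OF gl_part_linear lin])
      (simp_all add: t[of "Suc t"] aug_ideal_part \<phi>0 act_closedD(2)[OF act_closed_degree_part])
  show "(\<lambda>f. \<phi> f + \<psi> f) \<in> ?K" if \<psi>: "\<psi> \<in> ?K" for \<psi>
  proof -
    from \<psi> have \<psi>D: "\<psi> \<in> Dist" and lin': "gl_functional \<psi>" and \<psi>0: "\<forall>f\<in>degree_part l. \<psi> f = 0"
      by (auto simp: pi_kernel_iff Dist_iff)
    obtain s where s: "\<And>r f. s < r \<Longrightarrow> f \<in> aug_ideal r \<Longrightarrow> \<psi> f = 0" using Dist_vanish[OF \<psi>D] by blast
    show ?thesis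
      unfolding pi_kernel_iff
      by (intro conjI DistI[of _ "s + t"] functional_intro)
        (simp_all add: linearD[OF lin] linearD[OF lin'] distrib_left \<phi>0 \<psi>0 t[of "Suc (s + t)"] s[of "Suc (s + t)"])
  qed
  show "dist_mult \<phi> \<psi> \<in> ?K" "dist_mult \<psi> \<phi> \<in> ?K" if \<psi>: "\<psi> \<in> Dist" for \<psi>
  proof -
    have lin': "gl_functional \<psi>" using \<psi> by (simp add: Dist_iff)
    show "dist_mult \<phi> \<psi> \<in> ?K" "dist_mult \<psi> \<phi> \<in> ?K"
      unfolding pi_kernel_iff using dist_mult_Dist[OF \<phi>D \<psi>] dist_mult_Dist[OF \<psi> \<phi>D]
        dist_mult_vanish[OF lin lin'] dist_mult_vanish[OF lin' lin] \<phi>0 by blast+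
  qed
qed

section \<open>The Euler derivation\<close>

abbreviation degree_act :: "(int \<Rightarrow> 'k) \<Rightarrow> ('k::field_char_0, 'm::finite, 'n::finite) gl \<Rightarrow> ('k, 'm, 'n) gl" where
  "degree_act h \<equiv> wact (\<lambda>x. h (weight_degree x))"

lemma degree_act_on:
  fixes f :: "('k::field_char_0, 'm::finite, 'n::finite) gl"
  assumes "f \<in> degree_part d"
  shows "degree_act h f = gl_scale (h d) f"
proof -
  have e: "(\<lambda>x :: ('m, 'n) weight. h (weight_degree x) * of_bool (weight_degree x = d))
      = (\<lambda>x. h d * of_bool (weight_degree x = d))"
    by (rule ext) simp
  have f: "degree_proj d f = f" using assms by (simp add: degree_part_def)
  have "degree_act h (degree_proj d f) = gl_scale (h d) (degree_proj d f)"
    unfolding wact_wact e wact_scale ..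
  then show ?thesis by (simp only: f)
qed

lemma degree_part_closed:
  "0 \<in> degree_part d" "f \<in> degree_part d \<Longrightarrow> g \<in> degree_part d \<Longrightarrow> f + g \<in> degree_part d"
  "f \<in> degree_part d \<Longrightarrow> gl_scale c f \<in> degree_part d" "f \<in> degree_part d \<Longrightarrow> g \<in> degree_part d \<Longrightarrow> f - g \<in> degree_part d"
  using act_closedD(5-8)[OF act_closed_degree_part] by blast+

lemma mcoef_mult_degree:
  fixes ts ts' :: "bool list"
  assumes "length is = length ts" "length js = length ts" "length is' = length ts'" "length js' = length ts'"
  shows "(mcoef ts is js * mcoef ts' is' js' :: ('k::field_char_0, 'm::finite, 'n::finite) gl)
    \<in> degree_part ((\<Sum>t\<leftarrow>ts. if t then 1 else -1) + (\<Sum>t\<leftarrow>ts'. if t then 1 else -1))"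
proof -
  have "length (js @ js') = length (ts @ ts')" using assms by simp
  from mcoef_degree[OF this] show ?thesis
    unfolding mcoef_append[OF assms] by (intro degree_part_closed) simp
qed

lemma degree_part_mult:
  fixes f g :: "('k::field_char_0, 'm::finite, 'n::finite) gl"
  assumes "f \<in> degree_part a" "g \<in> degree_part b"
  shows "f * g \<in> degree_part (a + b)"
proof -
  have "degree_proj a f * degree_proj b g \<in> degree_part (a + b)" for f g :: "('k, 'm, 'n) gl"
  proof (induction f rule: mcoef_induct)
    case f: (mcoef ts "is" js)
    show ?case
    proof (induction g rule: mcoef_induct)
      case g: (mcoef ts' is' js')
      show ?case
        unfolding wact_mcoef weight_degree_of[OF f(2)] weight_degree_of[OF g(2)] gl_scale_mult[symmetric]
        using mcoef_mult_degree[OF f g] by (auto intro!: degree_part_closed)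
    qed (simp_all only: linearD[OF wact_linear] distrib_left gl_scale_mult[symmetric] degree_part_closed)
  qed (simp_all only: linearD[OF wact_linear] distrib_right gl_scale_mult[symmetric] degree_part_closed)
  from this[of f g] show ?thesis using assms by (simp add: degree_part_def)
qed

lemma degree_part_one: "1 \<in> degree_part 0"
  using mcoef_degree[of "[]" "[]" "[]"] by simp

lemma degree_part_diag: "cc i i \<in> degree_part 1" "ss i i \<in> degree_part (-1)"
  using mcoef_degree[of "[i]" "[True]" "[i]"] mcoef_degree[of "[i]" "[False]" "[i]"]
  unfolding mcoef_diag_Cons gl_ent_diag by simp_all

lemma degree_part_power: "f \<in> degree_part 0 \<Longrightarrow> f ^ n \<in> degree_part 0"
  by (induction n) (use degree_part_mult[of f 0 _ 0] in \<open>auto simp: degree_part_one\<close>)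

abbreviation euler :: "('k::field_char_0, 'm::finite, 'n::finite) gl \<Rightarrow> ('k, 'm, 'n) gl" where
  "euler \<equiv> degree_act of_int"

lemma euler_mult: "euler (f * g) = euler f * g + f * euler g"
proof (induction f rule: mcoef_induct)
  case f: (mcoef ts "is" js)
  show ?case
  proof (induction g rule: mcoef_induct)
    case g: (mcoef ts' is' js')
    show ?case
      unfolding degree_act_on[OF mcoef_mult_degree[OF f g]] degree_act_on[OF mcoef_degree[OF f(2)]]
        degree_act_on[OF mcoef_degree[OF g(2)]] gl_scale_mult[symmetric] of_int_add gl.scale_left_distrib ..
  qed (simp_all only: linearD[OF wact_linear] distrib_left gl_scale_mult[symmetric] gl.scale_right_distrib add_ac)
qed (simp_all only: linearD[OF wact_linear] distrib_right gl_scale_mult[symmetric] gl.scale_right_distrib add_ac)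

lemma euler_one: "euler 1 = 0"
  using degree_act_on[OF degree_part_one, of of_int] by simp

lemma aug_ideal_prod: "\<forall>f\<in>set fs. gl_eps f = 0 \<Longrightarrow> prod_list fs \<in> aug_ideal (length fs)"
  by (cases fs) (auto simp: aug_ideal_def intro!: aug_power_prod[of "_ # _", simplified])

lemma aug_ideal_power: "gl_eps f = 0 \<Longrightarrow> f ^ n \<in> aug_ideal n"
  using aug_ideal_prod[of "replicate n f"] by (simp add: prod_list_replicate)

lemma gl_eps_aug_ideal: "f \<in> aug_ideal (Suc t) \<Longrightarrow> gl_eps f = 0"
proof -
  assume "f \<in> aug_ideal (Suc t)"
  then have "f \<in> aug_power (Suc t)" by (simp add: aug_ideal_def)
  then show ?thesis
    by (induction rule: aug_power_induct) (auto simp: gl_eps_simps linearD(3)[OF gl_eps_functional] length_Suc_conv)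
qed

text \<open>In a product of functions vanishing at the identity a derivation hits one factor at a
  time, so at most one order of vanishing is lost.\<close>

lemma euler_aug_ideal:
  assumes "f \<in> aug_ideal (Suc t)"
  shows "euler f \<in> aug_ideal t"
proof -
  have P: "euler (prod_list fs) \<in> aug_ideal (length fs - 1)" if "\<forall>f\<in>set fs. gl_eps f = 0"
    for fs :: "('a, 'b, 'c) gl list"
    using that
  proof (induction fs)
    case Nil
    show ?case by (simp add: euler_one aug_ideal_closed)
  next
    case (Cons f fs)
    have "f * euler (prod_list fs) \<in> aug_ideal (1 + (length fs - 1))"
      using Cons by (intro aug_ideal_mult aug_ideal_1) auto
    then have "f * euler (prod_list fs) \<in> aug_ideal (length fs)"
      by (rule subsetD[OF aug_ideal_mono, rotated]) simp
    moreover have "euler f * prod_list fs \<in> aug_ideal (length fs)"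
      using Cons.prems by (intro aug_ideal_ideal aug_ideal_prod) simp
    ultimately show ?case by (simp add: euler_mult aug_ideal_closed)
  qed
  have "f \<in> aug_power (Suc t)" using assms by (simp add: aug_ideal_def)
  then show ?thesis
  proof (induction rule: aug_power_induct)
    case zero
    show ?case by (simp only: linearD(3)[OF wact_linear] aug_ideal_closed)
  next
    case (step c fs g)
    have "euler (prod_list fs) \<in> aug_ideal t" using P[OF step(2)] step(1) by simp
    then show ?case using step(3) by (simp only: linearD(1,2)[OF wact_linear] aug_ideal_closed)
  qed
qed

lemma degree_act_minus: "degree_act (\<lambda>d. of_int a - of_int d) f = gl_scale (of_int a) f - euler f"
  using wact_add[of "\<lambda>x. of_int a * 1" "\<lambda>x. - 1 * of_int (weight_degree x)" f]
  unfolding wact_scale wact_one by simp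

lemma gbinomial_Suc_factor:
  "((x :: 'k::field_char_0) gchoose Suc j) = inverse (of_nat (Suc j)) * ((x gchoose j) * (x - of_nat j))"
  using gbinomial_absorption[of j x] gbinomial_absorb_comp[of x j] by (simp add: field_simps del: of_nat_Suc)

text \<open>Up to a scalar the operator is a product of j shifted copies of the Euler derivation,
  each losing at most one order.\<close>

lemma degree_act_gchoose:
  assumes "f \<in> aug_ideal (t + j)"
  shows "degree_act (\<lambda>d. (of_int a - of_int d) gchoose j) f \<in> aug_ideal t"
  using assms
proof (induction j arbitrary: f)
  case 0
  then show ?case by (simp add: wact_one)
next
  case (Suc j)
  let ?g = "degree_act (\<lambda>d. of_int (a - int j) - of_int d) f"
  have "f \<in> aug_ideal (t + j)" using Suc.prems aug_ideal_mono[of "t + j" "t + Suc j"] by auto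
  then have "?g \<in> aug_ideal (t + j)"
    unfolding degree_act_minus using Suc.prems by (intro aug_ideal_closed euler_aug_ideal) simp_all
  then have "degree_act (\<lambda>d. (of_int a - of_int d) gchoose j) ?g \<in> aug_ideal t" by (rule Suc.IH)
  then have "gl_scale (inverse (of_nat (Suc j))) (degree_act (\<lambda>d. (of_int a - of_int d) gchoose j) ?g) \<in> aug_ideal t"
    by (rule aug_ideal_closed)
  moreover have "((of_int a - of_int d) gchoose Suc j)
      = inverse (of_nat (Suc j)) * (((of_int a - of_int d) gchoose j) * (of_int (a - int j) - of_int d) :: 'a)" for d
    unfolding gbinomial_Suc_factor by (simp add: algebra_simps)
  ultimately show ?case by (simp only: wact_wact wact_scale)
qed

section \<open>Truncated binomial series\<close>

context
  fixes i :: "'m::finite + 'n::finite" and t :: nat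
begin

abbreviation diag1 :: "('k::field_char_0, 'm, 'n) gl" where "diag1 \<equiv> cc i i - 1"

definition binom_trunc :: "int \<Rightarrow> ('k::field_char_0, 'm, 'n) gl" where
  "binom_trunc a = (\<Sum>j\<le>t. gl_scale (of_int a gchoose j) (diag1 ^ j))"

lemma diag1_eps: "gl_eps diag1 = 0"
  by (simp add: linearD(4)[OF gl_eps_functional] gl_eps_simps)

text \<open>Pascal's rule for the product with 1 + y, where y = c_ii - 1; truncation leaves only the
  term with y^(t+1) uncancelled, and it vanishes to order t+1.\<close>

lemma binom_trunc_step:
  "cc i i * binom_trunc a = binom_trunc (a + 1) + gl_scale (of_int a gchoose t) (diag1 ^ Suc t :: ('k::field_char_0, 'm, 'n) gl)"
proof -
  let ?y = "diag1 :: ('k, 'm, 'n) gl"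
  have "(1 + ?y) * (\<Sum>j\<le>s. gl_scale (x gchoose j) (?y ^ j))
      = (\<Sum>j\<le>s. gl_scale ((x + 1) gchoose j) (?y ^ j)) + gl_scale (x gchoose s) (?y ^ Suc s)" for s and x :: 'k
  proof (induction s)
    case (Suc s)
    have "(1 + ?y) * gl_scale (x gchoose Suc s) (?y ^ Suc s)
      = gl_scale (x gchoose Suc s) (?y ^ Suc s) + gl_scale (x gchoose Suc s) (?y ^ Suc (Suc s))"
      unfolding distrib_right mult_1_left gl_scale_mult(2)[symmetric] power_Suc gl.scale_right_distrib ..
    then show ?case
      unfolding sum.atMost_Suc distrib_left Suc gbinomial_Suc_Suc gl.scale_left_distrib by (simp only: add_ac)
  qed simp
  from this[of "of_int a" t] show ?thesis by (simp add: binom_trunc_def del: power_Suc)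
qed

lemma binom_trunc_0: "binom_trunc 0 = 1"
proof -
  have "(\<Sum>j\<le>s. gl_scale (0 gchoose j) (diag1 ^ j :: ('k::field_char_0, 'm, 'n) gl)) = 1" for s
    by (induction s) simp_all
  then show ?thesis by (simp add: binom_trunc_def)
qed

text \<open>s_ii c_ii = 1 - x, where x has augmentation 0 and degree 0. A geometric series in x
  corrects s_ii to an inverse of c_ii up to order t+1 without leaving degree -1.\<close>

lemma diag_inverse_trunc:
  obtains v :: "('k::field_char_0, 'm, 'n) gl" where "v \<in> degree_part (-1)" "v * cc i i - 1 \<in> aug_ideal (Suc t)"
proof
  let ?x = "1 - ss i i * cc i i :: ('k, 'm, 'n) gl"
  let ?v = "(\<Sum>k\<le>t. ?x ^ k) * ss i i"
  have "?x \<in> degree_part 0"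
    using degree_part_mult[OF degree_part_diag(2,1), of i i] by (intro degree_part_closed degree_part_one) simp
  then have "?x ^ k \<in> degree_part 0" for k by (rule degree_part_power)
  then have "(\<Sum>k\<le>t. ?x ^ k) \<in> degree_part 0"
    by (induction t) (simp_all add: degree_part_one degree_part_closed del: power_Suc)
  from degree_part_mult[OF this degree_part_diag(2)[of i]] show "?v \<in> degree_part (-1)" by simp
  have geo: "(\<Sum>k\<le>s. ?x ^ k) * (1 - ?x) = 1 - ?x ^ Suc s" for s
  proof (induction s)
    case (Suc s)
    have "(\<Sum>k\<le>Suc s. ?x ^ k) * (1 - ?x) = (1 - ?x ^ Suc s) + ?x ^ Suc s * (1 - ?x)"
      unfolding sum.atMost_Suc distrib_right Suc ..
    also have "\<dots> = 1 - ?x ^ Suc (Suc s)"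
      unfolding right_diff_distrib[of "?x ^ Suc s"] power_Suc2[of ?x "Suc s"] by simp
    finally show ?case .
  qed simp
  have "?v * cc i i - 1 = - (?x ^ Suc t)"
    using geo[of t] unfolding mult.assoc by simp
  also have "\<dots> = gl_scale (-1) (?x ^ Suc t)" by simp
  also have "\<dots> \<in> aug_ideal (Suc t)"
    by (intro aug_ideal_closed aug_ideal_power) (simp add: linearD(4)[OF gl_eps_functional] gl_eps_simps)
  finally show "?v * cc i i - 1 \<in> aug_ideal (Suc t)" .
qed

text \<open>By the binomial series \<^term>\<open>binom_trunc a\<close> is congruent to the \<^term>\<open>a\<close>-th power of \<^term>\<open>cc i i\<close>, where \<^term>\<open>ss i i\<close>
  serves as a first approximation of the inverse.\<close>

lemma binom_trunc_degree:
  "\<exists>u\<in>degree_part a. binom_trunc a - u \<in> (aug_ideal (Suc t) :: ('k::field_char_0, 'm, 'n) gl set)"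
proof (induction a rule: int_induct[of _ 0])
  case base
  show ?case
    by (intro bexI[of _ 1]) (simp_all add: binom_trunc_0 degree_part_one aug_ideal_closed)
next
  case (step1 a)
  then obtain u :: "('k, 'm, 'n) gl" where u: "u \<in> degree_part a" "binom_trunc a - u \<in> aug_ideal (Suc t)" by blast
  have "binom_trunc (a + 1) - cc i i * u
      = cc i i * (binom_trunc a - u) - gl_scale (of_int a gchoose t) (diag1 ^ Suc t)"
    unfolding right_diff_distrib binom_trunc_step by simp
  also have "\<dots> \<in> aug_ideal (Suc t)"
    by (intro aug_ideal_closed aug_ideal_ideal(1)[OF u(2)] aug_ideal_power diag1_eps)
  finally show ?case
    using degree_part_mult[OF degree_part_diag(1)[of i] u(1)] by (auto simp: add.commute)
next
  case (step2 a)
  then obtain u :: "('k, 'm, 'n) gl" where u: "u \<in> degree_part a" "binom_trunc a - u \<in> aug_ideal (Suc t)" by blast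
  obtain v :: "('k, 'm, 'n) gl" where v: "v \<in> degree_part (-1)" "v * cc i i - 1 \<in> aug_ideal (Suc t)"
    by (rule diag_inverse_trunc)
  have "binom_trunc (a - 1) - v * u = v * (cc i i * binom_trunc (a - 1) - binom_trunc a) + v * (binom_trunc a - u)
      - (v * cc i i - 1) * binom_trunc (a - 1)"
    by (simp add: right_diff_distrib left_diff_distrib mult.assoc)
  also have "cc i i * binom_trunc (a - 1) - binom_trunc a = gl_scale (of_int (a - 1) gchoose t) (diag1 ^ Suc t :: ('k, 'm, 'n) gl)"
    unfolding binom_trunc_step by simp
  also have "v * gl_scale (of_int (a - 1) gchoose t) (diag1 ^ Suc t) + v * (binom_trunc a - u)
      - (v * cc i i - 1) * binom_trunc (a - 1) \<in> aug_ideal (Suc t)"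
    by (intro aug_ideal_closed aug_ideal_ideal(1)[OF u(2)] aug_ideal_ideal(2)[OF v(2)]
        aug_ideal_ideal(1)[OF aug_ideal_closed(3)[OF aug_ideal_power[OF diag1_eps]]])
  finally show ?case
    using degree_part_mult[OF v(1) u(1)] by auto
qed

end

section \<open>Factorization of the kernel\<close>

text \<open>For even \<phi> the Koszul sign is trivial, so multiplication by \<phi> from the left is
  precomposition with left convolution.\<close>

lemma dist_mult_even:
  fixes \<phi> \<psi> :: "('k::field_char_0, 'm::finite, 'n::finite) gl_fun"
  assumes lin: "gl_functional \<phi>" "gl_functional \<psi>" and even: "\<And>a. \<phi> (gl_part True a) = 0"
  shows "dist_mult \<phi> \<psi> f = \<psi> (left_act \<phi> f)"
proof -
  have p: "dist_pairing \<phi> \<psi> a b = \<phi> a * \<psi> b" for a b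
  proof -
    have "\<phi> a = \<phi> (gl_part False a)" "\<psi> b = \<psi> (gl_part True b) + \<psi> (gl_part False b)"
      using arg_cong[OF gl_part_sum_parts[of a], of \<phi>] arg_cong[OF gl_part_sum_parts[of b], of \<psi>]
      by (simp_all add: linearD[OF lin(1)] linearD[OF lin(2)] even)
    then show ?thesis by (simp add: dist_pairing_def UNIV_bool even algebra_simps)
  qed
  have "tensor_lift (*) (dist_pairing \<phi> \<psi>) u = \<psi> (slice_left \<phi> u)" for u
  proof (induction u rule: gl2_induct)
    case (tens a b q r)
    show ?case unfolding slice_tens[OF lin(1)] linearD(2)[OF lin(2)] by (rule trans[OF dist_lift(1)[OF lin] p])
  qed (simp_all only: linearD[OF dist_lift(2)[OF lin]] linearD[OF slice_left_linear[OF lin(1)]] linearD[OF lin(2)])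
  then show ?thesis by (simp add: dist_mult_pairing left_act_def)
qed

text \<open>The element z - l for the Euler element z; convolution with it multiplies degree d by d
  - l.\<close>

definition shifted_euler :: "int \<Rightarrow> ('k::field_char_0, 'm::finite, 'n::finite) gl_fun" where
  "shifted_euler l = torus_fun (\<lambda>x. of_int (weight_degree x) - of_int l)"

lemma shifted_euler_functional: "gl_functional (shifted_euler l)"
  unfolding shifted_euler_def by (rule torus_fun_functional)

lemma shifted_euler_left_act: "left_act (shifted_euler l) f = degree_act (\<lambda>d. of_int d - of_int l) f"
  unfolding shifted_euler_def by (rule left_degree_act)

lemma shifted_euler_eps: "shifted_euler l f = gl_eps (degree_act (\<lambda>d. of_int d - of_int l) f)"
  unfolding shifted_euler_left_act[symmetric] eps_act(2)[OF shifted_euler_functional] ..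

lemma torus_point_ideal: "a \<in> torus_ideal \<Longrightarrow> torus.point a = 0"
  unfolding torus_ideal_def
proof (induction rule: ideal_gen.induct)
  case (add x r a b)
  then obtain i j where "r = cc i j" "i \<noteq> j" by blast
  then have "torus.point r = 0" by (auto simp: torus.point_simps)
  with add(3) show ?case by (simp only: torus.point_simps mult_zero_left mult_zero_right add_0_left)
qed (simp only: torus.point_simps)

lemma shifted_euler_DistT: "shifted_euler l \<in> (DistT :: ('k::field_char_0, 'm::finite, 'n::finite) gl_fun set)"
proof -
  have "shifted_euler l f = 0" if "f \<in> aug_ideal (Suc 1)" for f :: "('k, 'm, 'n) gl"
  proof -
    have "degree_act (\<lambda>d. of_int d - of_int l) f = euler f + gl_scale (- of_int l) f"
      using wact_add[of "\<lambda>x. of_int (weight_degree x)" "\<lambda>x. - of_int l * 1" f] unfolding wact_scale wact_one by simp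
    moreover have "gl_eps (euler f) = 0" using euler_aug_ideal[OF that] by (intro gl_eps_aug_ideal[of _ 0]) simp
    moreover have "gl_eps f = 0" by (rule gl_eps_aug_ideal[OF that])
    ultimately show ?thesis by (simp add: shifted_euler_eps gl_eps_simps linearD(4)[OF gl_eps_functional])
  qed
  then have "shifted_euler l \<in> (Dist :: ('k, 'm, 'n) gl_fun set)"
    by (rule DistI[OF shifted_euler_functional])
  moreover have "shifted_euler l f = 0" if "f \<in> torus_ideal" for f :: "('k, 'm, 'n) gl"
    using torus_point_ideal[OF that] by (simp add: shifted_euler_def torus_fun_def)
  ultimately show ?thesis by (simp add: DistT_def)
qed

lemma shifted_euler_degree_part: "f \<in> degree_part l \<Longrightarrow> shifted_euler l f = 0"
  unfolding shifted_euler_eps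
  by (simp add: degree_act_on[where h = "\<lambda>d. of_int d - of_int l"] linearD(3)[OF gl_eps_functional])

lemma shifted_euler_part: "shifted_euler l (gl_part True f) = 0"
  unfolding shifted_euler_eps wact_part gl_eps_part by simp

text \<open>If \<^term>\<open>\<xi>\<close> kills degree \<^term>\<open>l\<close> and \<^term>\<open>aug_ideal (Suc t)\<close>, then by \<open>binom_trunc_degree\<close> it kills
  \<^term>\<open>binom_trunc i t (l - d) * f\<close> for \<^term>\<open>f\<close> of degree \<^term>\<open>d\<close>.  Solving for \<^term>\<open>\<xi> f\<close>, all remaining terms have the
  factor \<^term>\<open>l - d\<close>.\<close>

lemma shifted_euler_factor:
  fixes \<xi> :: "('k::field_char_0, 'm::finite, 'n::finite) gl_fun"
  assumes \<xi>: "\<xi> \<in> Dist" and van: "\<And>f. f \<in> degree_part l \<Longrightarrow> \<xi> f = 0"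
  obtains \<eta> where "\<eta> \<in> Dist" "\<xi> = dist_mult (shifted_euler l) \<eta>"
proof -
  obtain t where t: "\<And>s f. t < s \<Longrightarrow> f \<in> aug_ideal s \<Longrightarrow> \<xi> f = 0" using Dist_vanish[OF \<xi>] by blast
  have lin: "gl_functional \<xi>" using \<xi> by (simp add: Dist_iff)
  \<comment> \<open>Any diagonal index serves.\<close>
  obtain i :: "'m + 'n" where True by blast
  let ?y = "cc i i - 1 :: ('k, 'm, 'n) gl"
  let ?b = "\<lambda>j :: nat. degree_act (\<lambda>d. (of_int (l - 1) - of_int d) gchoose j) :: ('k, 'm, 'n) gl \<Rightarrow> ('k, 'm, 'n) gl"
  \<comment> \<open>With e = l - d, absorption reads (e choose j+1) = e/(j+1) times (e-1 choose j).
    The factor e is left to z - l, and (e-1 choose j) becomes the degree operator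
    \<open>?b j\<close>.\<close>
  define \<eta> where "\<eta> f = (\<Sum>j<t. inverse (of_nat (Suc j)) * \<xi> (?y ^ Suc j * ?b j f))" for f
  have \<eta>lin: "gl_functional \<eta>"
    unfolding \<eta>_def
    by (rule functional_intro)
      (simp_all only: linearD[OF wact_linear] distrib_left gl_scale_mult[symmetric] linearD[OF lin] sum.distrib sum_distrib_left mult.left_commute)
  \<comment> \<open>\<open>?b j\<close> loses at most j < t orders, so from order 2t+1 at least t+1
    remain, where \<xi> vanishes.\<close>
  have "\<eta> f = 0" if f: "f \<in> aug_ideal (Suc (2 * t))" for f
    unfolding \<eta>_def
  proof (intro sum.neutral ballI)
    fix j assume "j \<in> {..<t}"
    then have "f \<in> aug_ideal (Suc t + j)" using f by (intro subsetD[OF aug_ideal_mono f]) simp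
    then have "?y ^ Suc j * ?b j f \<in> aug_ideal (Suc t)" by (intro aug_ideal_ideal degree_act_gchoose)
    then have "\<xi> (?y ^ Suc j * ?b j f) = 0" by (rule t[rotated]) simp
    then show "inverse (of_nat (Suc j)) * \<xi> (?y ^ Suc j * ?b j f) = 0" by simp
  qed
  then have \<eta>: "\<eta> \<in> Dist" by (rule DistI[OF \<eta>lin])
  have "\<xi> f = \<eta> (left_act (shifted_euler l) f)" for f
  proof (rule linear_eq_on_mcoef[OF lin linear_compose[OF left_act_linear[OF shifted_euler_functional] \<eta>lin]])
    fix ts :: "bool list" and "is" js :: "('m + 'n) list"
    assume "length js = length ts"
    let ?m = "mcoef ts is js :: ('k, 'm, 'n) gl"
    define d :: int where "d = (\<Sum>t\<leftarrow>ts. if t then 1 else -1)"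
    have m: "?m \<in> degree_part d" unfolding d_def by (rule mcoef_degree) fact
    define e :: 'k where "e = of_int (l - d)"
    have e1: "of_int (l - 1) - of_int d = e - 1" "of_int d - of_int l = - e" by (simp_all add: e_def)
    obtain u where u: "u \<in> degree_part (l - d)" "binom_trunc i t (l - d) - u \<in> (aug_ideal (Suc t) :: ('k, 'm, 'n) gl set)"
      using binom_trunc_degree by blast
    have "\<xi> (u * ?m) = 0" using degree_part_mult[OF u(1) m] by (intro van) simp
    moreover have "\<xi> ((binom_trunc i t (l - d) - u) * ?m) = 0"
      by (rule t[of "Suc t"]) (use aug_ideal_ideal(2)[OF u(2)] in simp_all)
    ultimately have "\<xi> (binom_trunc i t (l - d) * ?m) = 0"
      unfolding left_diff_distrib linearD(4)[OF lin] by simp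
    then have "(\<Sum>j\<le>t. (e gchoose j) * \<xi> (?y ^ j * ?m)) = 0"
      unfolding binom_trunc_def sum_distrib_right gl_scale_mult(1)[symmetric] linearD(6)[OF lin] linearD(2)[OF lin] e_def .
    \<comment> \<open>The term j = 0 is split off: its binomial coefficient is 1 and its power of y
      is trivial.\<close>
    then have "\<xi> ?m + (\<Sum>j<t. (e gchoose Suc j) * \<xi> (?y ^ Suc j * ?m)) = 0"
      by (simp add: sum.atMost_shift del: power_Suc)
    moreover have "\<eta> (left_act (shifted_euler l) ?m) = (\<Sum>j<t. - ((e gchoose Suc j) * \<xi> (?y ^ Suc j * ?m)))"
    proof -
      \<comment> \<open>The eigenvalue d - l = -e supplies the sign of moving the sum to the other
        side.\<close>
      have "left_act (shifted_euler l) ?m = gl_scale (- e) ?m"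
        unfolding shifted_euler_left_act degree_act_on[OF m, of "\<lambda>d. of_int d - of_int l"] e1 ..
      then have "\<eta> (left_act (shifted_euler l) ?m) = - e * \<eta> ?m" by (simp only: linearD(2)[OF \<eta>lin])
      also have "\<dots> = (\<Sum>j<t. - e * (inverse (of_nat (Suc j)) * ((e - 1 gchoose j) * \<xi> (?y ^ Suc j * ?m))))"
        unfolding \<eta>_def sum_distrib_left degree_act_on[OF m, of "\<lambda>d. (of_int (l - 1) - of_int d) gchoose _"] e1
          gl_scale_mult(2)[symmetric] linearD(2)[OF lin] ..
      also have "\<dots> = (\<Sum>j<t. - ((e gchoose Suc j) * \<xi> (?y ^ Suc j * ?m)))"
      proof (rule sum.cong[OF refl])
        fix j
        show "- e * (inverse (of_nat (Suc j)) * ((e - 1 gchoose j) * x)) = - ((e gchoose Suc j) * x)" for x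
          using gbinomial_absorption[of j e] by (simp add: field_simps del: of_nat_Suc)
      qed
      finally show ?thesis .
    qed
    ultimately show "\<xi> ?m = \<eta> (left_act (shifted_euler l) ?m)"
      unfolding sum_negf eq_neg_iff_add_eq_0[symmetric] by (rule trans[OF _ sym])
  qed
  then have "\<xi> = dist_mult (shifted_euler l) \<eta>"
    by (intro ext) (simp add: dist_mult_even shifted_euler_functional \<eta>lin shifted_euler_part)
  with \<eta> show thesis by (rule that)
qed

theorem theorem14p2:
  fixes l :: int
  shows "(pi_kernel (dominant_weights_of_degree l)
            :: ('k::field_char_0, 'm::{finite, linorder}, 'n::{finite, linorder}) gl_fun set)
         = dist_superideal_gen (pi_kernel (dominant_weights_of_degree l) \<inter> DistT)"
proof
  let ?K = "pi_kernel (dominant_weights_of_degree l) :: ('k, 'm, 'n) gl_fun set"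
  show "dist_superideal_gen (?K \<inter> DistT) \<subseteq> ?K"
    unfolding dist_superideal_gen_def using dist_superideal_pi_kernel by blast
  \<comment> \<open>Since z - l lies in J_l, the factorization exhibits every element of the kernel
    as a multiple of this single member.\<close>
  have "shifted_euler l \<in> ?K \<inter> DistT"
    using shifted_euler_DistT shifted_euler_degree_part by (auto simp: pi_kernel_iff DistT_def)
  then have zeta: "shifted_euler l \<in> I" if "?K \<inter> DistT \<subseteq> I" for I using that by blast
  show "?K \<subseteq> dist_superideal_gen (?K \<inter> DistT)"
    unfolding dist_superideal_gen_def
  proof (intro subsetI InterI, elim CollectE conjE)
    fix \<xi> I assume "\<xi> \<in> ?K" and I: "dist_superideal I" "?K \<inter> DistT \<subseteq> I"
    then obtain \<eta> where \<eta>: "\<eta> \<in> Dist" "\<xi> = dist_mult (shifted_euler l) \<eta>"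
      using shifted_euler_factor[of \<xi> l] unfolding pi_kernel_iff by blast
    with I(1) zeta[OF I(2)] show "\<xi> \<in> I" by (simp add: dist_superideal_def)
  qed
qed

end
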